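(* Let $n\ge 1$ and $\alpha\in(0,1]$. There exist constants $C(\alpha,n)>0$ and $c=c(n,\alpha)>0$ such that for every centered probability measure $f\,d\gamma$ on $\mathbb{R}^n$ with $\sqrt f\in W^{1,2}(\mathbb{R}^n,d\gamma)$ and $f\ge\alpha$, there exist $a_f\in\mathbb{R}^n$ and $b_f\in\mathbb{R}$ with $|a_f|+|b_f|\le c$ such that, with $L(x)=a_f\cdot x+b_f$, $$\|\log f-L\|_{L^1(d\gamma)}\le C(\alpha,n)\,\delta(f)^{\frac12}.$$
   Context: On $\mathbb{R}^n$, $d\gamma=(2\pi)^{-n/2}e^{-|x|^2/2}dx$ is the standard Gaussian measure. For a probability measure $f\,d\gamma$ with $\sqrt f\in W^{1,2}(\mathbb{R}^n,d\gamma)$, the Fisher information is $\mathrm{I}(f)=\int \frac{|\nabla f|^2}{f}\,d\gamma$, the relative entropy is $\mathrm{H}(f)=\int f\log f\,d\gamma$, and the log-Sobolev deficit is $\delta(f)=\frac12 \mathrm{I}(f)-\mathrm{H}(f)\ge 0$. A probability measure $\mu$ is centered if $\int x\,d\mu=0$. *)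

theory Defs
  imports "HOL-Analysis.Analysis" "HOL-Probability.Probability"
begin

definition gaussian :: "(real ^ 'n) measure" where
  "gaussian = density lborel
     (\<lambda>x. ennreal ((2 * pi) powr (- real CARD('n) / 2) * exp (- (norm x)\<^sup>2 / 2)))"

definition partial_deriv :: "'n \<Rightarrow> (real ^ 'n \<Rightarrow> real) \<Rightarrow> real ^ 'n \<Rightarrow> real" where
  "partial_deriv i \<phi> x = frechet_derivative \<phi> (at x) (axis i 1)"

primrec Ck :: "nat \<Rightarrow> (real ^ 'n \<Rightarrow> real) \<Rightarrow> bool" where
  "Ck 0 \<phi> \<longleftrightarrow> continuous_on UNIV \<phi>"
| "Ck (Suc k) \<phi> \<longleftrightarrow> (\<forall>x. \<phi> differentiable (at x)) \<and> (\<forall>i. Ck k (partial_deriv i \<phi>))"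

definition test_function :: "(real ^ 'n \<Rightarrow> real) \<Rightarrow> bool" where
  "test_function \<phi> \<longleftrightarrow> (\<forall>k. Ck k \<phi>) \<and> compact (closure {x. \<phi> x \<noteq> 0})"

definition locally_integrable :: "(real ^ 'n \<Rightarrow> 'b::{banach, second_countable_topology}) \<Rightarrow> bool" where
  "locally_integrable u \<longleftrightarrow> (\<forall>K. compact K \<longrightarrow> set_integrable lborel K u)"

definition has_weak_gradient :: "(real ^ 'n \<Rightarrow> real) \<Rightarrow> (real ^ 'n \<Rightarrow> real ^ 'n) \<Rightarrow> bool" where
  "has_weak_gradient u g \<longleftrightarrow> locally_integrable u \<and> locally_integrable g \<and>
     (\<forall>\<phi> i. test_function \<phi> \<longrightarrow>
        (\<integral>x. u x * partial_deriv i \<phi> x \<partial>lborel) = - (\<integral>x. g x $ i * \<phi> x \<partial>lborel))"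

text \<open>Weak gradients are unique only up to null sets; the choice made here is immaterial below,
  because \<open>weak_gradient\<close> occurs only under integrals. It is meaningful only for functions that
  possess a weak gradient, as every \<open>f\<close> with \<open>sqrt f\<close> in the Gaussian Sobolev space does.\<close>

definition weak_gradient :: "(real ^ 'n \<Rightarrow> real) \<Rightarrow> real ^ 'n \<Rightarrow> real ^ 'n" where
  "weak_gradient u = (SOME g. has_weak_gradient u g)"

definition gaussian_W12 :: "(real ^ 'n \<Rightarrow> real) \<Rightarrow> bool" where
  "gaussian_W12 u \<longleftrightarrow> integrable gaussian (\<lambda>x. (u x)\<^sup>2) \<and>
     (\<exists>g. has_weak_gradient u g \<and> integrable gaussian (\<lambda>x. (norm (g x))\<^sup>2))"

text \<open>The nonnegativity clause is needed because \<open>ennreal\<close> sends negative numbers to \<open>0\<close>.\<close>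

definition gaussian_prob_density :: "(real ^ 'n \<Rightarrow> real) \<Rightarrow> bool" where
  "gaussian_prob_density f \<longleftrightarrow> f \<in> borel_measurable borel \<and> (AE x in gaussian. 0 \<le> f x) \<and>
     prob_space (density gaussian (\<lambda>x. ennreal (f x)))"

text \<open>Integrability is required explicitly, since the Bochner integral of a non-integrable function
  is \<open>0\<close> by convention.\<close>

definition centered :: "(real ^ 'n) measure \<Rightarrow> bool" where
  "centered \<mu> \<longleftrightarrow> integrable \<mu> (\<lambda>x. x) \<and> (\<integral>x. x \<partial>\<mu>) = 0"

text \<open>If \<open>f\<close> is a Gaussian probability density and \<open>sqrt f\<close> is in the Gaussian Sobolev space, then
  both integrals below converge (the second one by the logarithmic Sobolev inequality), so the
  convention for divergent integrals plays no role.\<close>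

definition fisher_information :: "(real ^ 'n \<Rightarrow> real) \<Rightarrow> real" where
  "fisher_information f = (\<integral>x. (norm (weak_gradient f x))\<^sup>2 / f x \<partial>gaussian)"

definition relative_entropy :: "(real ^ 'n \<Rightarrow> real) \<Rightarrow> real" where
  "relative_entropy f = (\<integral>x. f x * ln (f x) \<partial>gaussian)"

definition log_sobolev_deficit :: "(real ^ 'n \<Rightarrow> real) \<Rightarrow> real" where
  "log_sobolev_deficit f = fisher_information f / 2 - relative_entropy f"

text \<open>The \<open>L\<^sup>1\<close> norm takes values in \<open>ennreal\<close>, so that a finite bound on it includes
  integrability.\<close>

definition gaussian_L1_norm :: "(real ^ 'n \<Rightarrow> real) \<Rightarrow> ennreal" where
  "gaussian_L1_norm h = (\<integral>\<^sup>+x. ennreal \<bar>h x\<bar> \<partial>gaussian)"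

end

(* The Ornstein-Uhlenbeck flow v_t = P_t f dissipates the deficit at the rate
   J(t) = \<integral> v_t |D\<^sup>2 log v_t|\<^sup>2 d\<gamma>, so \<delta>(f) = \<integral> J(t) dt, and v_t \<ge> \<alpha> gives J \<ge> \<alpha> \<parallel>D\<^sup>2 h_t\<parallel>\<^sup>2 in
   L\<^sup>2(\<gamma>), where h_t = log v_t.  By the Poincare inequality, applied twice, h_t is within \<parallel>D\<^sup>2 h_t\<parallel>
   of an affine function.  Moreover h_t solves d/dt h = \<Delta>h - x \<bullet> \<nabla>h + |\<nabla>h|\<^sup>2, and if \<nabla>h is replaced by
   its mean the right-hand side becomes affine, up to an L\<^sup>1 error of order \<parallel>D\<^sup>2 h\<parallel> + \<parallel>D\<^sup>2 h\<parallel>\<^sup>2.  Hence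
   modulo affine functions log f differs from log v_t by O(sqrt \<delta>) for t \<le> 1, while some such t has
   \<parallel>D\<^sup>2 h_t\<parallel> = O(sqrt \<delta>).  All this is done for smooth f with bounded derivatives; a Sobolev density is
   approximated by cutting off and mollifying, which asymptotically does not increase the deficit.
   If \<delta>(f) > 1, the claim is trivial because log f is bounded in L\<^sup>1(\<gamma>) in terms of \<alpha>. *)

theory Submission
  imports Defs
begin

section \<open>Bounded smooth functions\<close>

text \<open>The square root does not come from the Cauchy-Schwarz inequality: products are split
  with a free weight \<eta>, the estimates read constant times (\<eta> + deficit / \<eta>), and
  \<eta> becomes the root of the deficit only at the end. Bounds that stay linear in the deficit
  serve twice: along the flow the decay of the deficit pays directly for the Hessian term, and the
  final bound can be solved for the entropy. The latter is needed because the entropy is only lower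
  semicontinuous under L1 convergence; an upper bound on the entropies of the approximations is what
  Fatou's lemma can use, and it yields integrability of f ln f as well. The term |\<nabla>h|^2 is
  only controlled in L1, so affine functions have to be removed by a projection bounded on L1; the
  orthogonal one tests against the unbounded x_i. The same projection bounds the mean gradient of h.
  Cutting off and mollifying changes the mass, so smooth densities are not normalised: their mass is
  at most 2 and the deficit carries a correction m ln m.\<close>

lemma amgm_weighted: "0 < \<eta> \<Longrightarrow> 2 * \<bar>s * t\<bar> \<le> \<eta> * s\<^sup>2 + t\<^sup>2 / \<eta>" for s t \<eta> :: real
proof -
  assume \<eta>: "0 < \<eta>"
  have "0 \<le> (\<eta> * \<bar>s\<bar> - \<bar>t\<bar>)\<^sup>2 / \<eta>" using \<eta> by simp
  also have "(\<eta> * \<bar>s\<bar> - \<bar>t\<bar>)\<^sup>2 / \<eta> = \<eta> * s\<^sup>2 + t\<^sup>2 / \<eta> - 2 * \<bar>s * t\<bar>"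
    using \<eta> by (simp add: power2_diff abs_mult power_mult_distrib field_simps power2_eq_square)
  finally show ?thesis by simp
qed

section \<open>Integrability of products\<close>

lemma integrable_bounded_mult:
  fixes f g :: "'a \<Rightarrow> real"
  assumes f: "f \<in> borel_measurable M" "\<And>x. \<bar>f x\<bar> \<le> B" and g: "integrable M g"
  shows "integrable M (\<lambda>x. g x * f x)"
proof (rule Bochner_Integration.integrable_bound)
  show "integrable M (\<lambda>x. g x * B)" using g by simp
  show "(\<lambda>x. g x * f x) \<in> borel_measurable M" using f(1) borel_measurable_integrable[OF g] by simp
  have "\<bar>g x\<bar> * \<bar>f x\<bar> \<le> \<bar>g x\<bar> * \<bar>B\<bar>" for x
    by (intro mult_left_mono) (auto intro: order_trans[OF f(2)])
  then show "AE x in M. norm (g x * f x) \<le> norm (g x * B)"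
    by (simp add: abs_mult)
qed

lemma integrable_mult_L2:
  fixes a b :: "'a \<Rightarrow> real"
  assumes "a \<in> borel_measurable M" "b \<in> borel_measurable M" "integrable M (\<lambda>x. (a x)\<^sup>2)" "integrable M (\<lambda>x. (b x)\<^sup>2)"
  shows "integrable M (\<lambda>x. a x * b x)"
proof (rule Bochner_Integration.integrable_bound)
  show "integrable M (\<lambda>x. (a x)\<^sup>2 + (b x)\<^sup>2)" using assms by simp
  show "AE x in M. norm (a x * b x) \<le> norm ((a x)\<^sup>2 + (b x)\<^sup>2)"
  proof (rule AE_I2)
    fix x
    have "2 * \<bar>a x * b x\<bar> \<le> 1 * (a x)\<^sup>2 + (b x)\<^sup>2 / 1" by (rule amgm_weighted) simp
    then show "norm (a x * b x) \<le> norm ((a x)\<^sup>2 + (b x)\<^sup>2)" using abs_ge_zero[of "a x * b x"] by simp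
  qed
qed (use assms in simp)

section \<open>Partial derivatives and the total derivative\<close>

lemma has_derivative_partial_deriv:
  fixes f :: "real ^ 'n \<Rightarrow> real"
  assumes "f differentiable (at x)"
  shows "(f has_derivative (\<lambda>h. \<Sum>i\<in>UNIV. partial_deriv i f x * h $ i)) (at x)"
proof -
  let ?D = "frechet_derivative f (at x)"
  have D: "(f has_derivative ?D) (at x)"
    using assms frechet_derivative_works by blast
  interpret linear ?D
    using D has_derivative_linear by blast
  have "?D h = (\<Sum>i\<in>UNIV. partial_deriv i f x * h $ i)" for h
  proof -
    have "?D h = ?D (\<Sum>i\<in>UNIV. (h $ i) *\<^sub>R axis i 1)"
      by (simp add: basis_expansion[of h, unfolded scalar_mult_eq_scaleR])
    also have "\<dots> = (\<Sum>i\<in>UNIV. partial_deriv i f x * h $ i)"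
      by (simp add: sum scale partial_deriv_def mult.commute)
    finally show ?thesis .
  qed
  then have "?D = (\<lambda>h. \<Sum>i\<in>UNIV. partial_deriv i f x * h $ i)" by blast
  with D show ?thesis by simp
qed

lemma partial_deriv_eq:
  fixes f :: "real ^ 'n \<Rightarrow> real"
  assumes "(f has_derivative (\<lambda>h. \<Sum>i\<in>UNIV. c i * h $ i)) (at x)"
  shows "partial_deriv i f x = c i"
proof -
  have "frechet_derivative f (at x) = (\<lambda>h. \<Sum>i\<in>UNIV. c i * h $ i)"
    using assms frechet_derivative_at by metis
  then show ?thesis
    by (simp add: partial_deriv_def axis_def if_distrib[where f = "(*) _"] cong: if_cong)
qed

lemma partial_deriv_line:
  fixes f :: "real ^ 'n \<Rightarrow> real"
  assumes "f differentiable (at (x + t *\<^sub>R axis i 1))"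
  shows "((\<lambda>t. f (x + t *\<^sub>R axis i 1)) has_real_derivative partial_deriv i f (x + t *\<^sub>R axis i 1)) (at t)"
proof -
  let ?y = "x + t *\<^sub>R axis i 1"
  have "((\<lambda>t::real. x + t *\<^sub>R axis i (1::real)) has_derivative (\<lambda>t. t *\<^sub>R axis i 1)) (at t)"
    by (auto intro!: derivative_eq_intros)
  from has_derivative_compose[OF this has_derivative_partial_deriv[OF assms]]
  have "((\<lambda>t. f (x + t *\<^sub>R axis i 1)) has_derivative
      (\<lambda>t. \<Sum>j\<in>UNIV. partial_deriv j f ?y * (t *\<^sub>R axis i 1 :: real^'n) $ j)) (at t)" .
  moreover have "(\<lambda>t. \<Sum>j\<in>UNIV. partial_deriv j f ?y * (t *\<^sub>R axis i 1 :: real^'n) $ j) = (*) (partial_deriv i f ?y)"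
    by (rule ext) (simp add: axis_def if_distrib[where f = "(*) _"] cong: if_cong)
  ultimately show ?thesis
    by (simp add: has_field_derivative_def)
qed

text \<open>As a greatest fixed point, the class of functions whose iterated partial derivatives all
  exist and are bounded is closed under \<open>partial_deriv\<close> by definition, and membership
  is shown by exhibiting an invariant family instead of by induction on the order of
  differentiation.\<close>

coinductive bsmooth :: "(real ^ 'n \<Rightarrow> real) \<Rightarrow> bool" where
  "\<lbrakk>\<exists>M. \<forall>x. \<bar>f x\<bar> \<le> M; \<forall>x. f differentiable (at x); \<forall>i. bsmooth (partial_deriv i f)\<rbrakk> \<Longrightarrow> bsmooth f"

lemma bsmooth_bounded: "bsmooth f \<Longrightarrow> \<exists>M. \<forall>x. \<bar>f x\<bar> \<le> M"
  by (auto elim: bsmooth.cases)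

lemma bsmooth_bounded_pos: 
  assumes "bsmooth f" obtains M where "M > 0" "\<And>x. \<bar>f x\<bar> \<le> M"
proof -
  obtain M where "\<And>x. \<bar>f x\<bar> \<le> M" using bsmooth_bounded[OF assms] by blast
  then have "\<And>x. \<bar>f x\<bar> \<le> max M 1" "max M 1 > 0" by (auto simp: le_max_iff_disj)
  then show ?thesis using that by blast
qed

lemma bsmooth_differentiable: "bsmooth f \<Longrightarrow> f differentiable (at x)"
  by (auto elim: bsmooth.cases)

lemma bsmooth_partial_deriv: "bsmooth f \<Longrightarrow> bsmooth (partial_deriv i f)"
  by (auto elim: bsmooth.cases)

lemma bsmooth_has_derivative:
  "bsmooth f \<Longrightarrow> (f has_derivative (\<lambda>h. \<Sum>i\<in>UNIV. partial_deriv i f x * h $ i)) (at x)"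
  by (intro has_derivative_partial_deriv bsmooth_differentiable)

lemma bsmooth_continuous_on: "bsmooth f \<Longrightarrow> continuous_on S f"
  by (meson bsmooth_differentiable continuous_at_imp_continuous_on differentiable_imp_continuous_within)

lemma bsmooth_borel_measurable: "bsmooth f \<Longrightarrow> f \<in> borel_measurable borel"
  by (rule borel_measurable_continuous_onI, rule bsmooth_continuous_on)

text \<open>Derivatives may be supplied in total form through coefficient functions
  \<open>G i\<close>; uniqueness of the derivative identifies them with
  \<open>partial_deriv i f\<close>. Closure proofs can therefore rely on the rules for
  \<open>has_derivative\<close> and never compute a \<open>partial_deriv\<close>.\<close>

lemma bsmooth_coinduct [consumes 1, case_names bounded deriv]:
  assumes "X f"
    and bounded: "\<And>f. X f \<Longrightarrow> \<exists>M. \<forall>x. \<bar>f x\<bar> \<le> M"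
    and deriv: "\<And>f. X f \<Longrightarrow> \<exists>G. (\<forall>i. X (G i)) \<and>
      (\<forall>x. (f has_derivative (\<lambda>h. \<Sum>i\<in>UNIV. G i x * h $ i)) (at x))"
  shows "bsmooth f"
  using assms(1)
proof (coinduction arbitrary: f)
  case (bsmooth f)
  obtain G where G: "\<forall>i. X (G i)"
    "\<And>x. (f has_derivative (\<lambda>h. \<Sum>i\<in>UNIV. G i x * h $ i)) (at x)"
    using deriv[OF bsmooth] by blast
  have "partial_deriv i f = G i" for i
    using partial_deriv_eq[OF G(2)] by blast
  with G bounded[OF bsmooth] show ?case
    by (metis differentiable_def)
qed

text \<open>The algebra generated by the bounded smooth functions together with \<open>1/v\<close> is closed under
  partial derivatives, hence consists of bounded smooth functions.\<close>

inductive smooth_algebra :: "(real ^ 'n \<Rightarrow> real) \<Rightarrow> (real ^ 'n \<Rightarrow> real) \<Rightarrow> bool" for v where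
  "bsmooth f \<Longrightarrow> smooth_algebra v f"
| "smooth_algebra v (\<lambda>x. inverse (v x))"
| "smooth_algebra v (\<lambda>x. c)"
| "smooth_algebra v f \<Longrightarrow> smooth_algebra v g \<Longrightarrow> smooth_algebra v (\<lambda>x. f x + g x)"
| "smooth_algebra v f \<Longrightarrow> smooth_algebra v g \<Longrightarrow> smooth_algebra v (\<lambda>x. f x * g x)"

lemma smooth_algebra_bsmooth:
  assumes v: "bsmooth v" and \<alpha>: "0 < \<alpha>" "\<And>x. \<alpha> \<le> v x" and "smooth_algebra v f"
  shows "bsmooth f"
  using assms(4)
proof (coinduction arbitrary: f rule: bsmooth_coinduct)
  case (bounded f)
  then show ?case
  proof induction
    case 2
    have "\<bar>inverse (v x)\<bar> \<le> inverse \<alpha>" for x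
      using \<alpha>(1) \<alpha>(2)[of x] by (simp add: le_imp_inverse_le)
    then show ?case by blast
  next
    case (4 f g)
    then obtain M N where "\<forall>x. \<bar>f x\<bar> \<le> M" "\<forall>x. \<bar>g x\<bar> \<le> N" by blast
    then have "\<bar>f x + g x\<bar> \<le> M + N" for x
      by (meson abs_triangle_ineq add_mono order_trans)
    then show ?case by blast
  next
    case (5 f g)
    then obtain M N where "\<forall>x. \<bar>f x\<bar> \<le> M" "\<forall>x. \<bar>g x\<bar> \<le> N" by blast
    then have "\<bar>f x * g x\<bar> \<le> M * N" for x
      unfolding abs_mult by (intro mult_mono) (auto intro: order_trans[OF abs_ge_zero])
    then show ?case by blast
  qed (auto dest: bsmooth_bounded)
next
  case (deriv f)
  then show ?case
  proof induction
    case (1 f)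
    then show ?case
      by (intro exI[of _ "\<lambda>i. partial_deriv i f"])
        (auto intro: smooth_algebra.intros bsmooth_partial_deriv bsmooth_has_derivative)
  next
    case 2
    \<comment> \<open>The derivative of 1/v, with the sign and the square spelled out as products so
      that the introduction rules of \<open>smooth_algebra\<close> apply to it literally.\<close>
    let ?G = "\<lambda>i x. (- 1) * (inverse (v x) * (inverse (v x) * partial_deriv i v x))"
    have "smooth_algebra v (?G i)" for i
      by (intro smooth_algebra.intros bsmooth_partial_deriv v)
    moreover have "((\<lambda>x. inverse (v x)) has_derivative (\<lambda>h. \<Sum>i\<in>UNIV. ?G i x * h $ i)) (at x)" for x
      using \<alpha>(1) \<alpha>(2)[of x]
      by (auto intro!: derivative_eq_intros bsmooth_has_derivative[OF v]
          simp: sum_distrib_left sum_distrib_right sum_negf mult_ac)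
    ultimately show ?case by (intro exI[of _ ?G]) blast
  next
    case (3 c)
    have "smooth_algebra v (\<lambda>x. 0)" by (rule smooth_algebra.intros)
    then show ?case by (intro exI[of _ "\<lambda>i x. 0"]) auto
  next
    case (4 f g)
    from "4.IH"(1) obtain F where F: "\<forall>i. smooth_algebra v (F i)"
      "\<And>x. (f has_derivative (\<lambda>h. \<Sum>i\<in>UNIV. F i x * h $ i)) (at x)" by blast
    from "4.IH"(2) obtain G where G: "\<forall>i. smooth_algebra v (G i)"
      "\<And>x. (g has_derivative (\<lambda>h. \<Sum>i\<in>UNIV. G i x * h $ i)) (at x)" by blast
    have "smooth_algebra v (\<lambda>x. F i x + G i x)" for i
      by (rule smooth_algebra.intros(4)[OF spec[OF F(1)] spec[OF G(1)]])
    moreover have "((\<lambda>x. f x + g x) has_derivative (\<lambda>h. \<Sum>i\<in>UNIV. (F i x + G i x) * h $ i)) (at x)" for x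
      by (auto intro!: derivative_eq_intros F(2) G(2) simp: sum.distrib algebra_simps)
    ultimately show ?case by (intro exI[of _ "\<lambda>i x. F i x + G i x"]) blast
  next
    case (5 f g)
    from "5.IH"(1) obtain F where F: "\<forall>i. smooth_algebra v (F i)"
      "\<And>x. (f has_derivative (\<lambda>h. \<Sum>i\<in>UNIV. F i x * h $ i)) (at x)" by blast
    from "5.IH"(2) obtain G where G: "\<forall>i. smooth_algebra v (G i)"
      "\<And>x. (g has_derivative (\<lambda>h. \<Sum>i\<in>UNIV. G i x * h $ i)) (at x)" by blast
    have "smooth_algebra v (\<lambda>x. f x * G i x + F i x * g x)" for i
      using 5 F(1) G(1) by (intro smooth_algebra.intros(4,5)) auto
    moreover have "((\<lambda>x. f x * g x) has_derivative
        (\<lambda>h. \<Sum>i\<in>UNIV. (f x * G i x + F i x * g x) * h $ i)) (at x)" for x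
      by (auto intro!: derivative_eq_intros F(2) G(2)
            simp: sum.distrib sum_distrib_left sum_distrib_right algebra_simps)
    ultimately show ?case by (intro exI[of _ "\<lambda>i x. f x * G i x + F i x * g x"]) blast
  qed
qed

section \<open>Closure properties of bounded smooth functions\<close>

lemma bsmooth_const [intro]: "bsmooth (\<lambda>x. c)"
  by (rule bsmooth_coinduct[where X = "\<lambda>f. \<exists>c. f = (\<lambda>x. c)"])
    (auto intro!: exI[of _ "\<lambda>i x. 0"])

text \<open>For v = 1 the adjoined inverse is a constant, so closure under sums and products is a
  special case of the closure result for the algebra with 1/v.\<close>

lemma bsmooth_algebra1:
  assumes "smooth_algebra (\<lambda>x. 1) f" shows "bsmooth f"
  using smooth_algebra_bsmooth[OF bsmooth_const[of 1], of 1] assms by simp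

lemma bsmooth_add [intro]: "bsmooth f \<Longrightarrow> bsmooth g \<Longrightarrow> bsmooth (\<lambda>x. f x + g x)"
  by (rule bsmooth_algebra1) (intro smooth_algebra.intros)

lemma bsmooth_mult [intro]: "bsmooth f \<Longrightarrow> bsmooth g \<Longrightarrow> bsmooth (\<lambda>x. f x * g x)"
  by (rule bsmooth_algebra1) (intro smooth_algebra.intros)

lemma bsmooth_diff [intro]:
  assumes "bsmooth f" "bsmooth g" shows "bsmooth (\<lambda>x. f x - g x)"
proof -
  have "bsmooth (\<lambda>x. f x + (- 1) * g x)"
    by (intro bsmooth_add bsmooth_mult bsmooth_const assms)
  then show ?thesis by simp
qed

lemma bsmooth_divide:
  assumes "bsmooth f" "bsmooth v" "0 < \<alpha>" "\<And>x. \<alpha> \<le> v x"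
  shows "bsmooth (\<lambda>x. f x / v x)"
proof -
  have "smooth_algebra v (\<lambda>x. f x * inverse (v x))"
    by (intro smooth_algebra.intros assms)
  then show ?thesis
    using smooth_algebra_bsmooth[OF assms(2-4)] by (simp add: divide_inverse)
qed

lemma has_derivative_ln_partial:
  assumes v: "bsmooth v" and \<alpha>: "0 < \<alpha>" "\<And>x. \<alpha> \<le> v x"
  shows "((\<lambda>x. ln (v x)) has_derivative (\<lambda>h. \<Sum>i\<in>UNIV. (partial_deriv i v x / v x) * h $ i)) (at x)"
  using \<alpha>(1) \<alpha>(2)[of x]
  by (auto intro!: derivative_eq_intros bsmooth_has_derivative[OF v]
      simp: sum_distrib_left sum_distrib_right sum_divide_distrib divide_inverse mult_ac)

text \<open>The logarithm is not built from v and 1/v by sums and products, but its partial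
  derivatives are quotients by v; hence a single unfolding of \<open>bsmooth\<close> suffices, with
  boundedness checked by hand.\<close>

lemma bsmooth_ln:
  assumes v: "bsmooth v" and \<alpha>: "0 < \<alpha>" "\<And>x. \<alpha> \<le> v x"
  shows "bsmooth (\<lambda>x. ln (v x))"
proof (rule bsmooth.intros)
  have eq: "partial_deriv i (\<lambda>x. ln (v x)) = (\<lambda>x. partial_deriv i v x / v x)" for i
    using partial_deriv_eq[OF has_derivative_ln_partial[OF assms]] by blast
  show "\<forall>i. bsmooth (partial_deriv i (\<lambda>x. ln (v x)))"
    unfolding eq by (auto intro!: bsmooth_divide[OF _ v \<alpha>] bsmooth_partial_deriv v)
  show "\<forall>x. (\<lambda>x. ln (v x)) differentiable (at x)"
    using has_derivative_ln_partial[OF assms] differentiable_def by blast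
  obtain M where M: "\<And>x. \<bar>v x\<bar> \<le> M" using bsmooth_bounded[OF v] by blast
  have "\<bar>ln (v x)\<bar> \<le> \<bar>ln \<alpha>\<bar> + \<bar>ln M\<bar>" for x
  proof -
    have "\<alpha> \<le> v x" "v x \<le> M" using \<alpha>(2)[of x] M[of x] by auto
    then have "ln \<alpha> \<le> ln (v x)" "ln (v x) \<le> ln M" using \<alpha>(1) by auto
    then show ?thesis by linarith
  qed
  then show "\<exists>M. \<forall>x. \<bar>ln (v x)\<bar> \<le> M" by blast
qed

lemma partial_deriv_mult:
  assumes "bsmooth f" "bsmooth g"
  shows "partial_deriv i (\<lambda>x. f x * g x) x = f x * partial_deriv i g x + partial_deriv i f x * g x"
  by (rule partial_deriv_eq) (auto intro!: derivative_eq_intros bsmooth_has_derivative assms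
      simp: sum.distrib sum_distrib_left sum_distrib_right algebra_simps)

lemma partial_deriv_divide:
  assumes f: "bsmooth f" and v: "bsmooth v" and \<alpha>: "0 < \<alpha>" "\<And>x. \<alpha> \<le> v x"
  shows "partial_deriv i (\<lambda>x. f x / v x) x = (partial_deriv i f x - (f x / v x) * partial_deriv i v x) / v x"
proof (rule partial_deriv_eq)
  have nz: "v x \<noteq> 0" using \<alpha>(1) \<alpha>(2)[of x] by auto
  show "((\<lambda>x. f x / v x) has_derivative (\<lambda>h. \<Sum>i\<in>UNIV.
      ((partial_deriv i f x - (f x / v x) * partial_deriv i v x) / v x) * h $ i)) (at x)"
    by (rule has_derivative_eq_rhs[OF has_derivative_divide'[OF bsmooth_has_derivative[OF f]
          bsmooth_has_derivative[OF v] nz]])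
      (use nz in \<open>simp add: sum_subtractf[symmetric] sum_distrib_left sum_distrib_right
        sum_divide_distrib diff_divide_distrib right_diff_distrib left_diff_distrib mult_ac\<close>)
qed

section \<open>Global Lipschitz and Taylor bounds\<close>

lemma bsmooth_lipschitz:
  assumes "bsmooth f" obtains K where "K > 0" "\<And>x y. \<bar>f x - f y\<bar> \<le> K * norm (x - y)"
proof -
  have "\<exists>M. \<forall>x. \<bar>partial_deriv i f x\<bar> \<le> M" for i
    using assms bsmooth_bounded bsmooth_partial_deriv by blast
  then obtain M where M: "\<And>i x. \<bar>partial_deriv i f x\<bar> \<le> M i" by metis
  let ?K = "\<bar>\<Sum>i\<in>UNIV. M i\<bar> + 1"
  have "norm (f y - f x) \<le> ?K * norm (y - x)" for x y
  proof (rule differentiable_bound[of UNIV _ "\<lambda>x h. \<Sum>i\<in>UNIV. partial_deriv i f x * h $ i"])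
    fix z :: "real^'a"
    show "(f has_derivative (\<lambda>h. \<Sum>i\<in>UNIV. partial_deriv i f z * h $ i)) (at z within UNIV)"
      using bsmooth_has_derivative[OF assms] by simp
    show "onorm (\<lambda>h. \<Sum>i\<in>UNIV. partial_deriv i f z * h $ i) \<le> ?K"
    proof (rule onorm_le)
      fix h :: "real^'a"
      have "\<bar>\<Sum>i\<in>UNIV. partial_deriv i f z * h $ i\<bar> \<le> (\<Sum>i\<in>UNIV. M i * norm h)"
        by (rule order_trans[OF sum_abs], rule sum_mono)
          (auto simp: abs_mult intro!: mult_mono M component_le_norm_cart
            intro: order_trans[OF abs_ge_zero M])
      also have "\<dots> \<le> ?K * norm h" 
        unfolding sum_distrib_right[symmetric] by (intro mult_right_mono) auto
      finally show "norm (\<Sum>i\<in>UNIV. partial_deriv i f z * h $ i) \<le> ?K * norm h" by simp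
    qed
  qed auto
  then show ?thesis using that[of ?K] by (force simp: abs_minus_commute)
qed

text \<open>The mean value inequality on the ball of radius |y - x| is applied to f minus its linear
  part at x, whose gradient there is bounded by the Lipschitz constants of the partial derivatives.
  The constant does not depend on x, which is what permits integrating the estimate over shifted
  arguments.\<close>

lemma bsmooth_taylor:
  assumes "bsmooth f"
  obtains K where "K > 0" "\<And>x y. \<bar>f y - f x - (\<Sum>i\<in>UNIV. partial_deriv i f x * (y - x) $ i)\<bar> \<le> K * (norm (y - x))\<^sup>2"
proof -
  have "\<exists>K>0. \<forall>x y. \<bar>partial_deriv i f x - partial_deriv i f y\<bar> \<le> K * norm (x - y)" for i
    using bsmooth_lipschitz[OF bsmooth_partial_deriv[OF assms, of i]] by metis
  then obtain L where L: "\<And>i. L i > 0"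
    "\<And>i x y. \<bar>partial_deriv i f x - partial_deriv i f y\<bar> \<le> L i * norm (x - y)" by metis
  let ?K = "\<Sum>i\<in>UNIV. L i"
  have K0: "?K > 0" using L(1) by (simp add: sum_pos)
  have "\<bar>f y - f x - (\<Sum>i\<in>UNIV. partial_deriv i f x * (y - x) $ i)\<bar> \<le> ?K * (norm (y - x))\<^sup>2" for x y
  proof -
    let ?g = "\<lambda>z. f z - (\<Sum>i\<in>UNIV. partial_deriv i f x * z $ i)"
    let ?g' = "\<lambda>z h. \<Sum>i\<in>UNIV. (partial_deriv i f z - partial_deriv i f x) * h $ i"
    have "norm (?g y - ?g x) \<le> (?K * norm (y - x)) * norm (y - x)"
    proof (rule differentiable_bound[of "cball x (norm (y - x))" _ ?g'])
      fix z assume z: "z \<in> cball x (norm (y - x))"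
      show "(?g has_derivative ?g' z) (at z within cball x (norm (y - x)))"
        by (auto intro!: derivative_eq_intros has_derivative_at_withinI[OF bsmooth_has_derivative] assms
            bounded_linear.has_derivative[OF bounded_linear_vec_nth] simp: sum_subtractf algebra_simps)
      show "onorm (?g' z) \<le> ?K * norm (y - x)"
      proof (rule onorm_le)
        fix h :: "real^'a"
        have "\<bar>?g' z h\<bar> \<le> (\<Sum>i\<in>UNIV. (L i * norm (y - x)) * norm h)"
        proof (rule order_trans[OF sum_abs], rule sum_mono, unfold abs_mult, intro mult_mono)
          fix i
          have "\<bar>partial_deriv i f z - partial_deriv i f x\<bar> \<le> L i * norm (z - x)" by (rule L)
          also have "\<dots> \<le> L i * norm (y - x)"
            using z L(1)[of i] by (auto simp: dist_norm norm_minus_commute)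
          finally show "\<bar>partial_deriv i f z - partial_deriv i f x\<bar> \<le> L i * norm (y - x)" .
        qed (auto simp: component_le_norm_cart less_imp_le[OF L(1)])
        then show "norm (?g' z h) \<le> (?K * norm (y - x)) * norm h"
          by (simp add: sum_distrib_right)
      qed
    qed (auto simp: dist_norm norm_minus_commute)
    then show ?thesis
      by (simp add: power2_eq_square algebra_simps sum_subtractf)
  qed
  with K0 that show ?thesis by blast
qed

lemma has_derivative_quadratic_remainder:
  fixes F :: "real ^ 'n \<Rightarrow> real"
  assumes "\<And>y. \<bar>F y - F x - (\<Sum>i\<in>UNIV. G i * (y - x) $ i)\<bar> \<le> K * (norm (y - x))\<^sup>2"
  shows "(F has_derivative (\<lambda>h. \<Sum>i\<in>UNIV. G i * h $ i)) (at x)"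
  unfolding has_derivative_at
proof (intro conjI)
  show "bounded_linear (\<lambda>h. \<Sum>i\<in>UNIV. G i * h $ i)"
    by (intro bounded_linear_sum bounded_linear_const_mult bounded_linear_vec_nth)
  show "(\<lambda>h. norm (F (x + h) - F x - (\<Sum>i\<in>UNIV. G i * h $ i)) / norm h) \<midarrow>0\<rightarrow> 0"
  proof (rule Lim_null_comparison[where g = "\<lambda>h. K * norm h"])
    show "\<forall>\<^sub>F h in at 0. norm (norm (F (x + h) - F x - (\<Sum>i\<in>UNIV. G i * h $ i)) / norm h) \<le> K * norm h"
    proof (rule eventually_at_filter[THEN iffD2], intro always_eventually allI impI)
      fix h :: "real^'n" assume "h \<noteq> 0"
      then show "norm (norm (F (x + h) - F x - (\<Sum>i\<in>UNIV. G i * h $ i)) / norm h) \<le> K * norm h"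
        using assms[of "x + h"] by (simp add: divide_simps power2_eq_square mult_ac)
    qed
    show "((\<lambda>h::real^'n. K * norm h) \<longlongrightarrow> 0) (at 0)"
      by (auto intro!: tendsto_eq_intros)
  qed
qed

section \<open>Differentiation of averages and of parameter integrals\<close>

text \<open>Integrating the uniform Taylor remainder against |w| leaves a quadratic remainder, so no
  limit is taken under the integral. The form covers the Ornstein-Uhlenbeck flow (Gaussian M, w = 1,
  c = cos \<theta>), mollification (Lebesgue M, T = \<open>uminus\<close>, c = 1) and affine
  substitution (constant T).\<close>

lemma average_has_derivative:
  fixes k :: "real ^ 'n \<Rightarrow> real"
  assumes k: "bsmooth k" and w [measurable]: "integrable M w" and T [measurable]: "T \<in> borel_measurable M"
  shows "((\<lambda>x. \<integral>y. w y * k (c *\<^sub>R x + T y) \<partial>M) has_derivative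
    (\<lambda>h. \<Sum>i\<in>UNIV. (c * (\<integral>y. w y * partial_deriv i k (c *\<^sub>R x + T y) \<partial>M)) * h $ i)) (at x)"
proof -
  have int: "integrable M (\<lambda>y. w y * g (c *\<^sub>R x + T y))" if g: "bsmooth g" for g :: "real^'n \<Rightarrow> real" and x
  proof -
    obtain B where B: "\<And>x. \<bar>g x\<bar> \<le> B" using bsmooth_bounded[OF g] by blast
    note [measurable] = bsmooth_borel_measurable[OF g]
    have "integrable M (\<lambda>y. B * w y)" using w by simp
    then show ?thesis
    proof (rule Bochner_Integration.integrable_bound)
      have "norm (w y * g (c *\<^sub>R x + T y)) \<le> norm (B * w y)" for y
      proof -
        have "\<bar>w y\<bar> * \<bar>g (c *\<^sub>R x + T y)\<bar> \<le> \<bar>w y\<bar> * \<bar>B\<bar>"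
          by (intro mult_left_mono) (auto intro: order_trans[OF B])
        then show ?thesis by (simp add: abs_mult mult.commute)
      qed
      then show "AE y in M. norm (w y * g (c *\<^sub>R x + T y)) \<le> norm (B * w y)" by simp
    qed measurable
  qed
  obtain K where K: "K > 0" "\<And>x y. \<bar>k y - k x - (\<Sum>i\<in>UNIV. partial_deriv i k x * (y - x) $ i)\<bar> \<le> K * (norm (y - x))\<^sup>2"
    using bsmooth_taylor[OF k] by blast
  show ?thesis
  proof (rule has_derivative_quadratic_remainder[where K = "K * c\<^sup>2 * (\<integral>y. \<bar>w y\<bar> \<partial>M)"])
    fix z
    let ?R = "\<lambda>y. k (c *\<^sub>R z + T y) - k (c *\<^sub>R x + T y) - (\<Sum>i\<in>UNIV. partial_deriv i k (c *\<^sub>R x + T y) * (c * (z - x) $ i))"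
    have eq: "w y * ?R y = w y * k (c *\<^sub>R z + T y) - w y * k (c *\<^sub>R x + T y)
        - (\<Sum>i\<in>UNIV. (w y * partial_deriv i k (c *\<^sub>R x + T y)) * (c * (z - x) $ i))" for y
      by (simp add: right_diff_distrib sum_distrib_left mult_ac)
    have i1: "integrable M (\<lambda>y. w y * ?R y)"
      unfolding eq by (intro Bochner_Integration.integrable_diff Bochner_Integration.integrable_sum
          integrable_mult_left int k bsmooth_partial_deriv)
    note ip = int[OF k] integrable_mult_left[OF int[OF bsmooth_partial_deriv[OF k]]]
    have "(\<integral>y. w y * ?R y \<partial>M) = (\<integral>y. w y * k (c *\<^sub>R z + T y) \<partial>M) - (\<integral>y. w y * k (c *\<^sub>R x + T y) \<partial>M)
        - (\<Sum>i\<in>UNIV. \<integral>y. (w y * partial_deriv i k (c *\<^sub>R x + T y)) * (c * (z - x) $ i) \<partial>M)"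
      unfolding eq
      by (subst Bochner_Integration.integral_diff Bochner_Integration.integral_sum;
          (intro ip Bochner_Integration.integrable_diff Bochner_Integration.integrable_sum)?)+ simp
    also have "\<dots> = (\<integral>y. w y * k (c *\<^sub>R z + T y) \<partial>M) - (\<integral>y. w y * k (c *\<^sub>R x + T y) \<partial>M) -
       (\<Sum>i\<in>UNIV. c * (\<integral>y. w y * partial_deriv i k (c *\<^sub>R x + T y) \<partial>M) * (z - x) $ i)"
      by (simp only: integral_mult_left_zero) (simp only: mult_ac)
    finally have "(\<integral>y. w y * k (c *\<^sub>R z + T y) \<partial>M) - (\<integral>y. w y * k (c *\<^sub>R x + T y) \<partial>M) -
       (\<Sum>i\<in>UNIV. c * (\<integral>y. w y * partial_deriv i k (c *\<^sub>R x + T y) \<partial>M) * (z - x) $ i)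
      = (\<integral>y. w y * ?R y \<partial>M)" by simp
    also have "\<bar>\<dots>\<bar> \<le> (\<integral>y. (K * c\<^sup>2 * (norm (z - x))\<^sup>2) * \<bar>w y\<bar> \<partial>M)"
    proof (rule order_trans[OF integral_abs_bound], rule integral_mono)
      fix y
      have "\<bar>?R y\<bar> \<le> K * c\<^sup>2 * (norm (z - x))\<^sup>2"
      proof -
        have d: "(c *\<^sub>R z + T y) - (c *\<^sub>R x + T y) = c *\<^sub>R (z - x)"
          by (simp add: scaleR_diff_right)
        show ?thesis
          using K(2)[of "c *\<^sub>R z + T y" "c *\<^sub>R x + T y"] unfolding d
          by (simp add: power_mult_distrib mult.assoc del: vector_minus_component)
      qed
      then have "\<bar>w y\<bar> * \<bar>?R y\<bar> \<le> \<bar>w y\<bar> * (K * c\<^sup>2 * (norm (z - x))\<^sup>2)"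
        by (intro mult_left_mono) auto
      then show "\<bar>w y * ?R y\<bar> \<le> (K * c\<^sup>2 * (norm (z - x))\<^sup>2) * \<bar>w y\<bar>"
        by (simp add: abs_mult mult_ac)
    qed (use i1 w in auto)
    finally show "\<bar>(\<integral>y. w y * k (c *\<^sub>R z + T y) \<partial>M) - (\<integral>y. w y * k (c *\<^sub>R x + T y) \<partial>M) -
       (\<Sum>i\<in>UNIV. c * (\<integral>y. w y * partial_deriv i k (c *\<^sub>R x + T y) \<partial>M) * (z - x) $ i)\<bar>
      \<le> K * c\<^sup>2 * (\<integral>y. \<bar>w y\<bar> \<partial>M) * (norm (z - x))\<^sup>2"
      by (simp add: mult_ac)
  qed
qed

lemma bsmooth_average:
  fixes k :: "real ^ 'n \<Rightarrow> real"
  assumes k: "bsmooth k" and w: "integrable M w" and T: "T \<in> borel_measurable M"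
  shows "bsmooth (\<lambda>x. \<integral>y. w y * k (c *\<^sub>R x + T y) \<partial>M)"
proof -
  \<comment> \<open>The factor C belongs to the invariant because every differentiation pulls out
    another c.\<close>
  let ?X = "\<lambda>f. \<exists>C k'. f = (\<lambda>x. C * (\<integral>y. w y * k' (c *\<^sub>R x + T y) \<partial>M)) \<and> bsmooth k'"
  have "?X (\<lambda>x. \<integral>y. w y * k (c *\<^sub>R x + T y) \<partial>M)"
    using k by (intro exI[of _ 1] exI[of _ k]) simp
  then show ?thesis
  proof (rule bsmooth_coinduct[where X = ?X], goal_cases bounded deriv)
    case (bounded f)
    then obtain C k' where f: "f = (\<lambda>x. C * (\<integral>y. w y * k' (c *\<^sub>R x + T y) \<partial>M))" and k': "bsmooth k'" by blast
    obtain B where B: "\<And>x. \<bar>k' x\<bar> \<le> B" using bsmooth_bounded[OF k'] by blast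
    have "\<bar>\<integral>y. w y * k' (c *\<^sub>R x + T y) \<partial>M\<bar> \<le> (\<integral>y. \<bar>w y\<bar> * B \<partial>M)" for x
      by (rule order_trans[OF integral_abs_bound], rule integral_mono')
        (use w B in \<open>auto simp: abs_mult intro!: mult_left_mono mult_nonneg_nonneg
            intro: order_trans[OF abs_ge_zero B]\<close>)
    then have "\<bar>f x\<bar> \<le> \<bar>C\<bar> * (\<integral>y. \<bar>w y\<bar> * B \<partial>M)" for x
      unfolding f abs_mult by (intro mult_left_mono) auto
    then show ?case by blast
  next
    case (deriv f)
    then obtain C k' where f: "f = (\<lambda>x. C * (\<integral>y. w y * k' (c *\<^sub>R x + T y) \<partial>M))" and k': "bsmooth k'" by blast
    let ?G = "\<lambda>i x. (C * c) * (\<integral>y. w y * partial_deriv i k' (c *\<^sub>R x + T y) \<partial>M)"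
    have "(f has_derivative (\<lambda>h. \<Sum>i\<in>UNIV. ?G i x * h $ i)) (at x)" for x
      unfolding f using has_derivative_mult_right[OF average_has_derivative[OF k' w T, of c x], of C]
      by (simp add: sum_distrib_left mult_ac)
    moreover have "\<exists>C k. ?G i = (\<lambda>x. C * (\<integral>y. w y * k (c *\<^sub>R x + T y) \<partial>M)) \<and> bsmooth k" for i
      using bsmooth_partial_deriv[OF k'] by blast
    ultimately show ?case by (intro exI[of _ ?G]) blast
  qed
qed

lemma partial_deriv_average:
  fixes k :: "real ^ 'n \<Rightarrow> real"
  assumes "bsmooth k" "integrable M w" "T \<in> borel_measurable M"
  shows "partial_deriv i (\<lambda>x. \<integral>y. w y * k (c *\<^sub>R x + T y) \<partial>M) x
    = c * (\<integral>y. w y * partial_deriv i k (c *\<^sub>R x + T y) \<partial>M)"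
  by (rule partial_deriv_eq) (rule average_has_derivative[OF assms])

text \<open>The mean value theorem bounds the difference quotients by w, after which dominated
  convergence applies. Integrability is assumed at \<open>t0\<close> only: the same bound transfers
  it to the rest of the interval.\<close>

lemma has_derivative_integral:
  fixes f f' :: "real \<Rightarrow> 'a \<Rightarrow> real"
  assumes "t0 \<in> {a<..<b}"
    and meas [measurable]: "\<And>t. t \<in> {a<..<b} \<Longrightarrow> f t \<in> borel_measurable M"
    and int0: "integrable M (f t0)"
    and meas' [measurable]: "f' t0 \<in> borel_measurable M"
    and w: "integrable M w"
    and deriv: "\<And>t x. t \<in> {a<..<b} \<Longrightarrow> x \<in> space M \<Longrightarrow> ((\<lambda>t. f t x) has_real_derivative f' t x) (at t)"
    and bound: "\<And>t x. t \<in> {a<..<b} \<Longrightarrow> x \<in> space M \<Longrightarrow> \<bar>f' t x\<bar> \<le> w x"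
  shows "((\<lambda>t. \<integral>x. f t x \<partial>M) has_real_derivative (\<integral>x. f' t0 x \<partial>M)) (at t0)"
proof -
  have diff: "\<bar>f t x - f t0 x\<bar> \<le> w x * \<bar>t - t0\<bar>" if "t \<in> {a<..<b}" "x \<in> space M" for t x
  proof -
    have "norm (f t x - f t0 x) \<le> w x * norm (t - t0)"
    proof (rule field_differentiable_bound[of "{a<..<b}" _ "\<lambda>t. f' t x"])
      fix z assume z: "z \<in> {a<..<b}"
      show "((\<lambda>t. f t x) has_field_derivative f' z x) (at z within {a<..<b})"
        using deriv[OF z that(2)] by (rule has_field_derivative_at_within)
      show "norm (f' z x) \<le> w x" using bound[OF z that(2)] by simp
    qed (use assms(1) that in auto)
    then show ?thesis by simp
  qed
  have int: "integrable M (f t)" if t: "t \<in> {a<..<b}" for t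
  proof -
    have "integrable M (\<lambda>x. f t x - f t0 x)"
    proof (rule Bochner_Integration.integrable_bound)
      show "integrable M (\<lambda>x. w x * \<bar>t - t0\<bar>)" using w by simp
      show "(\<lambda>x. f t x - f t0 x) \<in> borel_measurable M"
        using meas[OF t] meas[OF assms(1)] by measurable
      show "AE x in M. norm (f t x - f t0 x) \<le> norm (w x * \<bar>t - t0\<bar>)"
        using diff[OF t] by (intro AE_I2) (auto intro: order_trans[OF _ abs_ge_self])
    qed
    from Bochner_Integration.integrable_add[OF this int0] show ?thesis by simp
  qed
  have "((\<lambda>t. (\<integral>x. f t x \<partial>M)) has_real_derivative (\<integral>x. f' t0 x \<partial>M)) (at t0 within {a<..<b})"
    unfolding has_field_derivative_iff tendsto_at_iff_sequentially
  proof (intro allI impI)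
    fix X assume X: "\<forall>i. X i \<in> {a<..<b} - {t0}" "X \<longlonglongrightarrow> t0"
    have "(\<lambda>n. \<integral>x. (f (X n) x - f t0 x) / (X n - t0) \<partial>M) \<longlonglongrightarrow> (\<integral>x. f' t0 x \<partial>M)"
    proof (rule integral_dominated_convergence[where w = w])
      show "AE x in M. (\<lambda>n. (f (X n) x - f t0 x) / (X n - t0)) \<longlonglongrightarrow> f' t0 x"
      proof (rule AE_I2)
        fix x assume "x \<in> space M"
        from has_field_derivative_at_within[OF deriv[OF assms(1) this], of "{a<..<b}"]
        have "((\<lambda>t. (f t x - f t0 x) / (t - t0)) \<longlongrightarrow> f' t0 x) (at t0 within {a<..<b})"
          unfolding has_field_derivative_iff .
        then show "(\<lambda>n. (f (X n) x - f t0 x) / (X n - t0)) \<longlonglongrightarrow> f' t0 x"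
          using X unfolding tendsto_at_iff_sequentially by (auto simp: comp_def)
      qed
      show "(\<lambda>x. (f (X n) x - f t0 x) / (X n - t0)) \<in> borel_measurable M" for n
        by (intro borel_measurable_divide borel_measurable_diff borel_measurable_const meas)
          (use X(1) assms(1) in auto)
      show "AE x in M. norm ((f (X n) x - f t0 x) / (X n - t0)) \<le> w x" for n
        using X(1) diff[of "X n"] by (intro AE_I2) (auto simp: divide_simps)
    qed (use w in auto)
    moreover have "(\<integral>x. (f (X n) x - f t0 x) / (X n - t0) \<partial>M)
        = ((\<integral>x. f (X n) x \<partial>M) - (\<integral>x. f t0 x \<partial>M)) / (X n - t0)" for n
      using Bochner_Integration.integral_diff[OF int int0, of "X n"] X(1) by simp
    ultimately show "((\<lambda>t. ((\<integral>x. f t x \<partial>M) - (\<integral>x. f t0 x \<partial>M)) / (t - t0)) \<circ> X) \<longlonglongrightarrow> (\<integral>x. f' t0 x \<partial>M)"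
      unfolding comp_def by (simp only:)
  qed
  then show ?thesis
    using assms(1) by (simp add: at_within_open[OF assms(1)])
qed

section \<open>The Gaussian measure\<close>

lemma space_gaussian [simp]: "space gaussian = UNIV"
  by (simp add: gaussian_def)

lemma sets_gaussian [simp, measurable_cong]: "sets gaussian = sets borel"
  by (simp add: gaussian_def)

lemma measurable_gaussian [simp]: "measurable gaussian N = measurable borel N"
  by (rule measurable_cong_sets) simp_all

definition gauss_density :: "real ^ 'n \<Rightarrow> real" where
  "gauss_density x = (2 * pi) powr (- real CARD('n) / 2) * exp (- (norm x)\<^sup>2 / 2)"

lemma gaussian_eq: "gaussian = density lborel (\<lambda>x. ennreal (gauss_density x))"
  by (simp add: gaussian_def gauss_density_def)

lemma gauss_density_pos: "gauss_density x > 0"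
  by (simp add: gauss_density_def)

lemma gauss_density_measurable [measurable]: "gauss_density \<in> borel_measurable borel"
  unfolding gauss_density_def by measurable

text \<open>The product form reduces the total mass to one-dimensional integrals of the standard
  normal density.\<close>

lemma gauss_density_prod:
  fixes x :: "real ^ 'n"
  shows "gauss_density x = (\<Prod>b\<in>Basis. std_normal_density (x \<bullet> b))"
proof -
  have "(norm x)\<^sup>2 = (\<Sum>b\<in>Basis. (x \<bullet> b)\<^sup>2)"
    unfolding power2_norm_eq_inner by (subst euclidean_inner) (simp add: power2_eq_square)
  moreover have "(2 * pi) powr (- real CARD('n) / 2) = (1 / sqrt (2 * pi)) ^ CARD('n)"
  proof -
    have "(2 * pi) powr (- real CARD('n) / 2) = ((2 * pi) powr (- 1 / 2)) powr real CARD('n)"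
      by (simp add: powr_powr)
    also have "(2 * pi) powr (- 1 / 2) = 1 / sqrt (2 * pi)"
      by (simp add: powr_minus_divide powr_half_sqrt)
    finally show ?thesis by (simp add: powr_realpow)
  qed
  ultimately show ?thesis
    unfolding gauss_density_def std_normal_density_def
    by (simp add: prod_dividef exp_sum[symmetric] sum_negf sum_divide_distrib power_one_over)
qed

lemma prob_space_gaussian: "prob_space (gaussian :: (real ^ 'n) measure)"
proof
  have "emeasure (gaussian :: (real ^ 'n) measure) UNIV
      = (\<integral>\<^sup>+x. (\<Prod>b\<in>Basis. ennreal (std_normal_density (x \<bullet> b))) \<partial>(lborel :: (real ^ 'n) measure))"
    by (simp add: gaussian_eq emeasure_density gauss_density_prod prod_ennreal del: prod_constant)
  also have "\<dots> = (\<Prod>b\<in>(Basis :: (real ^ 'n) set). (\<integral>\<^sup>+x. ennreal (std_normal_density x) \<partial>lborel))"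
    by (rule nn_integral_lborel_prod) simp_all
  also have "(\<integral>\<^sup>+x. ennreal (std_normal_density x) \<partial>lborel) = 1"
    using prob_space.emeasure_space_1[OF prob_space_normal_density[of 1 0]]
    by (simp add: emeasure_density)
  finally show "emeasure (gaussian :: (real ^ 'n) measure) (space gaussian) = 1" by simp
qed

interpretation gauss: prob_space "gaussian :: (real ^ 'n) measure"
  by (rule prob_space_gaussian)

section \<open>Translation and reflection of the Gaussian measure\<close>

text \<open>The Cameron-Martin formula in finite dimension: expanding the square in |x - c|^2
  produces the exponential factor.\<close>

lemma distr_gaussian_translate:
  fixes c :: "real ^ 'n"
  shows "distr gaussian borel (\<lambda>x. x + c) = density gaussian (\<lambda>x. ennreal (exp (c \<bullet> x - (norm c)\<^sup>2 / 2)))"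
    (is "?L = ?R")
proof (rule measure_eqI)
  fix A assume "A \<in> sets ?L"
  then have A [measurable]: "A \<in> sets borel" by simp
  have shift: "gauss_density (x - c) = gauss_density x * exp (c \<bullet> x - (norm c)\<^sup>2 / 2)" for x :: "real ^ 'n"
    unfolding gauss_density_def
    by (simp add: exp_add[symmetric] power2_norm_eq_inner inner_diff_left inner_diff_right
        inner_commute field_simps)
  have "emeasure ?L A = (\<integral>\<^sup>+x. indicator A (x + c) \<partial>gaussian)"
    by (simp add: nn_integral_indicator[symmetric] nn_integral_distr del: nn_integral_indicator)
  also have "\<dots> = (\<integral>\<^sup>+x. ennreal (gauss_density x) * indicator A (x + c) \<partial>lborel)"
    by (simp add: gaussian_eq nn_integral_density)
  also have "\<dots> = (\<integral>\<^sup>+x. ennreal (gauss_density (x - c)) * indicator A x \<partial>distr lborel borel ((+) c))"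
    by (subst nn_integral_distr) (simp_all add: add.commute)
  also have "\<dots> = (\<integral>\<^sup>+x. ennreal (gauss_density x) * (ennreal (exp (c \<bullet> x - (norm c)\<^sup>2 / 2)) * indicator A x) \<partial>lborel)"
    unfolding lborel_distr_plus shift
    by (intro nn_integral_cong) (simp add: ennreal_mult less_imp_le[OF gauss_density_pos] mult_ac)
  also have "\<dots> = (\<integral>\<^sup>+x. ennreal (exp (c \<bullet> x - (norm c)\<^sup>2 / 2)) * indicator A x \<partial>gaussian)"
    by (simp add: gaussian_eq nn_integral_density)
  also have "\<dots> = emeasure ?R A"
    by (simp add: emeasure_density)
  finally show "emeasure ?L A = emeasure ?R A" .
qed simp

lemma integral_gaussian_translate:
  fixes c :: "real ^ 'n" and g :: "real ^ 'n \<Rightarrow> real"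
  assumes [measurable]: "g \<in> borel_measurable borel"
  shows "(\<integral>x. g (x + c) \<partial>gaussian) = (\<integral>x. exp (c \<bullet> x - (norm c)\<^sup>2 / 2) * g x \<partial>gaussian)"
proof -
  have "(\<integral>x. g (x + c) \<partial>gaussian) = (\<integral>x. g x \<partial>distr gaussian borel (\<lambda>x. x + c))"
    by (simp add: integral_distr)
  also have "\<dots> = (\<integral>x. exp (c \<bullet> x - (norm c)\<^sup>2 / 2) * g x \<partial>gaussian)"
    unfolding distr_gaussian_translate by (simp add: integral_density)
  finally show ?thesis .
qed

lemma lborel_distr_reflect: "distr lborel borel (\<lambda>z. x - z) = lborel" for x :: "'a::euclidean_space"
  using lborel_affine[of "-1" x] by (simp add: density_1)

lemma distr_gaussian_uminus: "distr gaussian borel uminus = (gaussian :: (real ^ 'n) measure)"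
proof (rule measure_eqI)
  fix A assume "A \<in> sets (distr gaussian borel uminus :: (real ^ 'n) measure)"
  then have A [measurable]: "A \<in> sets borel" by simp
  have l: "lborel = distr lborel borel (uminus :: real ^ 'n \<Rightarrow> _)"
    using lborel_distr_reflect[of "0 :: real ^ 'n"] by simp
  have "emeasure (distr gaussian borel uminus) A = (\<integral>\<^sup>+x. indicator A (- x :: real ^ 'n) \<partial>gaussian)"
    by (simp add: nn_integral_indicator[symmetric] nn_integral_distr del: nn_integral_indicator)
  also have "\<dots> = (\<integral>\<^sup>+x. ennreal (gauss_density x) * indicator A (- x) \<partial>lborel)"
    by (simp add: gaussian_eq nn_integral_density)
  also have "\<dots> = (\<integral>\<^sup>+x. ennreal (gauss_density x) * indicator A x \<partial>distr lborel borel uminus)"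
    by (subst nn_integral_distr) (simp_all add: gauss_density_def)
  also have "\<dots> = emeasure gaussian A"
    unfolding l[symmetric] by (simp add: gaussian_eq emeasure_density)
  finally show "emeasure (distr gaussian borel uminus) A = emeasure gaussian A" .
qed simp

lemma integral_gaussian_odd:
  fixes g :: "real ^ 'n \<Rightarrow> real"
  assumes [measurable]: "g \<in> borel_measurable borel" and odd: "\<And>x. g (- x) = - g x"
  shows "(\<integral>x. g x \<partial>gaussian) = 0"
proof -
  have "(\<integral>x. g x \<partial>gaussian) = (\<integral>x. g (- x) \<partial>gaussian)"
    by (subst distr_gaussian_uminus[symmetric]) (simp add: integral_distr)
  then show ?thesis by (simp add: odd)
qed

section \<open>Exponential and polynomial moments\<close>

text \<open>Up to the factor exp (- |c|^2 / 2) the integrand is the density of a translated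
  probability measure, so its integral is finite without any computation.\<close>

lemma integrable_exp_inner: "integrable gaussian (\<lambda>x. exp (c \<bullet> x))" for c :: "real ^ 'n"
proof -
  have "(\<integral>\<^sup>+x. ennreal (exp (c \<bullet> x - (norm c)\<^sup>2 / 2)) \<partial>gaussian) = emeasure (distr gaussian borel (\<lambda>x. x + c)) UNIV"
    unfolding distr_gaussian_translate by (simp add: emeasure_density)
  also have "\<dots> = 1"
    using gauss.emeasure_space_1 by (simp add: emeasure_distr)
  finally have "integrable gaussian (\<lambda>x. exp (c \<bullet> x - (norm c)\<^sup>2 / 2))"
    by (intro integrableI_nonneg) auto
  then have "integrable gaussian (\<lambda>x. exp ((norm c)\<^sup>2 / 2) * exp (c \<bullet> x - (norm c)\<^sup>2 / 2))"
    by simp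
  then show ?thesis by (simp add: exp_add[symmetric])
qed

lemma integrable_exp_abs_component: "integrable gaussian (\<lambda>x :: real ^ 'n. exp (c * \<bar>x $ i\<bar>))"
proof (rule Bochner_Integration.integrable_bound)
  show "integrable gaussian (\<lambda>x :: real ^ 'n. exp ((axis i c) \<bullet> x) + exp ((axis i (- c)) \<bullet> x))"
    by (intro Bochner_Integration.integrable_add integrable_exp_inner)
  show "AE x :: real ^ 'n in gaussian. norm (exp (c * \<bar>x $ i\<bar>)) \<le> norm (exp ((axis i c) \<bullet> x) + exp ((axis i (- c)) \<bullet> x))"
  proof (rule AE_I2)
    fix x :: "real ^ 'n"
    have "0 < exp (c * x $ i)" "0 < exp (- (c * x $ i))" by simp_all
    then show "norm (exp (c * \<bar>x $ i\<bar>)) \<le> norm (exp ((axis i c) \<bullet> x) + exp ((axis i (- c)) \<bullet> x))"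
      by (cases "x $ i < 0") (simp_all add: inner_axis' del: exp_gt_zero)
  qed
qed simp

lemma abs_le_exp_abs: "\<bar>t\<bar> \<le> exp \<bar>t\<bar>" for t :: real
  using exp_ge_add_one_self[of "\<bar>t\<bar>"] by linarith

lemma integrable_component_sq [simp]: "integrable gaussian (\<lambda>x :: real ^ 'n. (x $ i)\<^sup>2)"
proof (rule Bochner_Integration.integrable_bound[OF integrable_exp_abs_component[of 2 i]])
  show "AE x :: real ^ 'n in gaussian. norm ((x $ i)\<^sup>2) \<le> norm (exp (2 * \<bar>x $ i\<bar>))"
  proof (intro AE_I2)
    fix x :: "real ^ 'n"
    have "\<bar>x $ i\<bar>\<^sup>2 \<le> (exp \<bar>x $ i\<bar>)\<^sup>2"
      by (intro power_mono abs_le_exp_abs) auto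
    then show "norm ((x $ i)\<^sup>2) \<le> norm (exp (2 * \<bar>x $ i\<bar>))"
      by (simp add: exp_double)
  qed
qed simp

lemma integrable_abs_component [simp]: "integrable gaussian (\<lambda>x :: real ^ 'n. \<bar>x $ i\<bar>)"
  by (rule Bochner_Integration.integrable_bound[OF integrable_exp_abs_component[of 1 i]])
    (auto simp: abs_le_exp_abs)

lemma integrable_component [simp]: "integrable gaussian (\<lambda>x :: real ^ 'n. x $ i)"
  by (rule Bochner_Integration.integrable_bound[OF integrable_abs_component[of i]]) auto

lemma integrable_bounded:
  fixes f :: "real ^ 'n \<Rightarrow> real"
  assumes "f \<in> borel_measurable borel" "\<And>x. \<bar>f x\<bar> \<le> M"
  shows "integrable gaussian f"
  by (rule gauss.integrable_const_bound[where B = M]) (use assms in auto)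

lemma bsmooth_integrable: "bsmooth f \<Longrightarrow> integrable gaussian f"
  by (metis bsmooth_borel_measurable bsmooth_bounded integrable_bounded)

lemma integrable_mult_bounded:
  fixes f g :: "real ^ 'n \<Rightarrow> real"
  assumes "f \<in> borel_measurable borel" "\<And>x. \<bar>f x\<bar> \<le> M" and g: "integrable gaussian g"
  shows "integrable gaussian (\<lambda>x. f x * g x)"
  using integrable_bounded_mult[of f gaussian M g] assms by (simp add: mult.commute)

text \<open>The Gaussian measure translated by \<open>t e\<^sub>i\<close> has density \<open>exp (t x\<^sub>i - t\<^sup>2/2)\<close>; differentiating
  both sides of the change of variables at \<open>t = 0\<close> gives the formula.\<close>

lemma gaussian_integration_by_parts:
  fixes \<phi> :: "real ^ 'n \<Rightarrow> real"
  assumes diff: "\<And>x. \<phi> differentiable (at x)" and w: "integrable gaussian (\<lambda>x. exp (2 * \<bar>x $ i\<bar>) * \<phi> x)"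
    and N: "\<And>x. \<bar>partial_deriv i \<phi> x\<bar> \<le> N" and [measurable]: "partial_deriv i \<phi> \<in> borel_measurable borel"
  shows "(\<integral>x. partial_deriv i \<phi> x \<partial>gaussian) = (\<integral>x. x $ i * \<phi> x \<partial>gaussian)"
proof -
  have "continuous_on UNIV \<phi>"
    using diff by (meson continuous_at_imp_continuous_on differentiable_imp_continuous_within)
  then have [measurable]: "\<phi> \<in> borel_measurable borel"
    by (rule borel_measurable_continuous_onI)
  have int: "integrable gaussian \<phi>"
    by (rule Bochner_Integration.integrable_bound[OF w]) (auto simp: abs_mult mult_le_cancel_right1)
  have w': "integrable gaussian (\<lambda>x. exp (2 * \<bar>x $ i\<bar>) * \<bar>\<phi> x\<bar>)"
    using integrable_abs[OF w] by (simp add: abs_mult)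
  let ?e = "axis i 1 :: real ^ 'n"
  have line: "((\<lambda>t. \<phi> (x + t *\<^sub>R ?e)) has_real_derivative partial_deriv i \<phi> (x + t *\<^sub>R ?e)) (at t)" for x t
    by (rule partial_deriv_line[OF diff])
  have "((\<lambda>t. \<integral>x. \<phi> (x + t *\<^sub>R ?e) \<partial>gaussian) has_real_derivative (\<integral>x. partial_deriv i \<phi> (x + 0 *\<^sub>R ?e) \<partial>gaussian)) (at 0)"
    by (rule has_derivative_integral[where a = "-1" and b = 1 and w = "\<lambda>_. N"])
      (auto intro!: line N int)
  moreover have "((\<lambda>t. \<integral>x. exp (t * x $ i - t\<^sup>2 / 2) * \<phi> x \<partial>gaussian) has_real_derivative
      (\<integral>x. ((x $ i - 0) * exp (0 * x $ i - 0\<^sup>2 / 2)) * \<phi> x \<partial>gaussian)) (at 0)"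
  proof (rule has_derivative_integral[where a = "-1" and b = 1 and w = "\<lambda>x. exp (2 * \<bar>x $ i\<bar>) * \<bar>\<phi> x\<bar>"
        and f' = "\<lambda>t x. ((x $ i - t) * exp (t * x $ i - t\<^sup>2 / 2)) * \<phi> x"])
    fix t :: real and x :: "real ^ 'n" assume t: "t \<in> {-1<..<1}"
    show "((\<lambda>t. exp (t * x $ i - t\<^sup>2 / 2) * \<phi> x) has_real_derivative
        ((x $ i - t) * exp (t * x $ i - t\<^sup>2 / 2)) * \<phi> x) (at t)"
      by (auto intro!: derivative_eq_intros)
    \<comment> \<open>For |t| < 1 both the linear and the exponential factor are at most exp |x_i|;
      this is where the weight \<open>exp (2 * \<bar>x $ i\<bar>)\<close> in the hypothesis comes
      from.\<close>
    have "\<bar>x $ i - t\<bar> \<le> exp \<bar>x $ i\<bar>"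
    proof -
      have "\<bar>x $ i - t\<bar> \<le> 1 + \<bar>x $ i\<bar>" using t by (simp add: abs_real_def split: if_splits)
      also have "\<dots> \<le> exp \<bar>x $ i\<bar>" by (rule exp_ge_add_one_self)
      finally show ?thesis .
    qed
    moreover have "t * x $ i - t\<^sup>2 / 2 \<le> \<bar>x $ i\<bar>"
    proof -
      have "t * x $ i \<le> \<bar>t\<bar> * \<bar>x $ i\<bar>" by (metis abs_ge_self abs_mult)
      also have "\<dots> \<le> 1 * \<bar>x $ i\<bar>" using t by (intro mult_right_mono) auto
      finally show ?thesis by (simp add: add_increasing2 algebra_simps)
    qed
    ultimately have "\<bar>x $ i - t\<bar> * exp (t * x $ i - t\<^sup>2 / 2) \<le> exp \<bar>x $ i\<bar> * exp \<bar>x $ i\<bar>"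
      by (intro mult_mono) auto
    then show "\<bar>((x $ i - t) * exp (t * x $ i - t\<^sup>2 / 2)) * \<phi> x\<bar> \<le> exp (2 * \<bar>x $ i\<bar>) * \<bar>\<phi> x\<bar>"
      by (auto simp: abs_mult exp_double power2_eq_square intro!: mult_mono)
  qed (use int w' in auto)
  moreover have "(\<integral>x. \<phi> (x + t *\<^sub>R ?e) \<partial>gaussian) = (\<integral>x. exp (t * x $ i - t\<^sup>2 / 2) * \<phi> x \<partial>gaussian)" for t
    by (subst integral_gaussian_translate) (simp_all add: inner_axis' power_mult_distrib)
  ultimately show ?thesis
    using DERIV_unique by fastforce
qed

section \<open>The Ornstein-Uhlenbeck flow\<close>

lemma measure_gaussian_UNIV [simp]: "measure gaussian (UNIV :: (real ^ 'n) set) = 1"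
  using gauss.prob_space by simp

text \<open>The operator \<Delta> - x \<bullet> \<nabla>, the generator of the Ornstein-Uhlenbeck
  semigroup.\<close>

definition gauss_op :: "(real ^ 'n \<Rightarrow> real) \<Rightarrow> real ^ 'n \<Rightarrow> real" where
  "gauss_op \<psi> x = (\<Sum>i\<in>UNIV. partial_deriv i (partial_deriv i \<psi>) x - x $ i * partial_deriv i \<psi> x)"

lemma bsmooth_component_integrable:
  assumes "bsmooth \<phi>" shows "integrable gaussian (\<lambda>x. x $ i * \<phi> x)"
proof -
  obtain M where "\<And>x. \<bar>\<phi> x\<bar> \<le> M" using bsmooth_bounded[OF assms] by blast
  then have "integrable gaussian (\<lambda>x. \<phi> x * x $ i)"
    using bsmooth_borel_measurable[OF assms] by (intro integrable_mult_bounded) auto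
  then show ?thesis by (simp add: mult.commute)
qed

lemma bsmooth_integration_by_parts:
  assumes "bsmooth \<phi>"
  shows "(\<integral>x. partial_deriv i \<phi> x \<partial>gaussian) = (\<integral>x. x $ i * \<phi> x \<partial>gaussian)"
proof -
  obtain M N where M: "\<And>x. \<bar>\<phi> x\<bar> \<le> M" "\<And>x. \<bar>partial_deriv i \<phi> x\<bar> \<le> N"
    using bsmooth_bounded[OF assms] bsmooth_bounded[OF bsmooth_partial_deriv[OF assms, of i]] by blast
  show ?thesis
  proof (rule gaussian_integration_by_parts[OF bsmooth_differentiable[OF assms] _ M(2)
          bsmooth_borel_measurable[OF bsmooth_partial_deriv[OF assms]]])
    have "integrable gaussian (\<lambda>x. \<phi> x * exp (2 * \<bar>x $ i\<bar>))"
      by (rule integrable_mult_bounded[OF bsmooth_borel_measurable[OF assms] M(1) integrable_exp_abs_component])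
    then show "integrable gaussian (\<lambda>x. exp (2 * \<bar>x $ i\<bar>) * \<phi> x)" by (simp add: mult.commute)
  qed
qed

text \<open>Gaussian integration by parts for \<phi> times a partial derivative of \<psi> cancels
  the drift term and leaves the Dirichlet form.\<close>

lemma gauss_op_symmetric:
  assumes \<phi>: "bsmooth \<phi>" and \<psi>: "bsmooth \<psi>"
  shows "(\<integral>x. \<phi> x * gauss_op \<psi> x \<partial>gaussian) = - (\<Sum>i\<in>UNIV. \<integral>x. partial_deriv i \<phi> x * partial_deriv i \<psi> x \<partial>gaussian)"
proof -
  have *: "\<phi> x * gauss_op \<psi> x = (\<Sum>i\<in>UNIV. \<phi> x * partial_deriv i (partial_deriv i \<psi>) x - x $ i * (\<phi> x * partial_deriv i \<psi> x))" for x
    by (simp add: gauss_op_def sum_distrib_left algebra_simps)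
  have "(\<integral>x. \<phi> x * partial_deriv i (partial_deriv i \<psi>) x - x $ i * (\<phi> x * partial_deriv i \<psi> x) \<partial>gaussian)
      = - (\<integral>x. partial_deriv i \<phi> x * partial_deriv i \<psi> x \<partial>gaussian)" for i
  proof -
    note s = bsmooth_mult[OF \<phi> bsmooth_partial_deriv[OF \<psi>, of i]]
    have "(\<integral>x. x $ i * (\<phi> x * partial_deriv i \<psi> x) \<partial>gaussian) = (\<integral>x. partial_deriv i (\<lambda>x. \<phi> x * partial_deriv i \<psi> x) x \<partial>gaussian)"
      using bsmooth_integration_by_parts[OF s, of i] by simp
    also have "\<dots> = (\<integral>x. \<phi> x * partial_deriv i (partial_deriv i \<psi>) x + partial_deriv i \<phi> x * partial_deriv i \<psi> x \<partial>gaussian)"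
      by (simp add: partial_deriv_mult \<phi> bsmooth_partial_deriv[OF \<psi>])
    also have "\<dots> = (\<integral>x. \<phi> x * partial_deriv i (partial_deriv i \<psi>) x \<partial>gaussian) + (\<integral>x. partial_deriv i \<phi> x * partial_deriv i \<psi> x \<partial>gaussian)"
      by (intro Bochner_Integration.integral_add bsmooth_integrable bsmooth_mult bsmooth_partial_deriv assms)
    finally show ?thesis
      by (subst Bochner_Integration.integral_diff)
        (auto intro!: bsmooth_integrable bsmooth_component_integrable bsmooth_mult bsmooth_partial_deriv assms)
  qed
  moreover have "integrable gaussian (\<lambda>x. \<phi> x * partial_deriv i (partial_deriv i \<psi>) x - x $ i * (\<phi> x * partial_deriv i \<psi> x))" for i
    by (intro Bochner_Integration.integrable_diff bsmooth_integrable
        bsmooth_component_integrable bsmooth_mult bsmooth_partial_deriv assms)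
  ultimately show ?thesis
    unfolding * by (subst Bochner_Integration.integral_sum) (simp_all add: sum_negf)
qed

text \<open>The Ornstein-Uhlenbeck semigroup \<open>P\<^sub>t\<close>, reparametrised by \<open>e\<^sup>-\<^sup>t = cos \<theta>\<close>, so that the flow
  reaches the mean value at the finite time \<open>\<theta> = \<pi>/2\<close>.\<close>

definition ou :: "real \<Rightarrow> (real ^ 'n \<Rightarrow> real) \<Rightarrow> real ^ 'n \<Rightarrow> real" where
  "ou \<theta> F x = (\<integral>y. F (cos \<theta> *\<^sub>R x + sin \<theta> *\<^sub>R y) \<partial>gaussian)"

lemma ou_zero [simp]: "ou 0 F x = F x"
  by (simp add: ou_def gauss.prob_space)

lemma ou_pi_half [simp]: "ou (pi / 2) F x = (\<integral>y. F y \<partial>gaussian)"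
  by (simp add: ou_def)

lemma ou_average: "ou \<theta> F = (\<lambda>x. \<integral>y. 1 * F (cos \<theta> *\<^sub>R x + sin \<theta> *\<^sub>R y) \<partial>gaussian)"
  by (simp add: ou_def fun_eq_iff)

lemma ou_bsmooth: "bsmooth F \<Longrightarrow> bsmooth (ou \<theta> F)"
  unfolding ou_average by (rule bsmooth_average) auto

lemma partial_deriv_ou:
  assumes "bsmooth F"
  shows "partial_deriv i (ou \<theta> F) x = cos \<theta> * ou \<theta> (partial_deriv i F) x"
  unfolding ou_average by (rule partial_deriv_average[OF assms]) auto

lemma partial_deriv_scale:
  assumes "bsmooth F" shows "partial_deriv i (\<lambda>x. c * F x) x = c * partial_deriv i F x"
  by (rule partial_deriv_eq) (auto intro!: derivative_eq_intros bsmooth_has_derivative assms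
      simp: sum_distrib_left mult_ac)

lemma partial_deriv_ou2:
  assumes "bsmooth F"
  shows "partial_deriv j (partial_deriv i (ou \<theta> F)) x = (cos \<theta>)\<^sup>2 * ou \<theta> (partial_deriv j (partial_deriv i F)) x"
proof -
  have "partial_deriv i (ou \<theta> F) = (\<lambda>x. cos \<theta> * ou \<theta> (partial_deriv i F) x)"
    using partial_deriv_ou[OF assms] by blast
  then show ?thesis
    by (simp add: partial_deriv_scale ou_bsmooth bsmooth_partial_deriv assms partial_deriv_ou power2_eq_square)
qed

lemma ou_integrand_measurable:
  "bsmooth F \<Longrightarrow> (\<lambda>y. F (cos \<theta> *\<^sub>R x + sin \<theta> *\<^sub>R y)) \<in> borel_measurable borel"
  by (rule measurable_compose[OF _ bsmooth_borel_measurable]) simp_all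

lemma ou_integrable:
  "bsmooth F \<Longrightarrow> integrable gaussian (\<lambda>y. F (cos \<theta> *\<^sub>R x + sin \<theta> *\<^sub>R y))"
  using bsmooth_bounded[of F] by (metis integrable_bounded ou_integrand_measurable)

lemma ou_ge: "bsmooth F \<Longrightarrow> (\<And>x. \<alpha> \<le> F x) \<Longrightarrow> \<alpha> \<le> ou \<theta> F x"
  unfolding ou_def by (rule gauss.integral_ge_const) (auto intro: ou_integrable)

lemma ou_le: "bsmooth F \<Longrightarrow> (\<And>x. F x \<le> \<alpha>) \<Longrightarrow> ou \<theta> F x \<le> \<alpha>"
  unfolding ou_def by (rule gauss.integral_le_const) (auto intro: ou_integrable)

lemma ou_abs_le: "bsmooth F \<Longrightarrow> (\<And>x. \<bar>F x\<bar> \<le> M) \<Longrightarrow> \<bar>ou \<theta> F x\<bar> \<le> M"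
  using ou_le[of F M] ou_ge[of F "- M"] by (auto simp: abs_le_iff minus_le_iff)

text \<open>The \<theta>-derivative of the flow. Where cos \<theta> is nonzero it equals tan
  \<theta> times the generator; this form avoids the division, so that it stays valid at \<theta> =
  \<pi>/2 and admits a majorant uniform in \<theta>.\<close>

definition ou_dot :: "real \<Rightarrow> (real ^ 'n \<Rightarrow> real) \<Rightarrow> real ^ 'n \<Rightarrow> real" where
  "ou_dot \<theta> F x = sin \<theta> * (\<Sum>i\<in>UNIV. cos \<theta> * ou \<theta> (partial_deriv i (partial_deriv i F)) x - x $ i * ou \<theta> (partial_deriv i F) x)"

lemma gauss_op_ou: "bsmooth F \<Longrightarrow> sin \<theta> * gauss_op (ou \<theta> F) x = cos \<theta> * ou_dot \<theta> F x"
  by (simp add: gauss_op_def ou_dot_def partial_deriv_ou partial_deriv_ou2 sum_distrib_left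
      power2_eq_square algebra_simps)

lemma ou_dot_measurable: "bsmooth F \<Longrightarrow> ou_dot \<theta> F \<in> borel_measurable borel"
proof -
  assume F: "bsmooth F"
  note [measurable] = bsmooth_borel_measurable[OF ou_bsmooth[OF bsmooth_partial_deriv[OF F]]]
    bsmooth_borel_measurable[OF ou_bsmooth[OF bsmooth_partial_deriv[OF bsmooth_partial_deriv[OF F]]]]
  show ?thesis unfolding ou_dot_def by measurable
qed

text \<open>The chain rule gives the gradient of F paired with - sin \<theta> x + cos \<theta> y.
  Integrating by parts in y trades y_i for sin \<theta> times a further i-th derivative, so the
  y-part becomes the second-order term of \<open>ou_dot\<close>.\<close>

lemma ou_has_derivative:
  assumes F: "bsmooth F"
  shows "((\<lambda>\<theta>. ou \<theta> F x) has_real_derivative ou_dot \<theta> F x) (at \<theta>)"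
proof -
  have "\<exists>M. \<forall>x. \<bar>partial_deriv i F x\<bar> \<le> M" for i
    using bsmooth_bounded bsmooth_partial_deriv[OF F] by blast
  then obtain M where M: "\<And>i x. \<bar>partial_deriv i F x\<bar> \<le> M i" by metis
  have M0: "0 \<le> M i" for i using M[of i 0] by linarith
  let ?X = "\<lambda>\<theta> y. cos \<theta> *\<^sub>R x + sin \<theta> *\<^sub>R y"
  let ?X' = "\<lambda>\<theta> y. (- sin \<theta>) *\<^sub>R x + cos \<theta> *\<^sub>R y"
  let ?f' = "\<lambda>\<theta> y. \<Sum>i\<in>UNIV. partial_deriv i F (?X \<theta> y) * (?X' \<theta> y) $ i"
  have "((\<lambda>\<theta>. \<integral>y. F (?X \<theta> y) \<partial>gaussian) has_real_derivative (\<integral>y. ?f' \<theta> y \<partial>gaussian)) (at \<theta>)"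
  proof (rule has_derivative_integral[where a = "\<theta> - 1" and b = "\<theta> + 1" and w = "\<lambda>y. \<Sum>i\<in>UNIV. M i * (\<bar>x $ i\<bar> + \<bar>y $ i\<bar>)"])
    fix t and y :: "real ^ 'a"
    have "((\<lambda>t. ?X t y) has_derivative (\<lambda>h. h *\<^sub>R ?X' t y)) (at t)"
      by (auto intro!: derivative_eq_intros simp: algebra_simps)
    from has_derivative_compose[OF this bsmooth_has_derivative[OF F]]
    show "((\<lambda>t. F (?X t y)) has_real_derivative ?f' t y) (at t)"
      unfolding has_field_derivative_def by (rule has_derivative_eq_rhs)
        (simp add: fun_eq_iff sum_distrib_left sum_distrib_right mult_ac)
    have "\<bar>?X' t y $ i\<bar> \<le> \<bar>x $ i\<bar> + \<bar>y $ i\<bar>" for i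
    proof -
      have "\<bar>?X' t y $ i\<bar> \<le> \<bar>sin t\<bar> * \<bar>x $ i\<bar> + \<bar>cos t\<bar> * \<bar>y $ i\<bar>"
        using abs_triangle_ineq[of "- sin t * x $ i" "cos t * y $ i"] by (simp add: abs_mult)
      also have "\<dots> \<le> 1 * \<bar>x $ i\<bar> + 1 * \<bar>y $ i\<bar>"
        by (intro add_mono mult_right_mono) auto
      finally show ?thesis by simp
    qed
    then show "\<bar>?f' t y\<bar> \<le> (\<Sum>i\<in>UNIV. M i * (\<bar>x $ i\<bar> + \<bar>y $ i\<bar>))"
      by (intro order_trans[OF sum_abs] sum_mono) (simp only: abs_mult, intro mult_mono M M0 abs_ge_zero)
  next
    show "?f' \<theta> \<in> borel_measurable gaussian"
      unfolding measurable_gaussian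
      by (intro borel_measurable_sum borel_measurable_times ou_integrand_measurable bsmooth_partial_deriv F) auto
  qed (use F in \<open>auto intro!: ou_integrable ou_integrand_measurable Bochner_Integration.integrable_sum\<close>)
  moreover have "(\<integral>y. ?f' \<theta> y \<partial>gaussian) = ou_dot \<theta> F x"
  proof -
    have i1: "integrable gaussian (\<lambda>y. y $ i * partial_deriv i F (?X \<theta> y))" for i
      using integrable_mult_bounded[OF ou_integrand_measurable[OF bsmooth_partial_deriv[OF F]] M integrable_component[of i]]
      by (simp add: mult.commute)
    have ibp: "(\<integral>y. y $ i * partial_deriv i F (?X \<theta> y) \<partial>gaussian) = sin \<theta> * (\<integral>y. partial_deriv i (partial_deriv i F) (?X \<theta> y) \<partial>gaussian)" for i
    proof -
      let ?\<phi> = "\<lambda>y. partial_deriv i F (?X \<theta> y)"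
      have \<phi>: "bsmooth ?\<phi>" "partial_deriv i ?\<phi> y = sin \<theta> * partial_deriv i (partial_deriv i F) (?X \<theta> y)" for y
        using bsmooth_average[of "partial_deriv i F" gaussian "\<lambda>_. 1" "\<lambda>_. cos \<theta> *\<^sub>R x" "sin \<theta>"]
          partial_deriv_average[of "partial_deriv i F" gaussian "\<lambda>_. 1" "\<lambda>_. cos \<theta> *\<^sub>R x" i "sin \<theta>" y]
        by (simp_all add: gauss.prob_space bsmooth_partial_deriv F add.commute)
      show ?thesis
        using bsmooth_integration_by_parts[OF \<phi>(1), of i] by (simp add: \<phi>(2))
    qed
    have "?f' \<theta> y = (\<Sum>i\<in>UNIV. cos \<theta> * (y $ i * partial_deriv i F (?X \<theta> y)) - (sin \<theta> * x $ i) * partial_deriv i F (?X \<theta> y))" for y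
      by (intro sum.cong) (simp_all add: algebra_simps)
    then have "(\<integral>y. ?f' \<theta> y \<partial>gaussian) = (\<Sum>i\<in>UNIV. \<integral>y. cos \<theta> * (y $ i * partial_deriv i F (?X \<theta> y)) - (sin \<theta> * x $ i) * partial_deriv i F (?X \<theta> y) \<partial>gaussian)"
      by (simp only:) (intro Bochner_Integration.integral_sum Bochner_Integration.integrable_diff integrable_mult_right i1 ou_integrable bsmooth_partial_deriv F)
    also have "\<dots> = (\<Sum>i\<in>UNIV. cos \<theta> * (sin \<theta> * ou \<theta> (partial_deriv i (partial_deriv i F)) x) - (sin \<theta> * x $ i) * ou \<theta> (partial_deriv i F) x)"
      by (intro sum.cong refl, subst Bochner_Integration.integral_diff)
        (simp_all add: ibp i1 ou_integrable bsmooth_partial_deriv F ou_def)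
    also have "\<dots> = ou_dot \<theta> F x"
      unfolding ou_dot_def sum_distrib_left by (intro sum.cong) (simp_all add: algebra_simps)
    finally show ?thesis .
  qed
  ultimately show ?thesis unfolding ou_def by simp
qed

text \<open>One majorant for all \<theta>, used in the later differentiations under the Gaussian
  integral. It grows linearly in x because of the drift term.\<close>

lemma ou_dot_bound:
  assumes F: "bsmooth F"
  obtains w where "integrable gaussian w" "\<And>\<theta> x. \<bar>ou_dot \<theta> F x\<bar> \<le> w x" "\<And>x. 0 \<le> w x"
proof -
  have "\<exists>M. \<forall>x. \<bar>partial_deriv i F x\<bar> \<le> M" "\<exists>M. \<forall>x. \<bar>partial_deriv i (partial_deriv i F) x\<bar> \<le> M" for i
    using bsmooth_bounded bsmooth_partial_deriv[OF F] bsmooth_partial_deriv[OF bsmooth_partial_deriv[OF F]] by blast+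
  then obtain M N where M: "\<And>i x. \<bar>partial_deriv i F x\<bar> \<le> M i" and N: "\<And>i x. \<bar>partial_deriv i (partial_deriv i F) x\<bar> \<le> N i"
    by metis
  have M0: "0 \<le> M i" "0 \<le> N i" for i using M[of i 0] N[of i 0] by linarith+
  let ?w = "\<lambda>x :: real ^ 'a. \<Sum>i\<in>UNIV. N i + \<bar>x $ i\<bar> * M i"
  have "\<bar>ou_dot \<theta> F x\<bar> \<le> ?w x" for \<theta> x
  proof -
    have "\<bar>cos \<theta> * ou \<theta> (partial_deriv i (partial_deriv i F)) x - x $ i * ou \<theta> (partial_deriv i F) x\<bar> \<le> N i + \<bar>x $ i\<bar> * M i" for i
    proof -
      have "\<bar>cos \<theta>\<bar> * \<bar>ou \<theta> (partial_deriv i (partial_deriv i F)) x\<bar> \<le> 1 * N i"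
        by (intro mult_mono ou_abs_le N bsmooth_partial_deriv F) (auto simp: M0)
      moreover have "\<bar>x $ i\<bar> * \<bar>ou \<theta> (partial_deriv i F) x\<bar> \<le> \<bar>x $ i\<bar> * M i"
        by (intro mult_left_mono ou_abs_le M bsmooth_partial_deriv F) auto
      ultimately show ?thesis
        unfolding abs_mult[symmetric] by linarith
    qed
    then have "\<bar>\<Sum>i\<in>UNIV. cos \<theta> * ou \<theta> (partial_deriv i (partial_deriv i F)) x - x $ i * ou \<theta> (partial_deriv i F) x\<bar> \<le> ?w x"
      by (intro order_trans[OF sum_abs] sum_mono)
    then have "\<bar>sin \<theta>\<bar> * \<bar>\<Sum>i\<in>UNIV. cos \<theta> * ou \<theta> (partial_deriv i (partial_deriv i F)) x - x $ i * ou \<theta> (partial_deriv i F) x\<bar> \<le> 1 * ?w x"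
      by (intro mult_mono) auto
    then show ?thesis by (simp add: ou_dot_def abs_mult)
  qed
  moreover have "integrable gaussian ?w"
    by (intro Bochner_Integration.integrable_sum Bochner_Integration.integrable_add integrable_mult_left) auto
  moreover have "0 \<le> ?w x" for x by (intro sum_nonneg) (simp add: M0)
  ultimately show ?thesis using that by blast
qed

section \<open>The Poincare inequality and the decay of the deficit\<close>

text \<open>With cos \<theta> = e^(-t) the factor tan \<theta> is dt/d\<theta>, so this is the
  evolution equation of the semigroup in weak form.\<close>

lemma integral_mult_ou_dot:
  assumes \<phi>: "bsmooth \<phi>" and F: "bsmooth F" and "cos \<theta> \<noteq> 0"
  shows "(\<integral>x. \<phi> x * ou_dot \<theta> F x \<partial>gaussian)
    = - tan \<theta> * (\<Sum>i\<in>UNIV. \<integral>x. partial_deriv i \<phi> x * partial_deriv i (ou \<theta> F) x \<partial>gaussian)"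
proof -
  have "ou_dot \<theta> F x = tan \<theta> * gauss_op (ou \<theta> F) x" for x
    using gauss_op_ou[OF F, of \<theta> x] assms(3) by (simp add: tan_def divide_simps mult.commute)
  then have "(\<integral>x. \<phi> x * ou_dot \<theta> F x \<partial>gaussian) = (\<integral>x. tan \<theta> * (\<phi> x * gauss_op (ou \<theta> F) x) \<partial>gaussian)"
    by (simp add: mult_ac)
  also have "\<dots> = tan \<theta> * (\<integral>x. \<phi> x * gauss_op (ou \<theta> F) x \<partial>gaussian)"
    by (rule integral_mult_right_zero)
  finally show ?thesis
    by (simp add: gauss_op_symmetric[OF \<phi> ou_bsmooth[OF F]])
qed

text \<open>Along the flow the squared norm has derivative -2 tan \<theta> times the Dirichlet
  energy, which is not positive.\<close>

lemma ou_contraction: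
  assumes F: "bsmooth F" and "0 \<le> \<theta>" "\<theta> < pi / 2"
  shows "(\<integral>x. (ou \<theta> F x)\<^sup>2 \<partial>gaussian) \<le> (\<integral>x. (F x)\<^sup>2 \<partial>gaussian)"
proof -
  obtain w where w: "integrable gaussian w" "\<And>\<theta> x. \<bar>ou_dot \<theta> F x\<bar> \<le> w x" "\<And>x. 0 \<le> w x"
    using ou_dot_bound[OF F] by blast
  obtain M where M: "M > 0" "\<And>x. \<bar>F x\<bar> \<le> M" using bsmooth_bounded_pos[OF F] by blast
  have deriv: "((\<lambda>t. \<integral>x. (ou t F x)\<^sup>2 \<partial>gaussian) has_real_derivative (\<integral>x. (2 * ou t F x) * ou_dot t F x \<partial>gaussian)) (at t)" for t
  proof (rule has_derivative_integral[where a = "t - 1" and b = "t + 1" and w = "\<lambda>x. (2 * M) * w x"])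
    fix s x
    show "((\<lambda>t. (ou t F x)\<^sup>2) has_real_derivative (2 * ou s F x) * ou_dot s F x) (at s)"
      by (auto intro!: derivative_eq_intros ou_has_derivative F)
    have "\<bar>2 * ou s F x\<bar> \<le> 2 * M" using ou_abs_le[OF F M(2)] by (simp add: abs_mult)
    then show "\<bar>(2 * ou s F x) * ou_dot s F x\<bar> \<le> (2 * M) * w x"
      unfolding abs_mult[of "2 * ou s F x"] using w M(1) by (intro mult_mono) auto
  next
    fix s show "(\<lambda>x. (ou s F x)\<^sup>2) \<in> borel_measurable gaussian"
      using bsmooth_borel_measurable[OF ou_bsmooth[OF F]] by simp
  next
    show "(\<lambda>x. (2 * ou t F x) * ou_dot t F x) \<in> borel_measurable gaussian"
      using bsmooth_borel_measurable[OF ou_bsmooth[OF F]] ou_dot_measurable[OF F] by simp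
    show "integrable gaussian (\<lambda>x. (ou t F x)\<^sup>2)"
      unfolding power2_eq_square by (intro bsmooth_integrable bsmooth_mult ou_bsmooth F)
  qed (use w in auto)
  have "(\<lambda>t. \<integral>x. (ou t F x)\<^sup>2 \<partial>gaussian) \<theta> \<le> (\<lambda>t. \<integral>x. (ou t F x)\<^sup>2 \<partial>gaussian) 0"
  proof (rule DERIV_nonpos_imp_nonincreasing[OF assms(2)])
    fix t :: real assume t: "0 \<le> t" "t \<le> \<theta>"
    then have c: "cos t > 0" using assms by (intro cos_gt_zero_pi) auto
    have "tan t \<ge> 0" using t assms c by (simp add: tan_def sin_ge_zero)
    have sm: "bsmooth (\<lambda>x. 2 * ou t F x)" by (intro bsmooth_mult bsmooth_const ou_bsmooth F)
    have "(\<integral>x. (2 * ou t F x) * ou_dot t F x \<partial>gaussian) = - tan t *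
        (\<Sum>i\<in>UNIV. \<integral>x. (2 * partial_deriv i (ou t F) x) * partial_deriv i (ou t F) x \<partial>gaussian)"
      using integral_mult_ou_dot[OF sm F, of t] c by (simp add: partial_deriv_scale ou_bsmooth F)
    also have "\<dots> \<le> 0"
      using \<open>tan t \<ge> 0\<close> by (auto intro!: mult_nonneg_nonneg sum_nonneg integral_nonneg simp: mult.assoc)
    finally show "\<exists>y. ((\<lambda>t. \<integral>x. (ou t F x)\<^sup>2 \<partial>gaussian) has_real_derivative y) (at t) \<and> y \<le> 0"
      using deriv by blast
  qed
  then show ?thesis by simp
qed

text \<open>The derivative of \<open>\<theta> \<mapsto> \<integral> \<phi> ou \<theta> \<phi>\<close>, which runs from \<open>\<integral> \<phi>\<^sup>2\<close> to \<open>(\<integral> \<phi>)\<^sup>2\<close>, is at least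
  \<open>- sin \<theta> \<integral> |\<nabla>\<phi>|\<^sup>2\<close>.\<close>

theorem gaussian_poincare:
  assumes \<phi>: "bsmooth \<phi>"
  shows "(\<integral>x. (\<phi> x - (\<integral>y. \<phi> y \<partial>gaussian))\<^sup>2 \<partial>gaussian) \<le> (\<Sum>i\<in>UNIV. \<integral>x. (partial_deriv i \<phi> x)\<^sup>2 \<partial>gaussian)"
proof -
  obtain w where w: "integrable gaussian w" "\<And>\<theta> x. \<bar>ou_dot \<theta> \<phi> x\<bar> \<le> w x" "\<And>x. 0 \<le> w x"
    using ou_dot_bound[OF \<phi>] by blast
  obtain M where M: "M > 0" "\<And>x. \<bar>\<phi> x\<bar> \<le> M" using bsmooth_bounded_pos[OF \<phi>] by blast
  let ?V = "\<lambda>t. \<integral>x. \<phi> x * ou t \<phi> x \<partial>gaussian"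
  let ?G = "\<Sum>i\<in>UNIV. \<integral>x. (partial_deriv i \<phi> x)\<^sup>2 \<partial>gaussian"
  have deriv: "(?V has_real_derivative (\<integral>x. \<phi> x * ou_dot t \<phi> x \<partial>gaussian)) (at t)" for t
  proof (rule has_derivative_integral[where a = "t - 1" and b = "t + 1" and w = "\<lambda>x. M * w x"])
    fix s x
    show "((\<lambda>t. \<phi> x * ou t \<phi> x) has_real_derivative \<phi> x * ou_dot s \<phi> x) (at s)"
      by (auto intro!: derivative_eq_intros ou_has_derivative \<phi>)
    show "\<bar>\<phi> x * ou_dot s \<phi> x\<bar> \<le> M * w x"
      unfolding abs_mult using w M by (intro mult_mono) auto
  next
    fix s show "(\<lambda>x. \<phi> x * ou s \<phi> x) \<in> borel_measurable gaussian"
      using bsmooth_borel_measurable[OF ou_bsmooth[OF \<phi>]] bsmooth_borel_measurable[OF \<phi>] by simp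
  next
    show "(\<lambda>x. \<phi> x * ou_dot t \<phi> x) \<in> borel_measurable gaussian"
      using bsmooth_borel_measurable[OF \<phi>] ou_dot_measurable[OF \<phi>] by simp
    show "integrable gaussian (\<lambda>x. \<phi> x * ou t \<phi> x)"
      by (intro bsmooth_integrable bsmooth_mult ou_bsmooth \<phi>)
  qed (use w in auto)
  \<comment> \<open>The end values are the second moment minus \<open>?G\<close> and the squared
    mean, so monotonicity is the claim. The criterion for open intervals is used because the
    identity involving tan breaks down at \<pi>/2.\<close>
  have "?V 0 - ?G * cos 0 \<le> ?V (pi / 2) - ?G * cos (pi / 2)"
  proof (rule DERIV_nonneg_imp_increasing_open[where f = "\<lambda>t. ?V t - ?G * cos t"])
    fix t :: real assume t: "0 < t" "t < pi / 2"
    then have c: "cos t > 0" "sin t \<ge> 0" by (auto intro: cos_gt_zero sin_ge_zero)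
    \<comment> \<open>Young's inequality, followed by the L2 contraction for the evolved
      factor.\<close>
    have le: "(\<integral>x. partial_deriv i \<phi> x * ou t (partial_deriv i \<phi>) x \<partial>gaussian) \<le> (\<integral>x. (partial_deriv i \<phi> x)\<^sup>2 \<partial>gaussian)" for i
    proof -
      note s = bsmooth_partial_deriv[OF \<phi>, of i]
      have i: "integrable gaussian (\<lambda>x. (partial_deriv i \<phi> x)\<^sup>2)" "integrable gaussian (\<lambda>x. (ou t (partial_deriv i \<phi>) x)\<^sup>2)"
        unfolding power2_eq_square by (intro bsmooth_integrable bsmooth_mult ou_bsmooth s)+
      have "(\<integral>x. partial_deriv i \<phi> x * ou t (partial_deriv i \<phi>) x \<partial>gaussian)
          \<le> (\<integral>x. ((partial_deriv i \<phi> x)\<^sup>2 + (ou t (partial_deriv i \<phi>) x)\<^sup>2) / 2 \<partial>gaussian)"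
      proof (rule integral_mono)
        fix x show "partial_deriv i \<phi> x * ou t (partial_deriv i \<phi>) x \<le> ((partial_deriv i \<phi> x)\<^sup>2 + (ou t (partial_deriv i \<phi>) x)\<^sup>2) / 2"
          using sum_squares_bound[of "partial_deriv i \<phi> x" "ou t (partial_deriv i \<phi>) x"] by simp
      qed (intro integrable_divide Bochner_Integration.integrable_add i bsmooth_integrable bsmooth_mult ou_bsmooth s)+
      also have "\<dots> = ((\<integral>x. (partial_deriv i \<phi> x)\<^sup>2 \<partial>gaussian) + (\<integral>x. (ou t (partial_deriv i \<phi>) x)\<^sup>2 \<partial>gaussian)) / 2"
        using i by simp
      finally show ?thesis using ou_contraction[OF s, of t] t by simp
    qed
    have "(\<integral>x. \<phi> x * ou_dot t \<phi> x \<partial>gaussian) = - sin t * (\<Sum>i\<in>UNIV. \<integral>x. partial_deriv i \<phi> x * ou t (partial_deriv i \<phi>) x \<partial>gaussian)"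
    proof -
      have "(\<integral>x. partial_deriv i \<phi> x * partial_deriv i (ou t \<phi>) x \<partial>gaussian) = cos t * (\<integral>x. partial_deriv i \<phi> x * ou t (partial_deriv i \<phi>) x \<partial>gaussian)" for i
        unfolding partial_deriv_ou[OF \<phi>] by (simp add: mult.left_commute[of _ "cos t"])
      then show ?thesis
        unfolding integral_mult_ou_dot[OF \<phi> \<phi> less_imp_neq[OF c(1), symmetric]]
        using c(1) by (simp add: sum_distrib_left[symmetric] tan_def)
    qed
    also have "\<dots> \<ge> - sin t * ?G"
      using c(2) by (auto intro!: mult_left_mono sum_mono le)
    finally have "0 \<le> (\<integral>x. \<phi> x * ou_dot t \<phi> x \<partial>gaussian) + ?G * sin t" by (simp add: mult.commute)
    moreover have "((\<lambda>t. ?V t - ?G * cos t) has_real_derivative (\<integral>x. \<phi> x * ou_dot t \<phi> x \<partial>gaussian) + ?G * sin t) (at t)"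
      by (auto intro!: derivative_eq_intros deriv)
    ultimately show "\<exists>y. ((\<lambda>t. ?V t - ?G * cos t) has_real_derivative y) (at t) \<and> 0 \<le> y" by blast
  next
    show "continuous_on {0..pi / 2} (\<lambda>t. ?V t - ?G * cos t)"
      by (intro continuous_intros continuous_at_imp_continuous_on ballI DERIV_isCont[OF deriv])
  qed simp
  moreover have "(\<integral>x. (\<phi> x - (\<integral>y. \<phi> y \<partial>gaussian))\<^sup>2 \<partial>gaussian) = (\<integral>x. \<phi> x * \<phi> x \<partial>gaussian) - (\<integral>y. \<phi> y \<partial>gaussian)\<^sup>2"
    using gauss.variance_eq[of \<phi>] bsmooth_integrable[OF \<phi>] bsmooth_integrable[OF bsmooth_mult[OF \<phi> \<phi>]]
    by (simp add: power2_eq_square)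
  ultimately show ?thesis by (simp add: power2_eq_square)
qed

section \<open>Entropy, Fisher information and deficit along the flow\<close>

locale smooth_density =
  fixes F :: "real ^ 'n \<Rightarrow> real" and \<alpha> :: real
  assumes F: "bsmooth F" and \<alpha>: "0 < \<alpha>" and ge: "\<And>x. \<alpha> \<le> F x"
begin

abbreviation "v \<theta> \<equiv> ou \<theta> F"
abbreviation "u i \<theta> \<equiv> ou \<theta> (partial_deriv i F)"
abbreviation "h \<theta> \<equiv> \<lambda>x. ln (v \<theta> x)"
abbreviation "p i \<theta> \<equiv> \<lambda>x. u i \<theta> x / v \<theta> x"

lemma v: "bsmooth (v \<theta>)" and v_ge: "\<alpha> \<le> v \<theta> x" and u: "bsmooth (u i \<theta>)"
  by (auto intro: ou_bsmooth F ou_ge ge bsmooth_partial_deriv)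

lemma v_pos: "0 < v \<theta> x"
  using v_ge[of \<theta> x] \<alpha> by linarith

lemma p: "bsmooth (p i \<theta>)"
  by (rule bsmooth_divide[OF u v \<alpha> v_ge])

lemma h: "bsmooth (h \<theta>)"
  by (rule bsmooth_ln[OF v \<alpha> v_ge])

lemma partial_deriv_h: "partial_deriv i (h \<theta>) = (\<lambda>x. cos \<theta> * p i \<theta> x)"
  using partial_deriv_eq[OF has_derivative_ln_partial[OF v \<alpha> v_ge]] by (simp add: partial_deriv_ou F fun_eq_iff)

lemma partial_deriv_p: "partial_deriv j (p i \<theta>) x = (partial_deriv j (u i \<theta>) x - p i \<theta> x * partial_deriv j (v \<theta>) x) / v \<theta> x"
  by (rule partial_deriv_divide[OF u v \<alpha> v_ge])

lemma partial_deriv_h2: "partial_deriv j (partial_deriv i (h \<theta>)) x = cos \<theta> * partial_deriv j (p i \<theta>) x"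
  unfolding partial_deriv_h by (rule partial_deriv_scale[OF p])

text \<open>Half the Fisher information of \<open>v \<theta>\<close> minus its entropy. The i-th
  partial derivative of \<open>v \<theta>\<close> is cos \<theta> times \<open>u i \<theta>\<close>,
  which explains the prefactor; in this form the expression is continuous up to \<pi>/2.\<close>

definition "D \<theta> = (cos \<theta>)\<^sup>2 / 2 * (\<Sum>i\<in>UNIV. \<integral>x. (u i \<theta> x)\<^sup>2 / v \<theta> x \<partial>gaussian) - (\<integral>x. v \<theta> x * ln (v \<theta> x) \<partial>gaussian)"

definition "J \<theta> = (\<Sum>i\<in>UNIV. \<Sum>j\<in>UNIV. \<integral>x. v \<theta> x * (partial_deriv j (partial_deriv i (h \<theta>)) x)\<^sup>2 \<partial>gaussian)"

lemma ln_v_bound: obtains K where "K > 0" "\<And>\<theta> x. \<bar>ln (v \<theta> x)\<bar> \<le> K"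
proof -
  obtain M where M: "M > 0" "\<And>x. \<bar>F x\<bar> \<le> M" using bsmooth_bounded_pos[OF F] by blast
  have "\<bar>ln (v \<theta> x)\<bar> \<le> \<bar>ln \<alpha>\<bar> + \<bar>ln M\<bar> + 1" for \<theta> x
  proof -
    have "v \<theta> x \<le> M" using ou_abs_le[OF F M(2), of \<theta> x] by linarith
    then have "ln \<alpha> \<le> ln (v \<theta> x)" "ln (v \<theta> x) \<le> ln M" using \<alpha> v_ge[of \<theta> x] by auto
    then show ?thesis by linarith
  qed
  then show ?thesis by (rule that[rotated]) simp
qed

lemma entropy_deriv:
  "((\<lambda>\<theta>. \<integral>x. v \<theta> x * ln (v \<theta> x) \<partial>gaussian) has_real_derivative
    (\<integral>x. (h \<theta> x + 1) * ou_dot \<theta> F x \<partial>gaussian)) (at \<theta>)"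
proof -
  obtain w where w: "integrable gaussian w" "\<And>\<theta> x. \<bar>ou_dot \<theta> F x\<bar> \<le> w x" "\<And>x. 0 \<le> w x"
    using ou_dot_bound[OF F] by blast
  obtain K where K: "K > 0" "\<And>\<theta> x. \<bar>ln (v \<theta> x)\<bar> \<le> K" using ln_v_bound by blast
  show ?thesis
  proof (rule has_derivative_integral[where a = "\<theta> - 1" and b = "\<theta> + 1" and w = "\<lambda>x. (K + 1) * w x"])
    fix s x
    show "((\<lambda>t. v t x * ln (v t x)) has_real_derivative (h s x + 1) * ou_dot s F x) (at s)"
      using v_pos[of s x] by (auto intro!: derivative_eq_intros ou_has_derivative F simp: field_simps)
    have "\<bar>h s x + 1\<bar> \<le> K + 1" using K(2)[of s x] by linarith
    then show "\<bar>(h s x + 1) * ou_dot s F x\<bar> \<le> (K + 1) * w x"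
      unfolding abs_mult using w K(1) by (intro mult_mono) auto
  next
    fix s show "(\<lambda>x. v s x * ln (v s x)) \<in> borel_measurable gaussian"
      using bsmooth_borel_measurable[OF v] by simp
  next
    show "(\<lambda>x. (h \<theta> x + 1) * ou_dot \<theta> F x) \<in> borel_measurable gaussian"
      using bsmooth_borel_measurable[OF v] ou_dot_measurable[OF F] by simp
    show "integrable gaussian (\<lambda>x. v \<theta> x * ln (v \<theta> x))"
      by (intro bsmooth_integrable bsmooth_mult v h)
  qed (use w in auto)
qed

text \<open>The derivative of u^2/v is written as 2 p u' - p^2 v' with p = u/v, so that both terms
  are a test function times a flow derivative and can be integrated by parts.\<close>

lemma fisher_deriv:
  "((\<lambda>\<theta>. \<integral>x. (u i \<theta> x)\<^sup>2 / v \<theta> x \<partial>gaussian) has_real_derivative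
    (\<integral>x. (2 * p i \<theta> x) * ou_dot \<theta> (partial_deriv i F) x - (p i \<theta> x * p i \<theta> x) * ou_dot \<theta> F x \<partial>gaussian)) (at \<theta>)"
proof -
  note F' = bsmooth_partial_deriv[OF F, of i]
  obtain w where w: "integrable gaussian w" "\<And>\<theta> x. \<bar>ou_dot \<theta> F x\<bar> \<le> w x" "\<And>x. 0 \<le> w x"
    using ou_dot_bound[OF F] by blast
  obtain w' where w': "integrable gaussian w'" "\<And>\<theta> x. \<bar>ou_dot \<theta> (partial_deriv i F) x\<bar> \<le> w' x" "\<And>x. 0 \<le> w' x"
    using ou_dot_bound[OF F'] by blast
  obtain M where M: "M > 0" "\<And>x. \<bar>partial_deriv i F x\<bar> \<le> M" using bsmooth_bounded_pos[OF F'] by blast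
  have pb: "\<bar>p i s x\<bar> \<le> M / \<alpha>" for s x
    using v_pos[of s x] v_ge[of s x] ou_abs_le[OF F' M(2), of s x] \<alpha> M(1)
    by (auto simp: abs_divide intro!: frac_le)
  show ?thesis
  proof (rule has_derivative_integral[where a = "\<theta> - 1" and b = "\<theta> + 1" and w = "\<lambda>x. (2 * (M / \<alpha>)) * w' x + ((M / \<alpha>) * (M / \<alpha>)) * w x"])
    fix s x
    show "((\<lambda>t. (u i t x)\<^sup>2 / v t x) has_real_derivative
       (2 * p i s x) * ou_dot s (partial_deriv i F) x - (p i s x * p i s x) * ou_dot s F x) (at s)"
      using v_pos[of s x] by (auto intro!: derivative_eq_intros ou_has_derivative F F' simp: field_simps power2_eq_square)
    have "\<bar>2 * p i s x\<bar> \<le> 2 * (M / \<alpha>)" using pb[of s x] unfolding abs_mult by simp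
    then have "\<bar>2 * p i s x\<bar> * \<bar>ou_dot s (partial_deriv i F) x\<bar> \<le> (2 * (M / \<alpha>)) * w' x"
      using w' \<alpha> M(1) by (intro mult_mono) auto
    moreover have "\<bar>p i s x\<bar> * \<bar>p i s x\<bar> \<le> (M / \<alpha>) * (M / \<alpha>)"
      using M(1) \<alpha> by (intro mult_mono pb) auto
    then have "(\<bar>p i s x\<bar> * \<bar>p i s x\<bar>) * \<bar>ou_dot s F x\<bar> \<le> ((M / \<alpha>) * (M / \<alpha>)) * w x"
      by (rule mult_mono) (use w \<alpha> M(1) in auto)
    then have "\<bar>p i s x * p i s x\<bar> * \<bar>ou_dot s F x\<bar> \<le> ((M / \<alpha>) * (M / \<alpha>)) * w x"
      by (simp only: abs_mult)
    ultimately show "\<bar>(2 * p i s x) * ou_dot s (partial_deriv i F) x - (p i s x * p i s x) * ou_dot s F x\<bar>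
        \<le> (2 * (M / \<alpha>)) * w' x + ((M / \<alpha>) * (M / \<alpha>)) * w x"
      unfolding abs_mult[symmetric] by linarith
  next
    fix s show "(\<lambda>x. (u i s x)\<^sup>2 / v s x) \<in> borel_measurable gaussian"
      using bsmooth_borel_measurable[OF v] bsmooth_borel_measurable[OF u] by simp
  next
    show "(\<lambda>x. (2 * p i \<theta> x) * ou_dot \<theta> (partial_deriv i F) x - (p i \<theta> x * p i \<theta> x) * ou_dot \<theta> F x) \<in> borel_measurable gaussian"
      using bsmooth_borel_measurable[OF v] bsmooth_borel_measurable[OF u] ou_dot_measurable[OF F] ou_dot_measurable[OF F'] by simp
    show "integrable gaussian (\<lambda>x. (u i \<theta> x)\<^sup>2 / v \<theta> x)"
      unfolding power2_eq_square by (intro bsmooth_integrable bsmooth_divide[OF _ v \<alpha> v_ge] bsmooth_mult u)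
  qed (use w w' in auto)
qed

lemma ou_dot_integrable:
  assumes "bsmooth \<phi>" "bsmooth G" shows "integrable gaussian (\<lambda>x. \<phi> x * ou_dot \<theta> G x)"
proof -
  obtain w where w: "integrable gaussian w" "\<And>\<theta> x. \<bar>ou_dot \<theta> G x\<bar> \<le> w x" "\<And>x. 0 \<le> w x"
    using ou_dot_bound[OF assms(2)] by blast
  have "integrable gaussian (ou_dot \<theta> G)"
    by (rule Bochner_Integration.integrable_bound[OF w(1)]) (use w ou_dot_measurable[OF assms(2)] in auto)
  then show ?thesis
    using bsmooth_bounded[OF assms(1)] bsmooth_borel_measurable[OF assms(1)] by (auto intro: integrable_mult_bounded)
qed

text \<open>The Bakry-Emery computation: the derivative of the entropy cancels the derivative of the
  prefactor cos^2 \<theta> / 2 exactly, and the derivative of the integrals of u_i^2/v that remains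
  is a negative multiple of a sum of squares.\<close>

lemma D_deriv:
  assumes c: "cos \<theta> > 0"
  shows "(D has_real_derivative - tan \<theta> * J \<theta>) (at \<theta>)"
proof -
  note F' = bsmooth_partial_deriv[OF F]
  let ?I = "\<lambda>i. \<integral>x. (u i \<theta> x)\<^sup>2 / v \<theta> x \<partial>gaussian"
  have E: "(\<integral>x. (h \<theta> x + 1) * ou_dot \<theta> F x \<partial>gaussian) = - tan \<theta> * ((cos \<theta>)\<^sup>2 * (\<Sum>i\<in>UNIV. ?I i))"
  proof -
    have s: "bsmooth (\<lambda>x. h \<theta> x + 1)" by (intro bsmooth_add h bsmooth_const)
    have d: "partial_deriv i (\<lambda>x. h \<theta> x + 1) x = cos \<theta> * p i \<theta> x" for i x
    proof -
      have "((\<lambda>x. h \<theta> x + 1) has_derivative (\<lambda>k. \<Sum>i\<in>UNIV. partial_deriv i (h \<theta>) x * k $ i)) (at x)"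
        by (rule has_derivative_eq_rhs[OF has_derivative_add[OF bsmooth_has_derivative[OF h] has_derivative_const]]) simp
      from partial_deriv_eq[OF this] show ?thesis by (simp add: partial_deriv_h)
    qed
    have "(\<integral>x. partial_deriv i (\<lambda>x. h \<theta> x + 1) x * partial_deriv i (v \<theta>) x \<partial>gaussian) = (\<integral>x. (cos \<theta>)\<^sup>2 * ((u i \<theta> x)\<^sup>2 / v \<theta> x) \<partial>gaussian)" for i
      by (simp add: d partial_deriv_ou[OF F] power2_eq_square mult_ac)
    then have "(\<integral>x. partial_deriv i (\<lambda>x. h \<theta> x + 1) x * partial_deriv i (v \<theta>) x \<partial>gaussian) = (cos \<theta>)\<^sup>2 * ?I i" for i
      by (simp only: integral_mult_right_zero)
    then show ?thesis
      using integral_mult_ou_dot[OF s F, of \<theta>] c by (simp add: sum_distrib_left)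
  qed
  have N: "(\<integral>x. (2 * p i \<theta> x) * ou_dot \<theta> (partial_deriv i F) x - (p i \<theta> x * p i \<theta> x) * ou_dot \<theta> F x \<partial>gaussian)
     = - 2 * tan \<theta> * (\<Sum>j\<in>UNIV. \<integral>x. v \<theta> x * (partial_deriv j (p i \<theta>) x)\<^sup>2 \<partial>gaussian)" for i
  proof -
    have s: "bsmooth (\<lambda>x. 2 * p i \<theta> x)" "bsmooth (\<lambda>x. p i \<theta> x * p i \<theta> x)"
      by (intro bsmooth_mult bsmooth_const p)+
    \<comment> \<open>The two Dirichlet forms combine to a square because, with p = u/v, the
      derivative of u minus p times the derivative of v is v times the derivative of p.\<close>
    have d: "(2 * partial_deriv j (p i \<theta>) x) * partial_deriv j (u i \<theta>) x - (2 * (p i \<theta> x * partial_deriv j (p i \<theta>) x)) * partial_deriv j (v \<theta>) x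
       = 2 * (v \<theta> x * (partial_deriv j (p i \<theta>) x)\<^sup>2)" for j x
      unfolding partial_deriv_p using v_pos[of \<theta> x] by (simp add: field_simps power2_eq_square)
    have "(\<integral>x. (2 * p i \<theta> x) * ou_dot \<theta> (partial_deriv i F) x - (p i \<theta> x * p i \<theta> x) * ou_dot \<theta> F x \<partial>gaussian)
       = - tan \<theta> * ((\<Sum>j\<in>UNIV. \<integral>x. (2 * partial_deriv j (p i \<theta>) x) * partial_deriv j (u i \<theta>) x \<partial>gaussian)
         - (\<Sum>j\<in>UNIV. \<integral>x. (2 * (p i \<theta> x * partial_deriv j (p i \<theta>) x)) * partial_deriv j (v \<theta>) x \<partial>gaussian))"
    proof -
      have d1: "partial_deriv j (\<lambda>x. 2 * p i \<theta> x) x = 2 * partial_deriv j (p i \<theta>) x" for j x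
        by (rule partial_deriv_scale[OF p])
      have d2: "partial_deriv j (\<lambda>x. p i \<theta> x * p i \<theta> x) x = 2 * (p i \<theta> x * partial_deriv j (p i \<theta>) x)" for j x
        unfolding partial_deriv_mult[OF p p] by simp
      have nz: "cos \<theta> \<noteq> 0" using c by simp
      show ?thesis
        unfolding Bochner_Integration.integral_diff[OF ou_dot_integrable[OF s(1) F'] ou_dot_integrable[OF s(2) F]]
          integral_mult_ou_dot[OF s(1) F' nz] integral_mult_ou_dot[OF s(2) F nz] d1 d2
        by (simp only: right_diff_distrib)
    qed
    also have "\<dots> = - tan \<theta> * (\<Sum>j\<in>UNIV. (\<integral>x. (2 * partial_deriv j (p i \<theta>) x) * partial_deriv j (u i \<theta>) x
         - (2 * (p i \<theta> x * partial_deriv j (p i \<theta>) x)) * partial_deriv j (v \<theta>) x \<partial>gaussian))"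
    proof -
      have "bsmooth (\<lambda>x. (2 * partial_deriv j (p i \<theta>) x) * partial_deriv j (u i \<theta>) x)"
        "bsmooth (\<lambda>x. (2 * (p i \<theta> x * partial_deriv j (p i \<theta>) x)) * partial_deriv j (v \<theta>) x)" for j
        by (intro bsmooth_mult bsmooth_const p u v bsmooth_partial_deriv)+
      then show ?thesis
        by (simp only: Bochner_Integration.integral_diff bsmooth_integrable sum_subtractf)
    qed
    also have "\<dots> = - 2 * tan \<theta> * (\<Sum>j\<in>UNIV. \<integral>x. v \<theta> x * (partial_deriv j (p i \<theta>) x)\<^sup>2 \<partial>gaussian)"
      unfolding d by (simp add: sum_distrib_left mult_ac)
    finally show ?thesis .
  qed
  have Jeq: "J \<theta> = (cos \<theta>)\<^sup>2 * (\<Sum>i\<in>UNIV. \<Sum>j\<in>UNIV. \<integral>x. v \<theta> x * (partial_deriv j (p i \<theta>) x)\<^sup>2 \<partial>gaussian)"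
    unfolding J_def partial_deriv_h2 sum_distrib_left power_mult_distrib
    by (simp add: mult.left_commute[of _ "(cos \<theta>)\<^sup>2"])
  have "(D has_real_derivative ((- sin \<theta> * cos \<theta>) * (\<Sum>i\<in>UNIV. ?I i)
     + (cos \<theta>)\<^sup>2 / 2 * (\<Sum>i\<in>UNIV. - 2 * tan \<theta> * (\<Sum>j\<in>UNIV. \<integral>x. v \<theta> x * (partial_deriv j (p i \<theta>) x)\<^sup>2 \<partial>gaussian))
     - (- tan \<theta> * ((cos \<theta>)\<^sup>2 * (\<Sum>i\<in>UNIV. ?I i))))) (at \<theta>)"
    unfolding D_def[abs_def] E[symmetric] N[symmetric]
    by (auto intro!: derivative_eq_intros entropy_deriv fisher_deriv)
  moreover have "((- sin \<theta> * cos \<theta>) * (\<Sum>i\<in>UNIV. ?I i)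
     + (cos \<theta>)\<^sup>2 / 2 * (\<Sum>i\<in>UNIV. - 2 * tan \<theta> * (\<Sum>j\<in>UNIV. \<integral>x. v \<theta> x * (partial_deriv j (p i \<theta>) x)\<^sup>2 \<partial>gaussian))
     - (- tan \<theta> * ((cos \<theta>)\<^sup>2 * (\<Sum>i\<in>UNIV. ?I i)))) = - tan \<theta> * J \<theta>"
    unfolding Jeq sum_distrib_left[symmetric] using c by (simp add: tan_def power2_eq_square field_simps)
  ultimately show ?thesis by simp
qed

lemma D_continuous: "continuous_on S D"
proof -
  have "isCont D \<theta>" for \<theta>
    unfolding D_def[abs_def]
    by (intro continuous_intros DERIV_isCont[OF entropy_deriv] DERIV_isCont[OF fisher_deriv]) simp
  then show ?thesis by (simp add: continuous_at_imp_continuous_on)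
qed

lemma J_nonneg: "0 \<le> J \<theta>"
  unfolding J_def by (intro sum_nonneg integral_nonneg) (simp add: less_imp_le[OF v_pos])

lemma D_antimono:
  assumes "0 \<le> s" "s \<le> t" "t \<le> pi / 2" shows "D t \<le> D s"
proof (rule DERIV_nonpos_imp_decreasing_open[OF assms(2)])
  fix x assume x: "s < x" "x < t"
  then have c: "cos x > 0" "sin x \<ge> 0" using assms by (auto intro!: cos_gt_zero sin_ge_zero)
  have "- tan x * J x \<le> 0"
    using c J_nonneg[of x] by (simp add: tan_def)
  then show "\<exists>y. (D has_real_derivative y) (at x) \<and> y \<le> 0" using D_deriv[OF c(1)] by blast
qed (rule D_continuous)

text \<open>At \<pi>/2 the flow has reached the constant mass m, so the subtracted value is - m ln
  m. For m = 1 this is the log-Sobolev deficit of F, and its nonnegativity is the log-Sobolev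
  inequality for smooth densities.\<close>

definition "deficit = D 0 - D (pi / 2)"

lemma deficit_eq: "deficit = (\<Sum>i\<in>UNIV. \<integral>x. (partial_deriv i F x)\<^sup>2 / F x \<partial>gaussian) / 2
    - (\<integral>x. F x * ln (F x) \<partial>gaussian) + (\<integral>x. F x \<partial>gaussian) * ln (\<integral>x. F x \<partial>gaussian)"
  by (simp add: deficit_def D_def)

lemma deficit_nonneg: "0 \<le> deficit"
  using D_antimono[of 0 "pi / 2"] by (simp add: deficit_def)

end

section \<open>A projection onto affine functions\<close>

lemma gaussian_mean_component: "(\<integral>(x :: real ^ 'n). x $ i \<partial>gaussian) = 0"
  by (rule integral_gaussian_odd) auto

text \<open>The weighted integrability that integration by parts requires of \<phi> = x_j.\<close>

lemma integrable_exp_component: "integrable gaussian (\<lambda>x :: real ^ 'n. exp (2 * \<bar>x $ i\<bar>) * x $ j)"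
proof (rule Bochner_Integration.integrable_bound)
  show "integrable gaussian (\<lambda>x :: real ^ 'n. exp (4 * \<bar>x $ i\<bar>) + (x $ j)\<^sup>2)"
    by (intro Bochner_Integration.integrable_add integrable_exp_abs_component integrable_component_sq)
  have "2 * exp (2 * \<bar>x $ i\<bar>) * \<bar>x $ j\<bar> \<le> (exp (2 * \<bar>x $ i\<bar>))\<^sup>2 + \<bar>x $ j\<bar>\<^sup>2" for x :: "real ^ 'n"
    by (rule sum_squares_bound)
  moreover have "(exp (2 * \<bar>x $ i\<bar>))\<^sup>2 = exp (4 * \<bar>x $ i\<bar>)" for x :: "real ^ 'n"
    by (simp add: exp_double[symmetric])
  ultimately have "2 * (exp (2 * \<bar>x $ i\<bar>) * \<bar>x $ j\<bar>) \<le> exp (4 * \<bar>x $ i\<bar>) + (x $ j)\<^sup>2" for x :: "real ^ 'n"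
    by (simp add: mult_ac)
  then have "exp (2 * \<bar>x $ i\<bar>) * \<bar>x $ j\<bar> \<le> exp (4 * \<bar>x $ i\<bar>) + (x $ j)\<^sup>2" for x :: "real ^ 'n"
    by (rule order_trans[rotated]) simp
  then show "AE x :: real ^ 'n in gaussian. norm (exp (2 * \<bar>x $ i\<bar>) * x $ j) \<le> norm (exp (4 * \<bar>x $ i\<bar>) + (x $ j)\<^sup>2)"
    by (intro AE_I2) (simp add: abs_mult)
qed simp

lemma partial_deriv_component: "partial_deriv i (\<lambda>x :: real ^ 'n. x $ j) x = (if i = j then 1 else 0)"
proof (rule partial_deriv_eq)
  show "((\<lambda>x :: real ^ 'n. x $ j) has_derivative (\<lambda>h. \<Sum>i\<in>UNIV. (if i = j then 1 else 0) * h $ i)) (at x)"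
    by (rule has_derivative_eq_rhs[OF bounded_linear.has_derivative[OF bounded_linear_vec_nth has_derivative_ident]])
      (simp add: fun_eq_iff if_distrib[where f = "\<lambda>c. c * _"] cong: if_cong)
qed

lemma integrable_component_mult: "integrable gaussian (\<lambda>x :: real ^ 'n. x $ i * x $ j)"
  by (rule integrable_mult_L2) simp_all

lemma gaussian_covariance: "(\<integral>(x :: real ^ 'n). x $ i * x $ j \<partial>gaussian) = (if i = j then 1 else 0)"
proof -
  have "(\<lambda>x :: real ^ 'n. x $ j) differentiable (at x)" for x
    by (rule bounded_linear_imp_differentiable) (rule bounded_linear_vec_nth)
  from gaussian_integration_by_parts[OF this integrable_exp_component, where N = 1]
  show ?thesis by (simp add: partial_deriv_component[abs_def])
qed

section \<open>Testing against the arctangent of a coordinate\<close>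

lemma partial_deriv_arctan: "partial_deriv i (\<lambda>x :: real ^ 'n. arctan (x $ j)) x = (if i = j then inverse (1 + (x $ j)\<^sup>2) else 0)"
proof (rule partial_deriv_eq)
  have "((\<lambda>x :: real ^ 'n. x $ j) has_derivative (\<lambda>h. h $ j)) (at x)"
    by (rule bounded_linear.has_derivative[OF bounded_linear_vec_nth has_derivative_ident])
  from has_derivative_compose[OF this DERIV_arctan[unfolded has_field_derivative_def]]
  show "((\<lambda>x :: real ^ 'n. arctan (x $ j)) has_derivative (\<lambda>h. \<Sum>i\<in>UNIV. (if i = j then inverse (1 + (x $ j)\<^sup>2) else 0) * h $ i)) (at x)"
    by (rule has_derivative_eq_rhs)
      (simp add: fun_eq_iff if_distrib[where f = "\<lambda>c. c * _"] cong: if_cong)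
qed

lemma abs_arctan_le: "\<bar>arctan t\<bar> \<le> 2"
  using arctan_bounded[of t] pi_less_4 by linarith

text \<open>Integration by parts turns the pairing into the mean of the i-th derivative of arctan
  x_j, so coordinates and arctangents are biorthogonal up to normalisation.\<close>

lemma gaussian_component_arctan:
  "(\<integral>(x :: real ^ 'n). x $ i * arctan (x $ j) \<partial>gaussian) = (if i = j then \<integral>(x :: real ^ 'n). inverse (1 + (x $ i)\<^sup>2) \<partial>gaussian else 0)"
proof -
  have "(\<lambda>x :: real ^ 'n. arctan (x $ j)) differentiable (at x)" for x
  proof (rule differentiable_compose[of arctan])
    show "arctan differentiable (at (x $ j))" using DERIV_arctan real_differentiable_def by blast
  qed (intro bounded_linear_imp_differentiable bounded_linear_vec_nth)
  moreover have "integrable gaussian (\<lambda>x :: real ^ 'n. exp (2 * \<bar>x $ i\<bar>) * arctan (x $ j))"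
    using integrable_mult_bounded[where f = "\<lambda>x :: real ^ 'n. arctan (x $ j)" and M = 2, OF _ abs_arctan_le integrable_exp_abs_component]
    by (simp add: mult.commute)
  moreover have "\<bar>partial_deriv i (\<lambda>x :: real ^ 'n. arctan (x $ j)) x\<bar> \<le> 1" for x
    unfolding partial_deriv_arctan by (auto simp: abs_inverse intro!: inverse_le_1_iff[THEN iffD2])
  moreover have "partial_deriv i (\<lambda>x :: real ^ 'n. arctan (x $ j)) \<in> borel_measurable borel"
    unfolding partial_deriv_arctan[abs_def] by simp
  ultimately have "(\<integral>x. partial_deriv i (\<lambda>x :: real ^ 'n. arctan (x $ j)) x \<partial>gaussian) = (\<integral>x. x $ i * arctan (x $ j) \<partial>gaussian)"
    by (rule gaussian_integration_by_parts)
  then show ?thesis by (auto simp: partial_deriv_arctan[abs_def])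
qed

definition kap :: "'n::finite \<Rightarrow> real" where
  "kap i = (\<integral>(x :: real ^ 'n). x $ i * arctan (x $ i) \<partial>gaussian)"

text \<open>The bound 1/(1 + s) \<ge> 3/4 - s/4 is the tangent line of a convex function at s = 1,
  the Gaussian mean of s = x_i^2; integrating it gives 1/2.\<close>

lemma kap_ge: "1 / 2 \<le> kap (i :: 'n::finite)"
proof -
  have i: "integrable gaussian (\<lambda>x :: real ^ 'n. inverse (1 + (x $ i)\<^sup>2))"
    by (rule integrable_bounded[where M = 1]) (auto simp: abs_inverse intro!: inverse_le_1_iff[THEN iffD2])
  have "(\<integral>(x :: real ^ 'n). 3 / 4 - (x $ i)\<^sup>2 / 4 \<partial>gaussian) \<le> (\<integral>(x :: real ^ 'n). inverse (1 + (x $ i)\<^sup>2) \<partial>gaussian)"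
  proof (rule integral_mono)
    fix x :: "real ^ 'n"
    have "0 \<le> ((x $ i)\<^sup>2 - 1)\<^sup>2" by simp
    then have "(3 / 4 - (x $ i)\<^sup>2 / 4) * (1 + (x $ i)\<^sup>2) \<le> 1"
      unfolding power2_eq_square[of "_ - 1"] by (simp add: algebra_simps add_divide_distrib)
    then show "3 / 4 - (x $ i)\<^sup>2 / 4 \<le> inverse (1 + (x $ i)\<^sup>2)"
      by (simp only: inverse_eq_divide pos_le_divide_eq[OF add_pos_nonneg[OF zero_less_one zero_le_power2]])
  qed (use i in auto)
  moreover have "(\<integral>(x :: real ^ 'n). 3 / 4 - (x $ i)\<^sup>2 / 4 \<partial>gaussian) = 1 / 2"
    using gaussian_covariance[of i i] by (simp add: power2_eq_square[symmetric])
  ultimately show ?thesis by (simp add: kap_def gaussian_component_arctan)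
qed

text \<open>A projection onto the affine functions that is bounded on \<open>L\<^sup>1\<close>: the slope is read off by
  testing against the bounded function \<open>arctan x\<^sub>i\<close> instead of \<open>x\<^sub>i\<close>.\<close>

definition slope :: "(real ^ 'n \<Rightarrow> real) \<Rightarrow> real ^ 'n" where
  "slope \<phi> = (\<chi> i. (\<integral>x. arctan (x $ i) * \<phi> x \<partial>gaussian) / kap i)"

definition resid :: "(real ^ 'n \<Rightarrow> real) \<Rightarrow> real ^ 'n \<Rightarrow> real" where
  "resid \<phi> x = \<phi> x - (slope \<phi> \<bullet> x + (\<integral>y. \<phi> y \<partial>gaussian))"

lemma integrable_arctan_mult:
  "integrable gaussian \<phi> \<Longrightarrow> integrable gaussian (\<lambda>x :: real ^ 'n. arctan (x $ i) * \<phi> x)"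
  by (rule integrable_mult_bounded[where M = 2]) (auto intro: abs_arctan_le)

text \<open>The constant is 2 / (1/2), from |arctan| \<le> 2 and \<open>kap_ge\<close>.\<close>

lemma slope_bound:
  fixes \<phi> :: "real ^ 'n \<Rightarrow> real"
  assumes \<phi>: "integrable gaussian \<phi>"
  shows "\<bar>slope \<phi> $ i\<bar> \<le> 4 * (\<integral>x. \<bar>\<phi> x\<bar> \<partial>gaussian)"
proof -
  have "\<bar>\<integral>x. arctan (x $ i) * \<phi> x \<partial>gaussian\<bar> \<le> (\<integral>x. 2 * \<bar>\<phi> x\<bar> \<partial>gaussian)"
    by (rule order_trans[OF integral_abs_bound], rule integral_mono[OF integrable_abs[OF integrable_arctan_mult[OF \<phi>]]])
      (use \<phi> in \<open>auto simp: abs_mult intro!: mult_right_mono abs_arctan_le\<close>)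
  then have "\<bar>\<integral>x. arctan (x $ i) * \<phi> x \<partial>gaussian\<bar> \<le> 2 * (\<integral>x. \<bar>\<phi> x\<bar> \<partial>gaussian)" by simp
  then have "\<bar>\<integral>x. arctan (x $ i) * \<phi> x \<partial>gaussian\<bar> / kap i \<le> (2 * (\<integral>x. \<bar>\<phi> x\<bar> \<partial>gaussian)) / (1 / 2)"
    using kap_ge[of i] by (intro frac_le) auto
  then show ?thesis
    using kap_ge[of i] by (simp add: slope_def abs_divide)
qed

lemma integrable_affine [simp]: "integrable gaussian (\<lambda>x :: real ^ 'n. c \<bullet> x)"
  unfolding inner_vec_def by (intro Bochner_Integration.integrable_sum) simp

lemma integral_inner [simp]: "(\<integral>(x :: real ^ 'n). c \<bullet> x \<partial>gaussian) = 0"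
  unfolding inner_vec_def by (subst Bochner_Integration.integral_sum) (simp_all add: gaussian_mean_component)

text \<open>Each arctan x_i pairs to zero with constants and with x_j for j \<noteq> i. Hence
  \<open>slope\<close> recovers the slope of an affine function exactly, which is why
  \<open>resid\<close> annihilates affine functions.\<close>

lemma integral_arctan_affine: "(\<integral>(x :: real ^ 'n). arctan (x $ i) * (c \<bullet> x + d) \<partial>gaussian) = kap i * c $ i"
proof -
  have 0: "(\<integral>(x :: real ^ 'n). arctan (x $ i) \<partial>gaussian) = 0"
    by (rule integral_gaussian_odd) (auto simp: arctan_minus)
  have i: "integrable gaussian (\<lambda>x :: real ^ 'n. x $ j * arctan (x $ i))" for j
    using integrable_arctan_mult[OF integrable_component] by (simp add: mult.commute)
  have ia: "integrable gaussian (\<lambda>x :: real ^ 'n. arctan (x $ i))"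
    by (rule integrable_bounded[where M = 2]) (auto intro: abs_arctan_le)
  have "(\<integral>(x :: real ^ 'n). arctan (x $ i) * (c \<bullet> x + d) \<partial>gaussian)
      = (\<integral>(x :: real ^ 'n). (\<Sum>j\<in>UNIV. c $ j * (x $ j * arctan (x $ i))) + d * arctan (x $ i) \<partial>gaussian)"
    by (simp add: inner_vec_def sum_distrib_left distrib_left mult_ac)
  also have "\<dots> = (\<Sum>j\<in>UNIV. c $ j * (\<integral>(x :: real ^ 'n). x $ j * arctan (x $ i) \<partial>gaussian))"
    by (subst Bochner_Integration.integral_add)
      (auto intro!: Bochner_Integration.integrable_sum integrable_mult_right i ia simp: Bochner_Integration.integral_sum i ia 0)
  also have "\<dots> = kap i * c $ i"
    by (simp add: gaussian_component_arctan kap_def if_distrib[where f = "(*) _"] cong: if_cong)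
  finally show ?thesis .
qed

lemma slope_diff_affine:
  assumes \<phi>: "integrable gaussian \<phi>"
  shows "slope (\<lambda>x. \<phi> x - (c \<bullet> x + d)) = slope \<phi> - c"
proof (rule vec_eq_iff[THEN iffD2], intro allI)
  fix i
  have a: "integrable gaussian (\<lambda>x :: real ^ 'a. c \<bullet> x + d)" by simp
  have "(\<integral>x. arctan (x $ i) * (\<phi> x - (c \<bullet> x + d)) \<partial>gaussian)
      = (\<integral>x. arctan (x $ i) * \<phi> x \<partial>gaussian) - (\<integral>x. arctan (x $ i) * (c \<bullet> x + d) \<partial>gaussian)"
    unfolding right_diff_distrib
    by (intro Bochner_Integration.integral_diff integrable_arctan_mult \<phi> a)
  then show "slope (\<lambda>x. \<phi> x - (c \<bullet> x + d)) $ i = (slope \<phi> - c) $ i"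
    using kap_ge[of i] by (simp add: slope_def integral_arctan_affine diff_divide_distrib)
qed

lemma integral_abs_component_le: "(\<integral>(x :: real ^ 'n). \<bar>x $ i\<bar> \<partial>gaussian) \<le> 1"
proof -
  have "(\<integral>(x :: real ^ 'n). \<bar>x $ i\<bar> \<partial>gaussian) \<le> (\<integral>(x :: real ^ 'n). (1 + (x $ i)\<^sup>2) / 2 \<partial>gaussian)"
  proof (rule integral_mono)
    fix x :: "real ^ 'n" show "\<bar>x $ i\<bar> \<le> (1 + (x $ i)\<^sup>2) / 2"
      using sum_squares_bound[of 1 "\<bar>x $ i\<bar>"] by simp
  qed auto
  also have "\<dots> = 1" using gaussian_covariance[of i i] by (simp add: power2_eq_square[symmetric])
  finally show ?thesis .
qed

text \<open>The adjoint of \<^const>\<open>resid\<close>.\<close>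

definition dual :: "(real ^ 'n \<Rightarrow> real) \<Rightarrow> real ^ 'n \<Rightarrow> real" where
  "dual \<sigma> y = \<sigma> y - (\<Sum>i\<in>UNIV. arctan (y $ i) / kap i * (\<integral>x. \<sigma> x * x $ i \<partial>gaussian)) - (\<integral>x. \<sigma> x \<partial>gaussian)"

lemma dual_measurable [measurable]: "\<sigma> \<in> borel_measurable borel \<Longrightarrow> dual \<sigma> \<in> borel_measurable borel"
  unfolding dual_def by (intro borel_measurable_diff borel_measurable_sum borel_measurable_times) simp_all

text \<open>One unit comes from \<sigma>, one from its mean, and 4 from each coordinate: |arctan| /
  \<open>kap\<close> is at most 4 and x_i has L1 norm at most 1.\<close>

lemma dual_bound:
  fixes \<sigma> :: "real ^ 'n \<Rightarrow> real"
  assumes [measurable]: "\<sigma> \<in> borel_measurable borel" and \<sigma>: "\<And>x. \<bar>\<sigma> x\<bar> \<le> 1"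
  shows "\<bar>dual \<sigma> y\<bar> \<le> 4 * CARD('n) + 2"
proof -
  have "\<bar>arctan (y $ i) / kap i * (\<integral>x. \<sigma> x * x $ i \<partial>gaussian)\<bar> \<le> 4" for i
  proof -
    have "\<bar>\<integral>x. \<sigma> x * x $ i \<partial>gaussian\<bar> \<le> (\<integral>(x :: real ^ 'n). \<bar>x $ i\<bar> \<partial>gaussian)"
    proof (rule order_trans[OF integral_abs_bound], rule integral_mono)
      show "integrable gaussian (\<lambda>x. \<bar>\<sigma> x * x $ i\<bar>)"
        by (intro integrable_abs integrable_mult_bounded[OF _ \<sigma>]) auto
      show "\<bar>\<sigma> x * x $ i\<bar> \<le> \<bar>x $ i\<bar>" for x
        using mult_right_mono[OF \<sigma>[of x], of "\<bar>x $ i\<bar>"] by (simp add: abs_mult)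
    qed auto
    then have 1: "\<bar>\<integral>x. \<sigma> x * x $ i \<partial>gaussian\<bar> \<le> 1"
      using integral_abs_component_le by (rule order_trans)
    have "\<bar>arctan (y $ i)\<bar> / kap i \<le> 2 / (1 / 2)"
      using kap_ge[of i] by (intro frac_le abs_arctan_le) auto
    then have "\<bar>arctan (y $ i)\<bar> / kap i * \<bar>\<integral>x. \<sigma> x * x $ i \<partial>gaussian\<bar> \<le> 4 * 1"
      using 1 by (intro mult_mono) auto
    then show ?thesis using kap_ge[of i] by (simp add: abs_mult abs_divide)
  qed
  then have "\<bar>\<Sum>i\<in>UNIV. arctan (y $ i) / kap i * (\<integral>x. \<sigma> x * x $ i \<partial>gaussian)\<bar> \<le> (\<Sum>i\<in>(UNIV :: 'n set). 4)"
    by (intro order_trans[OF sum_abs] sum_mono)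
  moreover have "\<bar>\<integral>x. \<sigma> x \<partial>gaussian\<bar> \<le> 1"
  proof -
    have "\<bar>\<integral>x. \<sigma> x \<partial>gaussian\<bar> \<le> (\<integral>(x :: real ^ 'n). 1 \<partial>gaussian)"
      by (rule order_trans[OF integral_abs_bound], rule integral_mono)
        (use \<sigma> in \<open>auto intro!: integrable_abs integrable_bounded[OF _ \<sigma>]\<close>)
    then show ?thesis by simp
  qed
  ultimately show ?thesis using \<sigma>[of y] unfolding dual_def by simp
qed

lemma integral_dual:
  fixes \<sigma> \<phi> :: "real ^ 'n \<Rightarrow> real"
  assumes [measurable]: "\<sigma> \<in> borel_measurable borel" and \<sigma>: "\<And>x. \<bar>\<sigma> x\<bar> \<le> 1" and \<phi>: "integrable gaussian \<phi>"
  shows "(\<integral>x. dual \<sigma> x * \<phi> x \<partial>gaussian) = (\<integral>x. \<sigma> x * resid \<phi> x \<partial>gaussian)"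
proof -
  have i: "integrable gaussian (\<lambda>x. \<sigma> x * \<psi> x)" if "integrable gaussian \<psi>" for \<psi>
    by (rule integrable_mult_bounded[OF _ \<sigma> that]) simp
  have i1: "integrable gaussian \<sigma>" by (rule integrable_bounded[OF _ \<sigma>]) simp
  let ?s = "\<lambda>i. \<integral>x. \<sigma> x * x $ i \<partial>gaussian"
  have "(\<integral>x. dual \<sigma> x * \<phi> x \<partial>gaussian) = (\<integral>x. \<sigma> x * \<phi> x - (\<Sum>i\<in>UNIV. (arctan (x $ i) * \<phi> x) * (?s i / kap i)) - \<phi> x * (\<integral>x. \<sigma> x \<partial>gaussian) \<partial>gaussian)"
    by (intro Bochner_Integration.integral_cong refl) (simp add: dual_def sum_distrib_left sum_distrib_right algebra_simps)
  also have "\<dots> = (\<integral>x. \<sigma> x * \<phi> x \<partial>gaussian) - (\<Sum>i\<in>UNIV. (\<integral>x. arctan (x $ i) * \<phi> x \<partial>gaussian) * (?s i / kap i)) - (\<integral>x. \<phi> x \<partial>gaussian) * (\<integral>x. \<sigma> x \<partial>gaussian)"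
    by (simp only: Bochner_Integration.integral_diff Bochner_Integration.integral_sum integral_mult_left_zero
        Bochner_Integration.integrable_diff Bochner_Integration.integrable_sum i \<phi> integrable_arctan_mult integrable_mult_left)
  also have "\<dots> = (\<integral>x. \<sigma> x * \<phi> x \<partial>gaussian) - ((\<Sum>i\<in>UNIV. slope \<phi> $ i * ?s i) + (\<integral>x. \<phi> x \<partial>gaussian) * (\<integral>x. \<sigma> x \<partial>gaussian))"
    by (simp add: slope_def)
  also have "\<dots> = (\<integral>x. \<sigma> x * \<phi> x - ((\<Sum>i\<in>UNIV. slope \<phi> $ i * (\<sigma> x * x $ i)) + (\<integral>x. \<phi> x \<partial>gaussian) * \<sigma> x) \<partial>gaussian)"
    by (simp only: Bochner_Integration.integral_diff Bochner_Integration.integral_add Bochner_Integration.integral_sum integral_mult_right_zero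
        Bochner_Integration.integrable_add Bochner_Integration.integrable_sum i \<phi> i1 integrable_mult_right integrable_component)
  also have "\<dots> = (\<integral>x. \<sigma> x * resid \<phi> x \<partial>gaussian)"
    by (simp add: resid_def inner_vec_def right_diff_distrib distrib_left sum_distrib_left mult_ac)
  finally show ?thesis .
qed

lemma resid_diff_affine:
  assumes "integrable gaussian \<phi>"
  shows "resid (\<lambda>x. \<phi> x - (c \<bullet> x + d)) = resid \<phi>"
  using assms by (auto simp: resid_def slope_diff_affine fun_eq_iff inner_diff_left)

lemma resid_integrable: "integrable gaussian \<phi> \<Longrightarrow> integrable gaussian (resid \<phi>)"
  unfolding resid_def by (intro Bochner_Integration.integrable_diff Bochner_Integration.integrable_add) simp_all

text \<open>Duality: test the residual against its own sign and move the projection to the bounded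
  side.\<close>

lemma integral_abs_resid_le:
  fixes \<phi> :: "real ^ 'n \<Rightarrow> real"
  assumes \<phi>: "integrable gaussian \<phi>"
  shows "(\<integral>x. \<bar>resid \<phi> x\<bar> \<partial>gaussian) \<le> (4 * CARD('n) + 2) * (\<integral>x. \<bar>\<phi> x\<bar> \<partial>gaussian)"
proof -
  have [measurable]: "resid \<phi> \<in> borel_measurable borel"
    using borel_measurable_integrable[OF resid_integrable[OF \<phi>]] by simp
  let ?\<sigma> = "\<lambda>x. sgn (resid \<phi> x)"
  have s: "\<bar>?\<sigma> x\<bar> \<le> 1" for x by (simp add: sgn_real_def)
  have "(\<integral>x. \<bar>resid \<phi> x\<bar> \<partial>gaussian) = (\<integral>x. ?\<sigma> x * resid \<phi> x \<partial>gaussian)"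
    by (simp add: abs_sgn mult.commute)
  also have "\<dots> = (\<integral>x. dual ?\<sigma> x * \<phi> x \<partial>gaussian)"
    by (rule integral_dual[symmetric]) (use \<phi> s in auto)
  also have "\<dots> \<le> (\<integral>x. (4 * CARD('n) + 2) * \<bar>\<phi> x\<bar> \<partial>gaussian)"
  proof (rule integral_mono)
    show "integrable gaussian (\<lambda>x. dual ?\<sigma> x * \<phi> x)"
      by (rule integrable_mult_bounded[OF _ dual_bound \<phi>]) (use s in auto)
    fix x
    have "dual ?\<sigma> x * \<phi> x \<le> \<bar>dual ?\<sigma> x\<bar> * \<bar>\<phi> x\<bar>" by (simp add: abs_mult[symmetric])
    also have "\<dots> \<le> (4 * CARD('n) + 2) * \<bar>\<phi> x\<bar>"
      by (intro mult_right_mono dual_bound) (use s in auto)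
    finally show "dual ?\<sigma> x * \<phi> x \<le> (4 * CARD('n) + 2) * \<bar>\<phi> x\<bar>" .
  qed (use \<phi> in simp)
  finally show ?thesis by simp
qed

text \<open>Since \<open>Cov (\<phi>, x\<^sub>i) = \<integral> \<partial>\<^sub>i \<phi>\<close>, subtracting the best affine approximation lowers both sides of
  the Poincare inequality by the same amount.\<close>

lemma gaussian_poincare_affine:
  fixes \<phi> :: "real ^ 'n \<Rightarrow> real"
  assumes \<phi>: "bsmooth \<phi>"
  defines "a \<equiv> \<chi> i. \<integral>x. partial_deriv i \<phi> x \<partial>gaussian"
  shows "(\<integral>x. (\<phi> x - (a \<bullet> x + (\<integral>y. \<phi> y \<partial>gaussian)))\<^sup>2 \<partial>gaussian)
    \<le> (\<Sum>i\<in>UNIV. \<integral>x. (partial_deriv i \<phi> x - a $ i)\<^sup>2 \<partial>gaussian)"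
    and "integrable gaussian (\<lambda>x. (\<phi> x - (a \<bullet> x + (\<integral>y. \<phi> y \<partial>gaussian)))\<^sup>2)"
proof -
  let ?b = "\<integral>y. \<phi> y \<partial>gaussian"
  have ai: "(\<integral>x. x $ i * \<phi> x \<partial>gaussian) = a $ i" for i
    using bsmooth_integration_by_parts[OF \<phi>, of i] by (simp add: a_def)
  have quad: "integrable gaussian (\<lambda>x. (a \<bullet> x)\<^sup>2)" "(\<integral>x. (a \<bullet> x)\<^sup>2 \<partial>gaussian) = (norm a)\<^sup>2"
  proof -
    have eq: "(a \<bullet> x)\<^sup>2 = (\<Sum>i\<in>UNIV. \<Sum>j\<in>UNIV. a $ i * a $ j * (x $ i * x $ j))" for x
      by (simp add: inner_vec_def power2_eq_square sum_product mult_ac)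
    show "integrable gaussian (\<lambda>x. (a \<bullet> x)\<^sup>2)"
      unfolding eq by (intro Bochner_Integration.integrable_sum integrable_mult_right integrable_component_mult)
    have "(\<integral>x. (a \<bullet> x)\<^sup>2 \<partial>gaussian) = (\<Sum>i\<in>UNIV. \<Sum>j\<in>UNIV. a $ i * a $ j * (if i = j then 1 else 0))"
      unfolding eq by (simp only: Bochner_Integration.integral_sum Bochner_Integration.integrable_sum
          integrable_mult_right integrable_component_mult integral_mult_right_zero gaussian_covariance)
    then show "(\<integral>x. (a \<bullet> x)\<^sup>2 \<partial>gaussian) = (norm a)\<^sup>2"
      by (simp add: power2_norm_eq_inner inner_vec_def if_distrib[where f = "(*) _"] cong: if_cong)
  qed
  have cross: "integrable gaussian (\<lambda>x. \<phi> x * (a \<bullet> x))" "(\<integral>x. \<phi> x * (a \<bullet> x) \<partial>gaussian) = (norm a)\<^sup>2"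
  proof -
    have eq: "\<phi> x * (a \<bullet> x) = (\<Sum>i\<in>UNIV. a $ i * (x $ i * \<phi> x))" for x
      by (simp add: inner_vec_def sum_distrib_left mult_ac)
    show "integrable gaussian (\<lambda>x. \<phi> x * (a \<bullet> x))"
      unfolding eq by (intro Bochner_Integration.integrable_sum integrable_mult_right bsmooth_component_integrable \<phi>)
    have "(\<integral>x. \<phi> x * (a \<bullet> x) \<partial>gaussian) = (\<Sum>i\<in>UNIV. a $ i * a $ i)"
      unfolding eq by (simp only: Bochner_Integration.integral_sum integrable_mult_right
          bsmooth_component_integrable \<phi> integral_mult_right_zero ai)
    then show "(\<integral>x. \<phi> x * (a \<bullet> x) \<partial>gaussian) = (norm a)\<^sup>2"
      by (simp add: power2_norm_eq_inner inner_vec_def)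
  qed
  have "bsmooth (\<lambda>x. (\<phi> x - ?b) * (\<phi> x - ?b))"
    by (intro bsmooth_mult bsmooth_diff bsmooth_const \<phi>)
  then have var: "integrable gaussian (\<lambda>x. (\<phi> x - ?b)\<^sup>2)"
    unfolding power2_eq_square by (rule bsmooth_integrable)
  have sq: "(\<phi> x - (a \<bullet> x + ?b))\<^sup>2 = (\<phi> x - ?b)\<^sup>2 - 2 * (\<phi> x * (a \<bullet> x)) + 2 * ?b * (a \<bullet> x) + (a \<bullet> x)\<^sup>2" for x
    by (simp add: power2_eq_square algebra_simps)
  show "integrable gaussian (\<lambda>x. (\<phi> x - (a \<bullet> x + ?b))\<^sup>2)"
    unfolding sq by (intro Bochner_Integration.integrable_add Bochner_Integration.integrable_diff integrable_mult_right var quad cross) simp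
  have lhs: "(\<integral>x. (\<phi> x - (a \<bullet> x + ?b))\<^sup>2 \<partial>gaussian) = (\<integral>x. (\<phi> x - ?b)\<^sup>2 \<partial>gaussian) - (norm a)\<^sup>2"
    unfolding sq by (simp add: var quad cross)
  have "(\<integral>x. (partial_deriv i \<phi> x - a $ i)\<^sup>2 \<partial>gaussian) = (\<integral>x. (partial_deriv i \<phi> x)\<^sup>2 \<partial>gaussian) - (a $ i)\<^sup>2" for i
    using gauss.variance_eq[of "partial_deriv i \<phi>"] bsmooth_integrable[OF bsmooth_partial_deriv[OF \<phi>, of i]]
      bsmooth_integrable[OF bsmooth_mult[OF bsmooth_partial_deriv[OF \<phi>, of i] bsmooth_partial_deriv[OF \<phi>, of i]]]
    by (simp add: a_def power2_eq_square)
  then have "(\<Sum>i\<in>UNIV. \<integral>x. (partial_deriv i \<phi> x - a $ i)\<^sup>2 \<partial>gaussian) = (\<Sum>i\<in>UNIV. \<integral>x. (partial_deriv i \<phi> x)\<^sup>2 \<partial>gaussian) - (norm a)\<^sup>2"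
    by (simp add: sum_subtractf power2_norm_eq_inner[of a] inner_vec_def power2_eq_square[of "a $ _", symmetric])
  with lhs gaussian_poincare[OF \<phi>] show "(\<integral>x. (\<phi> x - (a \<bullet> x + ?b))\<^sup>2 \<partial>gaussian)
    \<le> (\<Sum>i\<in>UNIV. \<integral>x. (partial_deriv i \<phi> x - a $ i)\<^sup>2 \<partial>gaussian)" by simp
qed

text \<open>The variance of |\<phi>| is nonnegative.\<close>

lemma integral_abs_sq_le:
  fixes \<phi> :: "real ^ 'n \<Rightarrow> real"
  assumes "integrable gaussian \<phi>" and "integrable gaussian (\<lambda>x. (\<phi> x)\<^sup>2)"
  shows "(\<integral>x. \<bar>\<phi> x\<bar> \<partial>gaussian)\<^sup>2 \<le> (\<integral>x. (\<phi> x)\<^sup>2 \<partial>gaussian)"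
  using gauss.variance_eq[of "\<lambda>x. \<bar>\<phi> x\<bar>"] assms gauss.variance_positive[of "\<lambda>x. \<bar>\<phi> x\<bar>"] by simp

section \<open>Stability for smooth densities\<close>

lemma resid_affine: "resid (\<lambda>x. c \<bullet> x + d) = (\<lambda>x :: real ^ 'n. 0)"
proof -
  have "slope (\<lambda>x :: real ^ 'n. 0) = 0"
    by (simp add: slope_def vec_eq_iff)
  then have "resid (\<lambda>x :: real ^ 'n. 0) = (\<lambda>x. 0)"
    by (simp add: resid_def fun_eq_iff)
  then show ?thesis
    using resid_diff_affine[of "\<lambda>x. c \<bullet> x + d" c d] by simp
qed

text \<open>By the mean value theorem on \<open>[\<pi>/8, \<pi>/4]\<close> there is a \<open>\<xi>\<close> with \<open>J \<xi> \<le> time_const * deficit\<close>.\<close>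

definition time_const :: real where
  "time_const = 8 / (pi * tan (pi / 8))"

text \<open>The first two terms collect the coefficients of \<eta> in the bound on
  \<open>err\<close>: n from the constant 1 and the unit second moments, the other from the squared
  mean gradient. The terms 32 n + 3 collect the coefficients of the squared Hessian norm over
  \<eta>.\<close>

definition error_const :: "real \<Rightarrow> real \<Rightarrow> real" where
  "error_const n \<alpha> = n + 32 * n * (1 + 2 * \<bar>ln \<alpha>\<bar>)\<^sup>2 + 32 * n + 3"

text \<open>The factor 4 n + 2 is the sup bound of \<open>dual\<close>. The remaining product is a
  common upper bound for the coefficients 1 + E of \<eta> and (\<open>time_const\<close> + E) /
  \<alpha> of deficit / \<eta>, where E is \<open>error_const\<close>.\<close>

definition stability_const :: "real \<Rightarrow> real \<Rightarrow> real" where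
  "stability_const n \<alpha> = (4 * n + 2) * (1 + error_const n \<alpha>) * (1 + time_const) * (1 + 1 / \<alpha>)"

lemma tan_pi_8_pos: "0 < tan (pi / 8)"
  by (rule tan_gt_zero) (use pi_gt_zero in auto)

lemma time_const_pos: "0 < time_const"
  unfolding time_const_def using tan_pi_8_pos by simp

lemma error_const_pos: "0 \<le> n \<Longrightarrow> 0 < error_const n \<alpha>"
  unfolding error_const_def by (intro add_nonneg_pos add_nonneg_nonneg mult_nonneg_nonneg) auto

lemma stability_const_pos: "0 \<le> n \<Longrightarrow> 0 < \<alpha> \<Longrightarrow> 0 < stability_const n \<alpha>"
  unfolding stability_const_def using error_const_pos[of n \<alpha>] time_const_pos
  by (intro mult_pos_pos) (auto intro: add_pos_pos)

section \<open>Logarithm of the flow: Hessian, mean gradient and error term\<close>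

context smooth_density
begin

definition "grad_mean \<theta> = (\<chi> i. \<integral>x. partial_deriv i (h \<theta>) x \<partial>gaussian)"

definition "hess_sq \<theta> = (\<Sum>i\<in>UNIV. \<Sum>j\<in>UNIV. \<integral>x. (partial_deriv j (partial_deriv i (h \<theta>)) x)\<^sup>2 \<partial>gaussian)"

definition "dgrad i \<theta> x = partial_deriv i (h \<theta>) x - grad_mean \<theta> $ i"

text \<open>The remainder of \<open>h \<theta>\<close> after the L2-orthogonal projection onto
  affine functions, whose slope is the mean gradient; \<open>resid\<close> uses the L1-bounded
  projection instead. The two remainders differ by an affine function.\<close>

definition "dval \<theta> x = h \<theta> x - (grad_mean \<theta> \<bullet> x + (\<integral>y. h \<theta> y \<partial>gaussian))"

lemma hess: "bsmooth (partial_deriv j (partial_deriv i (h \<theta>)))" and dgrad: "bsmooth (dgrad i \<theta>)"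
  unfolding dgrad_def by (intro bsmooth_diff bsmooth_const bsmooth_partial_deriv h)+

lemma bsmooth_sq_integrable: "bsmooth \<phi> \<Longrightarrow> integrable gaussian (\<lambda>x. (\<phi> x)\<^sup>2)"
  unfolding power2_eq_square by (intro bsmooth_integrable bsmooth_mult)

lemma hess_sq_le: "\<alpha> * hess_sq \<theta> \<le> J \<theta>"
  unfolding hess_sq_def J_def sum_distrib_left
proof (intro sum_mono)
  fix i j
  have "(\<integral>x. \<alpha> * (partial_deriv j (partial_deriv i (h \<theta>)) x)\<^sup>2 \<partial>gaussian)
      \<le> (\<integral>x. v \<theta> x * (partial_deriv j (partial_deriv i (h \<theta>)) x)\<^sup>2 \<partial>gaussian)"
  proof (rule integral_mono)
    show "integrable gaussian (\<lambda>x. v \<theta> x * (partial_deriv j (partial_deriv i (h \<theta>)) x)\<^sup>2)"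
      unfolding power2_eq_square by (intro bsmooth_integrable bsmooth_mult v hess)
  qed (use bsmooth_sq_integrable[OF hess] in \<open>auto intro!: mult_right_mono v_ge\<close>)
  then show "\<alpha> * (\<integral>x. (partial_deriv j (partial_deriv i (h \<theta>)) x)\<^sup>2 \<partial>gaussian)
      \<le> (\<integral>x. v \<theta> x * (partial_deriv j (partial_deriv i (h \<theta>)) x)\<^sup>2 \<partial>gaussian)" by simp
qed

lemma hess_sq_nonneg: "0 \<le> hess_sq \<theta>"
  unfolding hess_sq_def by (intro sum_nonneg integral_nonneg) simp

lemma dgrad_sq_le: "(\<Sum>i\<in>UNIV. \<integral>x. (dgrad i \<theta> x)\<^sup>2 \<partial>gaussian) \<le> hess_sq \<theta>"
  unfolding hess_sq_def dgrad_def grad_mean_def vec_lambda_beta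
  by (intro sum_mono gaussian_poincare bsmooth_partial_deriv h)

lemma diag_sq_le: "(\<Sum>i\<in>UNIV. \<integral>x. (partial_deriv i (partial_deriv i (h \<theta>)) x)\<^sup>2 \<partial>gaussian) \<le> hess_sq \<theta>"
  unfolding hess_sq_def
proof (intro sum_mono)
  fix i :: 'n
  show "(\<integral>x. (partial_deriv i (partial_deriv i (h \<theta>)) x)\<^sup>2 \<partial>gaussian) \<le> (\<Sum>j\<in>UNIV. \<integral>x. (partial_deriv j (partial_deriv i (h \<theta>)) x)\<^sup>2 \<partial>gaussian)"
    by (rule member_le_sum) auto
qed

lemma dval_integrable: "integrable gaussian (dval \<theta>)"
  unfolding dval_def using bsmooth_integrable[OF h] by simp

lemma dval_le: "(\<integral>x. \<bar>dval \<theta> x\<bar> \<partial>gaussian)\<^sup>2 \<le> hess_sq \<theta>"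
proof -
  have i: "integrable gaussian (\<lambda>x. (dval \<theta> x)\<^sup>2)"
    using gaussian_poincare_affine(2)[OF h] unfolding dval_def grad_mean_def .
  have "(\<integral>x. (dval \<theta> x)\<^sup>2 \<partial>gaussian) \<le> (\<Sum>i\<in>UNIV. \<integral>x. (dgrad i \<theta> x)\<^sup>2 \<partial>gaussian)"
    using gaussian_poincare_affine(1)[OF h] unfolding dval_def dgrad_def grad_mean_def .
  with integral_abs_sq_le[OF dval_integrable i] dgrad_sq_le show ?thesis by (meson order_trans)
qed

text \<open>The derivative of \<open>h \<theta>\<close> is \<open>tan \<theta> (\<Delta>h - x \<bullet> \<nabla>h + |\<nabla>h|\<^sup>2)\<close>; up to an affine function this is
  \<open>tan \<theta>\<close> times the following quantity.\<close>

definition "err \<theta> x = (\<Sum>i\<in>UNIV. partial_deriv i (partial_deriv i (h \<theta>)) x - x $ i * dgrad i \<theta> x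
    + 2 * grad_mean \<theta> $ i * dgrad i \<theta> x + (dgrad i \<theta> x)\<^sup>2)"

lemma h_dot:
  assumes c: "cos \<theta> \<noteq> 0"
  shows "ou_dot \<theta> F x / v \<theta> x = tan \<theta> * (err \<theta> x + ((- grad_mean \<theta>) \<bullet> x + (norm (grad_mean \<theta>))\<^sup>2))"
proof -
  have nz: "v \<theta> x \<noteq> 0" using v_pos[of \<theta> x] by simp
  have d1: "partial_deriv i (v \<theta>) x = v \<theta> x * partial_deriv i (h \<theta>) x" for i
    using nz by (simp add: partial_deriv_h partial_deriv_ou[OF F])
  have d2: "partial_deriv i (partial_deriv i (v \<theta>)) x = v \<theta> x * (partial_deriv i (partial_deriv i (h \<theta>)) x + (partial_deriv i (h \<theta>) x)\<^sup>2)" for i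
  proof -
    have "partial_deriv i (partial_deriv i (v \<theta>)) x = cos \<theta> * partial_deriv i (u i \<theta>) x"
      unfolding partial_deriv_ou[OF F, abs_def] by (rule partial_deriv_scale[OF u])
    moreover have "partial_deriv i (partial_deriv i (h \<theta>)) x = cos \<theta> * ((partial_deriv i (u i \<theta>) x - p i \<theta> x * partial_deriv i (v \<theta>) x) / v \<theta> x)"
      unfolding partial_deriv_h2 partial_deriv_p ..
    ultimately show ?thesis
      using nz by (simp add: partial_deriv_h d1 power2_eq_square field_simps)
  qed
  have "gauss_op (v \<theta>) x = v \<theta> x * (\<Sum>i\<in>UNIV. partial_deriv i (partial_deriv i (h \<theta>)) x + (partial_deriv i (h \<theta>) x)\<^sup>2 - x $ i * partial_deriv i (h \<theta>) x)"
    unfolding gauss_op_def d2 unfolding d1 sum_distrib_left by (intro sum.cong) (simp_all add: algebra_simps)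
  \<comment> \<open>Write the i-th derivative of h as a_i + d_i, with a_i its mean. In - x_i (a_i +
    d_i) + (a_i + d_i)^2 the terms without d_i are - a_i x_i + a_i^2 and form the affine part; all
    others go into \<open>err\<close>.\<close>
  moreover have "(\<Sum>i\<in>UNIV. partial_deriv i (partial_deriv i (h \<theta>)) x + (partial_deriv i (h \<theta>) x)\<^sup>2 - x $ i * partial_deriv i (h \<theta>) x)
      = err \<theta> x + ((- grad_mean \<theta>) \<bullet> x + (norm (grad_mean \<theta>))\<^sup>2)"
    unfolding err_def power2_norm_eq_inner inner_vec_def sum.distrib[symmetric]
    by (intro sum.cong) (simp_all add: dgrad_def power2_eq_square algebra_simps)
  ultimately have "gauss_op (v \<theta>) x / v \<theta> x = err \<theta> x + ((- grad_mean \<theta>) \<bullet> x + (norm (grad_mean \<theta>))\<^sup>2)"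
    using nz by simp
  moreover have "ou_dot \<theta> F x = tan \<theta> * gauss_op (v \<theta>) x"
    using gauss_op_ou[OF F, of \<theta> x] c by (simp add: tan_def divide_simps mult.commute)
  ultimately show ?thesis by (simp only: times_divide_eq_right[symmetric])
qed

lemma err_integrable: "integrable gaussian (err \<theta>)"
  unfolding err_def
  by (intro Bochner_Integration.integrable_sum Bochner_Integration.integrable_add Bochner_Integration.integrable_diff
      integrable_mult_right bsmooth_component_integrable bsmooth_integrable[OF hess] bsmooth_integrable[OF dgrad] bsmooth_sq_integrable dgrad)

text \<open>Since ln \<alpha> \<le> h \<le> v - 1, the L1 norm is controlled by \<alpha> and the
  mass, and the flow conserves mass, as testing its derivative against the constant 1 shows.\<close>

lemma integral_abs_h_le:
  assumes m: "(\<integral>x. F x \<partial>gaussian) \<le> 2" and \<theta>: "0 \<le> \<theta>" "\<theta> < pi / 2"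
  shows "(\<integral>x. \<bar>h \<theta> x\<bar> \<partial>gaussian) \<le> 1 + 2 * \<bar>ln \<alpha>\<bar>"
proof -
  have mass: "(\<integral>x. v \<theta> x \<partial>gaussian) = (\<integral>x. F x \<partial>gaussian)"
  proof -
    obtain w where w: "integrable gaussian w" "\<And>\<theta> x. \<bar>ou_dot \<theta> F x\<bar> \<le> w x" "\<And>x. 0 \<le> w x"
      using ou_dot_bound[OF F] by blast
    have "((\<lambda>t. \<integral>x. v t x \<partial>gaussian) has_real_derivative (\<integral>x. ou_dot t F x \<partial>gaussian)) (at t)" for t
      by (rule has_derivative_integral[where a = "t - 1" and b = "t + 1" and w = w])
        (auto intro!: bsmooth_borel_measurable bsmooth_integrable v ou_has_derivative F ou_dot_measurable w)
    moreover have "(\<integral>x. ou_dot t F x \<partial>gaussian) = 0" if "0 \<le> t" "t \<le> \<theta>" for t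
    proof -
      have "cos t \<noteq> 0" using that \<theta> cos_gt_zero_pi[of t] by auto
      moreover have "partial_deriv i (\<lambda>x. 1) x = 0" for i and x :: "real ^ 'n"
        by (rule partial_deriv_eq[where c = "\<lambda>_. 0"]) simp
      ultimately show ?thesis
        using integral_mult_ou_dot[OF bsmooth_const[of 1] F, of t] by simp
    qed
    ultimately have "(\<lambda>t. \<integral>x. v t x \<partial>gaussian) \<theta> = (\<lambda>t. \<integral>x. v t x \<partial>gaussian) 0"
      by (intro antisym; intro DERIV_nonneg_imp_nondecreasing[OF \<theta>(1)] DERIV_nonpos_imp_nonincreasing[OF \<theta>(1)]) force+
    then show ?thesis by simp
  qed
  have "(\<integral>x. \<bar>h \<theta> x\<bar> \<partial>gaussian) \<le> (\<integral>x. (v \<theta> x - 1) + 2 * \<bar>ln \<alpha>\<bar> \<partial>gaussian)"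
  proof (rule integral_mono)
    fix x
    have "ln \<alpha> \<le> h \<theta> x" "h \<theta> x \<le> v \<theta> x - 1"
      using v_ge[of \<theta> x] \<alpha> v_pos[of \<theta> x] ln_le_minus_one by auto
    then show "\<bar>h \<theta> x\<bar> \<le> (v \<theta> x - 1) + 2 * \<bar>ln \<alpha>\<bar>" by linarith
  qed (use bsmooth_integrable[OF h] bsmooth_integrable[OF v] in simp_all)
  also have "\<dots> = (\<integral>x. F x \<partial>gaussian) - 1 + 2 * \<bar>ln \<alpha>\<bar>"
    using bsmooth_integrable[OF v] by (simp add: mass)
  finally show ?thesis using m by simp
qed

text \<open>No direct gradient bound uniform in the density is at hand, but h - \<open>dval\<close>
  is affine with slope \<open>grad_mean\<close>, and \<open>slope\<close> reads it off from L1
  information on h and \<open>dval\<close>. The factor 32 is 4^2 from \<open>slope_bound\<close>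
  times 2 from squaring a sum.\<close>

lemma grad_mean_sq_le:
  assumes m: "(\<integral>x. F x \<partial>gaussian) \<le> 2" and \<theta>: "0 \<le> \<theta>" "\<theta> < pi / 2"
  shows "(grad_mean \<theta> $ i)\<^sup>2 \<le> 32 * ((1 + 2 * \<bar>ln \<alpha>\<bar>)\<^sup>2 + hess_sq \<theta>)"
proof -
  let ?B = "1 + 2 * \<bar>ln \<alpha>\<bar>" and ?r = "\<integral>x. \<bar>dval \<theta> x\<bar> \<partial>gaussian"
  note ih = bsmooth_integrable[OF h, of \<theta>]
  have "slope (dval \<theta>) = slope (h \<theta>) - grad_mean \<theta>"
    unfolding dval_def by (rule slope_diff_affine[OF ih])
  then have "grad_mean \<theta> $ i = slope (h \<theta>) $ i - slope (dval \<theta>) $ i" by simp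
  moreover have "\<bar>slope (h \<theta>) $ i\<bar> \<le> 4 * ?B"
    using slope_bound[OF ih, of i] integral_abs_h_le[OF assms] by simp
  moreover have "\<bar>slope (dval \<theta>) $ i\<bar> \<le> 4 * ?r"
    by (rule slope_bound[OF dval_integrable])
  ultimately have "\<bar>grad_mean \<theta> $ i\<bar> \<le> 4 * ?B + 4 * ?r" by linarith
  then have "(grad_mean \<theta> $ i)\<^sup>2 \<le> (4 * ?B + 4 * ?r)\<^sup>2"
    by (subst power2_abs[symmetric], intro power_mono) auto
  also have "\<dots> = 16 * ?B\<^sup>2 + 16 * ?r\<^sup>2 + 16 * (2 * ?B * ?r)"
    by (simp add: power2_eq_square algebra_simps)
  also have "\<dots> \<le> 16 * ?B\<^sup>2 + 16 * ?r\<^sup>2 + 16 * (?B\<^sup>2 + ?r\<^sup>2)"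
    by (intro add_left_mono mult_left_mono sum_squares_bound) simp
  also have "\<dots> = 32 * (?B\<^sup>2 + ?r\<^sup>2)" by simp
  also have "\<dots> \<le> 32 * (?B\<^sup>2 + hess_sq \<theta>)"
    using dval_le[of \<theta>] by simp
  finally show ?thesis .
qed

text \<open>Weighted splitting of each product in \<open>err\<close> puts the Hessian and the
  gradient deviations squared over \<eta>, while the rest, including the squared mean gradient,
  receives a factor \<eta>.\<close>

lemma integral_abs_err_le:
  assumes m: "(\<integral>x. F x \<partial>gaussian) \<le> 2" and \<theta>: "0 \<le> \<theta>" "\<theta> < pi / 2" and \<eta>: "0 < \<eta>" "\<eta> \<le> 1"
  shows "(\<integral>x. \<bar>err \<theta> x\<bar> \<partial>gaussian) \<le> error_const CARD('n) \<alpha> * (\<eta> + hess_sq \<theta> / \<eta>)"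
proof -
  let ?H = "\<lambda>i x. partial_deriv i (partial_deriv i (h \<theta>)) x" and ?g = "\<lambda>i x. dgrad i \<theta> x" and ?a = "\<lambda>i. grad_mean \<theta> $ i"
  let ?b = "\<lambda>i x. \<eta> / 2 + (?H i x)\<^sup>2 / (2 * \<eta>) + \<eta> / 2 * (x $ i)\<^sup>2 + \<eta> * (?a i)\<^sup>2 + (3 / (2 * \<eta>) + 1) * (?g i x)\<^sup>2"
  have triangle: "0 \<le> s \<Longrightarrow> \<bar>p - q + 2 * r + s\<bar> \<le> \<bar>p\<bar> + \<bar>q\<bar> + 2 * \<bar>r\<bar> + s" for p q r s :: real
    by linarith
  have pt: "\<bar>?H i x - x $ i * ?g i x + 2 * ?a i * ?g i x + (?g i x)\<^sup>2\<bar> \<le> ?b i x" for i x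
  proof -
    have 1: "2 * \<bar>1 * ?H i x\<bar> \<le> \<eta> * 1\<^sup>2 + (?H i x)\<^sup>2 / \<eta>" by (rule amgm_weighted[OF \<eta>(1)])
    have 2: "2 * \<bar>x $ i * ?g i x\<bar> \<le> \<eta> * (x $ i)\<^sup>2 + (?g i x)\<^sup>2 / \<eta>" by (rule amgm_weighted[OF \<eta>(1)])
    have 3: "2 * \<bar>?a i * ?g i x\<bar> \<le> \<eta> * (?a i)\<^sup>2 + (?g i x)\<^sup>2 / \<eta>" by (rule amgm_weighted[OF \<eta>(1)])
    have "\<bar>?H i x - x $ i * ?g i x + 2 * ?a i * ?g i x + (?g i x)\<^sup>2\<bar>
        \<le> \<bar>?H i x\<bar> + \<bar>x $ i * ?g i x\<bar> + 2 * \<bar>?a i * ?g i x\<bar> + (?g i x)\<^sup>2"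
      using triangle[OF zero_le_power2] by (simp only: mult.assoc)
    also have "\<dots> \<le> \<eta> / 2 + (?H i x)\<^sup>2 / \<eta> / 2 + \<eta> / 2 * (x $ i)\<^sup>2 + (?g i x)\<^sup>2 / \<eta> / 2 + (\<eta> * (?a i)\<^sup>2 + (?g i x)\<^sup>2 / \<eta>) + (?g i x)\<^sup>2"
      using 1 2 3 by simp
    also have "\<dots> = ?b i x"
      using \<eta>(1) by (simp add: field_simps)
    finally show ?thesis .
  qed
  have ib: "integrable gaussian (?b i)" for i
    using bsmooth_sq_integrable[OF hess] bsmooth_sq_integrable[OF dgrad] by simp
  have "(\<integral>x. \<bar>err \<theta> x\<bar> \<partial>gaussian) \<le> (\<integral>x. (\<Sum>i\<in>UNIV. ?b i x) \<partial>gaussian)"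
  proof (rule integral_mono)
    show "\<bar>err \<theta> x\<bar> \<le> (\<Sum>i\<in>UNIV. ?b i x)" for x
      unfolding err_def by (intro order_trans[OF sum_abs] sum_mono pt)
    show "integrable gaussian (\<lambda>x. \<bar>err \<theta> x\<bar>)"
      by (rule integrable_abs[OF err_integrable])
    show "integrable gaussian (\<lambda>x. \<Sum>i\<in>UNIV. ?b i x)"
      by (rule Bochner_Integration.integrable_sum) (rule ib)
  qed
  also have "\<dots> = (\<Sum>i\<in>UNIV. \<integral>x. ?b i x \<partial>gaussian)"
    by (rule Bochner_Integration.integral_sum) (rule ib)
  also have "\<dots> = (\<Sum>i\<in>UNIV. \<eta> + (\<integral>x. (?H i x)\<^sup>2 \<partial>gaussian) / (2 * \<eta>) + \<eta> * (?a i)\<^sup>2 + (3 / (2 * \<eta>) + 1) * (\<integral>x. (?g i x)\<^sup>2 \<partial>gaussian))"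
  proof (rule sum.cong[OF refl])
    fix i :: 'n
    have x2: "(\<integral>(x :: real ^ 'n). (x $ i)\<^sup>2 \<partial>gaussian) = 1"
      using gaussian_covariance[of i i] by (simp add: power2_eq_square[symmetric])
    show "(\<integral>x. ?b i x \<partial>gaussian) = \<eta> + (\<integral>x. (?H i x)\<^sup>2 \<partial>gaussian) / (2 * \<eta>) + \<eta> * (?a i)\<^sup>2 + (3 / (2 * \<eta>) + 1) * (\<integral>x. (?g i x)\<^sup>2 \<partial>gaussian)"
      by (simp add: Bochner_Integration.integral_add Bochner_Integration.integrable_add bsmooth_sq_integrable hess dgrad x2)
  qed
  also have "\<dots> = CARD('n) * \<eta> + (\<Sum>i\<in>UNIV. \<integral>x. (?H i x)\<^sup>2 \<partial>gaussian) / (2 * \<eta>) + \<eta> * (\<Sum>i\<in>UNIV. (?a i)\<^sup>2)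
      + (3 / (2 * \<eta>) + 1) * (\<Sum>i\<in>UNIV. \<integral>x. (?g i x)\<^sup>2 \<partial>gaussian)"
    by (simp only: sum.distrib sum_distrib_left sum_divide_distrib) simp
  also have "\<dots> \<le> CARD('n) * \<eta> + hess_sq \<theta> / (2 * \<eta>) + \<eta> * (\<Sum>i\<in>(UNIV :: 'n set). 32 * ((1 + 2 * \<bar>ln \<alpha>\<bar>)\<^sup>2 + hess_sq \<theta>))
      + (3 / (2 * \<eta>) + 1) * hess_sq \<theta>"
    using \<eta> by (intro add_mono mult_left_mono divide_right_mono sum_mono diag_sq_le dgrad_sq_le grad_mean_sq_le m \<theta>) auto
  also have "\<dots> = (CARD('n) + 32 * CARD('n) * (1 + 2 * \<bar>ln \<alpha>\<bar>)\<^sup>2) * \<eta> + (32 * CARD('n) * \<eta>) * hess_sq \<theta> + 2 * (hess_sq \<theta> / \<eta>) + hess_sq \<theta>"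
    by (simp add: algebra_simps)
  also have "\<dots> \<le> (CARD('n) + 32 * CARD('n) * (1 + 2 * \<bar>ln \<alpha>\<bar>)\<^sup>2) * \<eta> + (32 * CARD('n) * 1) * (hess_sq \<theta> / \<eta>) + 2 * (hess_sq \<theta> / \<eta>) + hess_sq \<theta> / \<eta>"
  proof -
    \<comment> \<open>Here \<eta> \<le> 1 is used: it absorbs the Hessian terms that carry no
      1/\<eta>, namely the one from the squared gradient deviation and the one from the mean
      gradient.\<close>
    have "hess_sq \<theta> \<le> hess_sq \<theta> / \<eta>"
      using \<eta> hess_sq_nonneg[of \<theta>] by (simp add: pos_le_divide_eq mult_left_le)
    then show ?thesis
      using \<eta> hess_sq_nonneg[of \<theta>] by (intro add_mono mult_mono) auto
  qed
  also have "\<dots> \<le> error_const CARD('n) \<alpha> * (\<eta> + hess_sq \<theta> / \<eta>)"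
  proof -
    have gen: "A * \<eta> + N * 1 * q + 2 * q + q \<le> (A + N + 3) * (\<eta> + q)" if "0 \<le> A" "0 \<le> N" "0 \<le> q" for A N q
    proof -
      have "0 \<le> N * \<eta> + 3 * \<eta> + A * q" using that \<eta> by simp
      then show ?thesis by (simp add: algebra_simps)
    qed
    show ?thesis
      unfolding error_const_def of_nat_mult of_nat_numeral of_nat_1 by (rule gen) (use \<eta> hess_sq_nonneg[of \<theta>] in auto)
  qed
  finally show ?thesis .
qed

lemma exists_time:
  obtains \<xi> where "0 < \<xi>" "\<xi> < pi / 4" "\<alpha> * hess_sq \<xi> \<le> time_const * deficit"
proof -
  have dd: "(D has_real_derivative - tan x * J x) (at x)" if "pi / 8 \<le> x" "x \<le> pi / 4" for x
  proof (intro D_deriv cos_gt_zero)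
    show "0 < x" "x < pi / 2" using that pi_gt_zero by linarith+
  qed
  have lt: "pi / 8 < pi / 4" using pi_gt_zero by simp
  obtain \<xi> where \<xi>: "pi / 8 < \<xi>" "\<xi> < pi / 4" "D (pi / 4) - D (pi / 8) = (pi / 4 - pi / 8) * (- tan \<xi> * J \<xi>)"
    using MVT2[OF lt dd] by blast
  \<comment> \<open>The interval stays away from 0, where the dissipation factor tan vanishes; this
    makes the constant independent of the position of \<xi>.\<close>
  have "tan (pi / 8) \<le> tan \<xi>"
    using \<xi> pi_gt_zero by (intro less_imp_le tan_monotone) auto
  then have "pi / 8 * (tan (pi / 8) * J \<xi>) \<le> pi / 8 * (tan \<xi> * J \<xi>)"
    using J_nonneg by (intro mult_left_mono mult_right_mono) auto
  also have "\<dots> = D (pi / 8) - D (pi / 4)"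
    using \<xi>(3) by (simp add: field_simps)
  also have "\<dots> \<le> deficit"
    using D_antimono[of 0 "pi / 8"] D_antimono[of "pi / 4" "pi / 2"] pi_gt_zero by (simp add: deficit_def)
  finally have "J \<xi> \<le> time_const * deficit"
    unfolding time_const_def using tan_pi_8_pos pi_gt_zero by (simp add: field_simps)
  then show ?thesis
    using that[of \<xi>] \<xi> hess_sq_le[of \<xi>] pi_gt_zero by simp
qed

text \<open>Testing \<open>resid (h 0)\<close> against its sign \<open>\<sigma>\<close> turns the \<open>L\<^sup>1\<close> norm into the value at \<open>0\<close> of a
  differentiable function of \<open>\<theta>\<close>, whose derivative only sees \<open>err\<close> because \<open>resid\<close> kills affine functions.\<close>

theorem smooth_stability:
  assumes m: "(\<integral>x. F x \<partial>gaussian) \<le> 2" and \<eta>: "0 < \<eta>" "\<eta> \<le> 1"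
  shows "(\<integral>x. \<bar>resid (\<lambda>x. ln (F x)) x\<bar> \<partial>gaussian) \<le> stability_const CARD('n) \<alpha> * (\<eta> + deficit / \<eta>)"
proof -
  let ?N = "4 * real CARD('n) + 2" and ?E = "error_const CARD('n) \<alpha>"
  have ih: "integrable gaussian (h \<theta>)" for \<theta> by (rule bsmooth_integrable[OF h])
  have mr: "resid (h 0) \<in> borel_measurable borel"
    using borel_measurable_integrable[OF resid_integrable[OF ih[of 0]]] by simp
  define \<sigma> where "\<sigma> x = sgn (resid (h 0) x)" for x
  have \<sigma>m [measurable]: "\<sigma> \<in> borel_measurable borel" unfolding \<sigma>_def using mr by measurable
  have \<sigma>b: "\<bar>\<sigma> x\<bar> \<le> 1" for x by (simp add: \<sigma>_def sgn_real_def)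
  note db = dual_bound[OF \<sigma>m \<sigma>b]
  define Z where "Z \<theta> = (\<integral>x. dual \<sigma> x * h \<theta> x \<partial>gaussian)" for \<theta>
  have abs_dual: "\<bar>\<integral>x. dual \<sigma> x * \<phi> x \<partial>gaussian\<bar> \<le> ?N * (\<integral>x. \<bar>\<phi> x\<bar> \<partial>gaussian)" if \<phi>: "integrable gaussian \<phi>" for \<phi>
  proof -
    have "\<bar>\<integral>x. dual \<sigma> x * \<phi> x \<partial>gaussian\<bar> \<le> (\<integral>x. ?N * \<bar>\<phi> x\<bar> \<partial>gaussian)"
    proof (rule order_trans[OF integral_abs_bound], rule integral_mono)
      show "integrable gaussian (\<lambda>x. \<bar>dual \<sigma> x * \<phi> x\<bar>)"
        by (intro integrable_abs integrable_mult_bounded[OF _ db \<phi>]) simp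
      show "\<bar>dual \<sigma> x * \<phi> x\<bar> \<le> ?N * \<bar>\<phi> x\<bar>" for x
        unfolding abs_mult using db[of x] by (intro mult_right_mono) auto
    qed (use \<phi> in simp)
    then show ?thesis by simp
  qed
  have Z0: "Z 0 = (\<integral>x. \<bar>resid (\<lambda>x. ln (F x)) x\<bar> \<partial>gaussian)"
  proof -
    have "Z 0 = (\<integral>x. \<sigma> x * resid (h 0) x \<partial>gaussian)"
      unfolding Z_def by (rule integral_dual[OF \<sigma>m \<sigma>b ih])
    also have "\<dots> = (\<integral>x. \<bar>resid (h 0) x\<bar> \<partial>gaussian)"
      by (simp add: \<sigma>_def abs_sgn mult.commute)
    finally show ?thesis by simp
  qed
  have Z': "(Z has_real_derivative tan \<theta> * (\<integral>x. dual \<sigma> x * err \<theta> x \<partial>gaussian)) (at \<theta>)" if c: "cos \<theta> \<noteq> 0" for \<theta>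
  proof -
    obtain w where w: "integrable gaussian w" "\<And>\<theta> x. \<bar>ou_dot \<theta> F x\<bar> \<le> w x" "\<And>x. 0 \<le> w x"
      using ou_dot_bound[OF F] by blast
    have "(Z has_real_derivative (\<integral>x. dual \<sigma> x * (ou_dot \<theta> F x / v \<theta> x) \<partial>gaussian)) (at \<theta>)"
      unfolding Z_def
    proof (rule has_derivative_integral[where a = "\<theta> - 1" and b = "\<theta> + 1" and w = "\<lambda>x. ?N * (w x / \<alpha>)"])
      fix s x
      show "((\<lambda>t. dual \<sigma> x * h t x) has_real_derivative dual \<sigma> x * (ou_dot s F x / v s x)) (at s)"
        using v_pos[of s x] by (auto intro!: derivative_eq_intros ou_has_derivative F simp: field_simps)
      have "\<bar>ou_dot s F x\<bar> / v s x \<le> w x / \<alpha>"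
        using v_ge[of s x] \<alpha> w by (intro frac_le) auto
      then show "\<bar>dual \<sigma> x * (ou_dot s F x / v s x)\<bar> \<le> ?N * (w x / \<alpha>)"
        unfolding abs_mult using db[of x] v_pos[of s x] by (intro mult_mono) (auto simp: abs_divide)
    next
      fix s show "(\<lambda>x. dual \<sigma> x * h s x) \<in> borel_measurable gaussian"
        using bsmooth_borel_measurable[OF h] by simp
    next
      show "integrable gaussian (\<lambda>x. dual \<sigma> x * h \<theta> x)"
        by (rule integrable_mult_bounded[OF _ db ih]) simp
      show "(\<lambda>x. dual \<sigma> x * (ou_dot \<theta> F x / v \<theta> x)) \<in> borel_measurable gaussian"
        using bsmooth_borel_measurable[OF v] ou_dot_measurable[OF F] by simp
    qed (use w in auto)
    moreover have "(\<integral>x. dual \<sigma> x * (ou_dot \<theta> F x / v \<theta> x) \<partial>gaussian) = tan \<theta> * (\<integral>x. dual \<sigma> x * err \<theta> x \<partial>gaussian)"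
    proof -
      let ?aff = "\<lambda>x. (- grad_mean \<theta>) \<bullet> x + (norm (grad_mean \<theta>))\<^sup>2"
      have ia: "integrable gaussian ?aff" by (intro Bochner_Integration.integrable_add integrable_affine) simp
      have "(\<integral>x. dual \<sigma> x * (ou_dot \<theta> F x / v \<theta> x) \<partial>gaussian) = (\<integral>x. tan \<theta> * (dual \<sigma> x * err \<theta> x + dual \<sigma> x * ?aff x) \<partial>gaussian)"
        unfolding h_dot[OF c] by (intro Bochner_Integration.integral_cong refl) (simp only: distrib_left mult_ac)
      also have "\<dots> = tan \<theta> * ((\<integral>x. dual \<sigma> x * err \<theta> x \<partial>gaussian) + (\<integral>x. dual \<sigma> x * ?aff x \<partial>gaussian))"
        unfolding integral_mult_right_zero
          Bochner_Integration.integral_add[OF integrable_mult_bounded[OF dual_measurable[OF \<sigma>m] db err_integrable]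
            integrable_mult_bounded[OF dual_measurable[OF \<sigma>m] db ia]] ..
      also have "(\<integral>x. dual \<sigma> x * ?aff x \<partial>gaussian) = 0"
        unfolding integral_dual[OF \<sigma>m \<sigma>b ia] resid_affine by simp
      finally show ?thesis by simp
    qed
    ultimately show ?thesis by simp
  qed
  obtain \<xi> where \<xi>: "0 < \<xi>" "\<xi> < pi / 4" "\<alpha> * hess_sq \<xi> \<le> time_const * deficit"
    using exists_time by blast
  let ?A = "?N * ?E"
  have N0: "0 < ?N" "0 < ?E" by (auto intro: error_const_pos)
  \<comment> \<open>The added terms pay for the worst case of the derivative of Z: \<eta> \<theta>
    covers the part of the error bound proportional to \<eta>, and the decrease of D covers the
    Hessian part, since - D' = tan \<theta> J \<ge> \<alpha> tan \<theta>
    \<open>hess_sq\<close>.\<close>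
  define W where "W \<theta> = Z \<theta> + ?A * (\<eta> * \<theta> - D \<theta> / (\<alpha> * \<eta>))" for \<theta>
  have "W 0 \<le> W \<xi>"
  proof (rule DERIV_nonneg_imp_nondecreasing[where f = W])
    fix \<theta> assume \<theta>: "0 \<le> \<theta>" "\<theta> \<le> \<xi>"
    then have c: "cos \<theta> > 0" and \<theta>2: "\<theta> < pi / 2" using \<xi> pi_gt_zero by (auto intro!: cos_gt_zero_pi)
    have t: "0 \<le> tan \<theta>" "tan \<theta> \<le> 1"
    proof -
      have "tan 0 \<le> tan \<theta>" using \<theta> \<theta>2 by (intro tan_mono_le) auto
      then show "0 \<le> tan \<theta>" by simp
      have "tan \<theta> \<le> tan (pi / 4)" using \<theta> \<xi> pi_gt_zero by (intro tan_mono_le) auto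
      then show "tan \<theta> \<le> 1" by (simp add: tan_45)
    qed
    have "tan \<theta> * (hess_sq \<theta> / \<eta>) \<le> tan \<theta> * J \<theta> / (\<alpha> * \<eta>)"
    proof -
      have "hess_sq \<theta> / \<eta> \<le> J \<theta> / (\<alpha> * \<eta>)"
        using hess_sq_le[of \<theta>] \<alpha> \<eta>(1) by (simp add: field_simps)
      from mult_left_mono[OF this t(1)] show ?thesis by simp
    qed
    moreover have "tan \<theta> * \<eta> \<le> \<eta>" using t \<eta>(1) by (simp add: mult_left_le_one_le)
    ultimately have b: "tan \<theta> * (\<eta> + hess_sq \<theta> / \<eta>) \<le> \<eta> + tan \<theta> * J \<theta> / (\<alpha> * \<eta>)"
      by (simp only: distrib_left)
    have "\<bar>\<integral>x. dual \<sigma> x * err \<theta> x \<partial>gaussian\<bar> \<le> ?N * (?E * (\<eta> + hess_sq \<theta> / \<eta>))"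
      using abs_dual[OF err_integrable] integral_abs_err_le[OF m \<theta>(1) \<theta>2 \<eta>] N0
      by (meson mult_left_mono order_trans less_imp_le)
    then have "tan \<theta> * \<bar>\<integral>x. dual \<sigma> x * err \<theta> x \<partial>gaussian\<bar> \<le> tan \<theta> * (?A * (\<eta> + hess_sq \<theta> / \<eta>))"
      using t(1) by (intro mult_left_mono) (simp_all only: mult.assoc)
    also have "\<dots> = ?A * (tan \<theta> * (\<eta> + hess_sq \<theta> / \<eta>))" by (simp only: mult_ac)
    also have "\<dots> \<le> ?A * (\<eta> + tan \<theta> * J \<theta> / (\<alpha> * \<eta>))"
      using N0 by (intro mult_left_mono b) auto
    finally have "tan \<theta> * \<bar>\<integral>x. dual \<sigma> x * err \<theta> x \<partial>gaussian\<bar> \<le> ?A * (\<eta> + tan \<theta> * J \<theta> / (\<alpha> * \<eta>))" .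
    moreover have "- (tan \<theta> * \<bar>\<integral>x. dual \<sigma> x * err \<theta> x \<partial>gaussian\<bar>) \<le> tan \<theta> * (\<integral>x. dual \<sigma> x * err \<theta> x \<partial>gaussian)"
      using mult_left_mono[OF _ t(1), of "- \<bar>\<integral>x. dual \<sigma> x * err \<theta> x \<partial>gaussian\<bar>" "\<integral>x. dual \<sigma> x * err \<theta> x \<partial>gaussian"]
      by simp
    ultimately have "0 \<le> tan \<theta> * (\<integral>x. dual \<sigma> x * err \<theta> x \<partial>gaussian) + ?A * (\<eta> - (- tan \<theta> * J \<theta>) / (\<alpha> * \<eta>))"
      by simp
    moreover have "(W has_real_derivative tan \<theta> * (\<integral>x. dual \<sigma> x * err \<theta> x \<partial>gaussian) + ?A * (\<eta> - (- tan \<theta> * J \<theta>) / (\<alpha> * \<eta>))) (at \<theta>)"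
      unfolding W_def[abs_def] using \<alpha> \<eta>(1)
      by (auto intro!: derivative_eq_intros DERIV_cdivide Z' D_deriv less_imp_neq[OF c, symmetric] c)
    ultimately show "\<exists>y. (W has_real_derivative y) (at \<theta>) \<and> 0 \<le> y" by blast
  qed (use \<xi> in simp)
  then have "Z 0 \<le> Z \<xi> + ?A * (\<eta> * \<xi> + (D 0 - D \<xi>) / (\<alpha> * \<eta>))"
    by (simp add: W_def algebra_simps diff_divide_distrib)
  also have "\<dots> \<le> Z \<xi> + ?A * (\<eta> * 1 + deficit / (\<alpha> * \<eta>))"
  proof -
    have "D 0 - D \<xi> \<le> deficit" using D_antimono[of \<xi> "pi / 2"] \<xi> by (simp add: deficit_def)
    moreover have "\<xi> \<le> 1" using \<xi>(2) pi_less_4 by simp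
    ultimately show ?thesis using N0 \<alpha> \<eta> by (intro add_left_mono mult_left_mono add_mono divide_right_mono) auto
  qed
  \<comment> \<open>At \<xi> the Hessian itself is small. As \<open>resid\<close> ignores the affine
    difference between \<open>h \<xi>\<close> and \<open>dval \<xi>\<close>, the latter may be
    tested instead, and \<open>dval_le\<close> bounds its L1 norm.\<close>
  also have "Z \<xi> \<le> ?N * (\<eta> + time_const * deficit / (\<alpha> * \<eta>))"
  proof -
    let ?r = "\<integral>x. \<bar>dval \<xi> x\<bar> \<partial>gaussian"
    have "Z \<xi> = (\<integral>x. dual \<sigma> x * dval \<xi> x \<partial>gaussian)"
      unfolding Z_def integral_dual[OF \<sigma>m \<sigma>b ih] integral_dual[OF \<sigma>m \<sigma>b dval_integrable]
      unfolding dval_def resid_diff_affine[OF ih] ..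
    also have "\<dots> \<le> ?N * ?r" using abs_dual[OF dval_integrable, of \<xi>] by linarith
    also have "\<dots> \<le> ?N * (\<eta> + hess_sq \<xi> / \<eta>)"
    proof -
      have "2 * \<bar>1 * ?r\<bar> \<le> \<eta> * 1\<^sup>2 + ?r\<^sup>2 / \<eta>" by (rule amgm_weighted[OF \<eta>(1)])
      also have "?r\<^sup>2 / \<eta> \<le> hess_sq \<xi> / \<eta>" using dval_le \<eta>(1) by (intro divide_right_mono) auto
      finally have "2 * ?r \<le> \<eta> + hess_sq \<xi> / \<eta>" by simp
      moreover have "0 \<le> ?r" by simp
      ultimately have "?r \<le> \<eta> + hess_sq \<xi> / \<eta>" by linarith
      then show ?thesis using N0 by (intro mult_left_mono) auto
    qed
    also have "\<dots> \<le> ?N * (\<eta> + time_const * deficit / (\<alpha> * \<eta>))"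
      using \<xi>(3) \<alpha> \<eta>(1) N0 by (intro mult_left_mono add_left_mono) (simp_all add: field_simps)
    finally show ?thesis .
  qed
  finally have "Z 0 \<le> ?N * (\<eta> + time_const * deficit / (\<alpha> * \<eta>)) + ?A * (\<eta> + deficit / (\<alpha> * \<eta>))" by simp
  also have "\<dots> = ?N * ((1 + ?E) * \<eta> + (time_const + ?E) * (1 / \<alpha>) * (deficit / \<eta>))"
    by (simp add: algebra_simps add_divide_distrib)
  also have "\<dots> \<le> ?N * ((1 + ?E) * (1 + time_const) * (1 + 1 / \<alpha>) * \<eta> + (1 + ?E) * (1 + time_const) * (1 + 1 / \<alpha>) * (deficit / \<eta>))"
  proof (rule mult_left_mono[OF add_mono[OF mult_right_mono mult_right_mono]])
    have "1 + ?E \<le> (1 + ?E) * (1 + time_const)"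
      using N0 time_const_pos by (simp add: algebra_simps)
    also have "\<dots> \<le> (1 + ?E) * (1 + time_const) * (1 + 1 / \<alpha>)"
      using N0 time_const_pos \<alpha> by (simp add: algebra_simps)
    finally show "1 + ?E \<le> (1 + ?E) * (1 + time_const) * (1 + 1 / \<alpha>)" .
    have "time_const + ?E \<le> (1 + ?E) * (1 + time_const)"
      using N0 time_const_pos by (simp add: algebra_simps)
    then show "(time_const + ?E) * (1 / \<alpha>) \<le> (1 + ?E) * (1 + time_const) * (1 + 1 / \<alpha>)"
      using N0 time_const_pos \<alpha> by (intro mult_mono) auto
  qed (use \<eta> N0 deficit_nonneg in auto)
  also have "\<dots> = stability_const CARD('n) \<alpha> * (\<eta> + deficit / \<eta>)"
    by (simp only: stability_const_def distrib_left[symmetric] mult.assoc)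
  finally show ?thesis unfolding Z0 .
qed

end

section \<open>Mollification\<close>

lemma lborel_integral_translate:
  fixes f :: "'a::euclidean_space \<Rightarrow> real"
  shows "f \<in> borel_measurable borel \<Longrightarrow> (\<integral>x. f (x - z) \<partial>lborel) = (\<integral>x. f x \<partial>lborel)"
  by (subst (2) lborel_distr_plus[of "- z", symmetric]) (simp add: integral_distr)

lemma lborel_integrable_translate:
  fixes f :: "'a::euclidean_space \<Rightarrow> real"
  assumes "integrable lborel f" shows "integrable lborel (\<lambda>x. f (x - z))"
proof -
  have "integrable (distr lborel borel ((+) (- z))) f" using assms by (simp add: lborel_distr_plus)
  then show ?thesis
    using borel_measurable_integrable[OF assms] by (simp add: integrable_distr_eq)
qed

text \<open>Truncation in height and support leaves a bounded function with bounded support;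
  measurability provides continuous functions converging to it almost everywhere, and a common
  majorant turns this into L1 convergence.\<close>

lemma L1_approx_continuous:
  fixes b :: "'a::euclidean_space \<Rightarrow> real"
  assumes b: "integrable lborel b" and "0 < \<epsilon>"
  obtains g R where "continuous_on UNIV g" "\<And>x. R < norm x \<Longrightarrow> g x = 0" "(\<integral>x. \<bar>b x - g x\<bar> \<partial>lborel) < \<epsilon>"
proof -
  have bm [measurable]: "b \<in> borel_measurable borel" using borel_measurable_integrable[OF b] by simp
  define t where "t k x = (if norm x \<le> real k then max (- real k) (min (real k) (b x)) else 0)" for k x
  have tm [measurable]: "t k \<in> borel_measurable borel" for k unfolding t_def by measurable
  have "(\<lambda>k. \<integral>x. \<bar>b x - t k x\<bar> \<partial>lborel) \<longlonglongrightarrow> (\<integral>(x :: 'a). 0 \<partial>lborel)"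
  proof (rule integral_dominated_convergence[where w = "\<lambda>x. 2 * \<bar>b x\<bar>"])
    show "AE x in lborel. (\<lambda>k. \<bar>b x - t k x\<bar>) \<longlonglongrightarrow> 0"
    proof (intro AE_I2 tendsto_eventually)
      fix x
      obtain k0 :: nat where "max (norm x) \<bar>b x\<bar> \<le> real k0" using real_arch_simple by blast
      then show "\<forall>\<^sub>F k in sequentially. \<bar>b x - t k x\<bar> = 0"
        by (intro eventually_sequentiallyI[of k0]) (auto simp: t_def)
    qed
    show "AE x in lborel. norm \<bar>b x - t k x\<bar> \<le> 2 * \<bar>b x\<bar>" for k
      by (intro AE_I2) (auto simp: t_def)
  qed (use b in auto)
  then have "\<forall>\<^sub>F k in sequentially. (\<integral>x. \<bar>b x - t k x\<bar> \<partial>lborel) < \<epsilon> / 2"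
    using assms(2) by (intro order_tendstoD) auto
  then obtain k where k: "(\<integral>x. \<bar>b x - t k x\<bar> \<partial>lborel) < \<epsilon> / 2"
    by (auto simp: eventually_sequentially)
  have ti: "integrable lborel (t k)"
    by (rule Bochner_Integration.integrable_bound[OF b]) (auto simp: t_def)
  have "t k \<in> borel_measurable lebesgue" by (rule measurable_completion) simp
  then have "t k measurable_on UNIV" by (rule lebesgue_measurable_imp_measurable_on) simp
  then obtain N g where N: "negligible N" and g: "\<And>n. continuous_on UNIV (g n)"
    and lim: "\<And>x. x \<notin> N \<Longrightarrow> (\<lambda>n. g n x) \<longlonglongrightarrow> t k x"
    unfolding measurable_on_def by auto
  \<comment> \<open>A continuous cutoff equal to 1 on the ball of radius k. Together with the
    clipping in \<open>G\<close> it supplies the majorant, and neither changes the limit, since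
    \<open>t k\<close> is already clipped and supported in that ball.\<close>
  define c where "c x = max 0 (min 1 (real k + 1 - norm x))" for x :: 'a
  define G where "G n x = c x * max (- real k) (min (real k) (g n x))" for n x
  have Gc: "continuous_on UNIV (G n)" for n
    unfolding G_def c_def by (intro continuous_intros g)
  have [measurable]: "G n \<in> borel_measurable borel" for n
    by (rule borel_measurable_continuous_onI[OF Gc])
  have Gb: "\<bar>G n x\<bar> \<le> real k * indicator (cball 0 (real k + 1)) x" for n x
  proof -
    have "\<bar>c x\<bar> * \<bar>max (- real k) (min (real k) (g n x))\<bar> \<le> indicator (cball 0 (real k + 1)) x * real k"
      by (intro mult_mono) (auto simp: c_def split: split_indicator)
    then show ?thesis by (simp add: G_def abs_mult mult.commute)
  qed
  have ind: "integrable lborel (\<lambda>x :: 'a. real k * indicator (cball 0 (real k + 1)) x)"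
    using emeasure_lborel_cball_finite[of "0 :: 'a" "real k + 1"] by (intro integrable_mult_right integrable_real_indicator) auto
  have Gi: "integrable lborel (G n)" for n
    by (rule Bochner_Integration.integrable_bound[OF ind]) (use Gb in \<open>auto intro!: AE_I2 simp: abs_mult\<close>)
  have "(\<lambda>n. \<integral>x. \<bar>t k x - G n x\<bar> \<partial>lborel) \<longlonglongrightarrow> (\<integral>(x :: 'a). 0 \<partial>lborel)"
  proof (rule integral_dominated_convergence[where w = "\<lambda>x. \<bar>t k x\<bar> + real k * indicator (cball 0 (real k + 1)) x"])
    have "N \<in> null_sets lebesgue" using N by (simp add: negligible_iff_null_sets)
    then have "AE x in lebesgue. x \<notin> N" by (rule AE_not_in)
    then have "AE x in lebesgue. (\<lambda>n. \<bar>t k x - G n x\<bar>) \<longlonglongrightarrow> 0"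
    proof (rule AE_mp, intro AE_I2 impI)
      fix x assume "x \<notin> N"
      have "(\<lambda>n. G n x) \<longlonglongrightarrow> c x * max (- real k) (min (real k) (t k x))"
        unfolding G_def by (intro tendsto_intros lim \<open>x \<notin> N\<close>)
      moreover have "c x * max (- real k) (min (real k) (t k x)) = t k x"
        by (auto simp: t_def c_def)
      ultimately have "(\<lambda>n. \<bar>t k x - G n x\<bar>) \<longlonglongrightarrow> \<bar>t k x - t k x\<bar>"
        by (intro tendsto_intros) simp
      then show "(\<lambda>n. \<bar>t k x - G n x\<bar>) \<longlonglongrightarrow> 0" by simp
    qed
    then show "AE x in lborel. (\<lambda>n. \<bar>t k x - G n x\<bar>) \<longlonglongrightarrow> 0"
      by (simp add: AE_completion_iff)
    show "AE x in lborel. norm \<bar>t k x - G n x\<bar> \<le> \<bar>t k x\<bar> + real k * indicator (cball 0 (real k + 1)) x" for n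
    proof (intro AE_I2)
      fix x show "norm \<bar>t k x - G n x\<bar> \<le> \<bar>t k x\<bar> + real k * indicator (cball 0 (real k + 1)) x"
        using Gb[of n x] by simp
    qed
  qed (use ti ind in auto)
  then have "\<forall>\<^sub>F n in sequentially. (\<integral>x. \<bar>t k x - G n x\<bar> \<partial>lborel) < \<epsilon> / 2"
    using assms(2) by (intro order_tendstoD) auto
  then obtain n where n: "(\<integral>x. \<bar>t k x - G n x\<bar> \<partial>lborel) < \<epsilon> / 2"
    by (auto simp: eventually_sequentially)
  have "(\<integral>x. \<bar>b x - G n x\<bar> \<partial>lborel) \<le> (\<integral>x. \<bar>b x - t k x\<bar> + \<bar>t k x - G n x\<bar> \<partial>lborel)"
    by (rule integral_mono) (use b ti Gi in auto)
  also have "\<dots> < \<epsilon>" using b ti Gi k n by simp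
  finally have "(\<integral>x. \<bar>b x - G n x\<bar> \<partial>lborel) < \<epsilon>" .
  moreover have "G n x = 0" if "real k + 1 < norm x" for x using that by (simp add: G_def c_def)
  ultimately show ?thesis using that[OF Gc] by blast
qed

text \<open>An \<epsilon>/3 argument: uniform continuity handles the shift of the approximating
  function, and translation invariance of Lebesgue measure makes the approximation error the same
  before and after the shift.\<close>

lemma L1_translation:
  fixes b :: "'a::euclidean_space \<Rightarrow> real"
  assumes b: "integrable lborel b" and \<epsilon>: "0 < \<epsilon>"
  obtains \<delta> where "0 < \<delta>" "\<And>z. norm z < \<delta> \<Longrightarrow> (\<integral>x. \<bar>b (x - z) - b x\<bar> \<partial>lborel) < \<epsilon>"
proof -
  have "0 < \<epsilon> / 3" using \<epsilon> by simp
  from L1_approx_continuous[OF b this] obtain g R where g: "continuous_on UNIV g" "\<And>x. R < norm x \<Longrightarrow> g x = 0"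
    and bg: "(\<integral>x. \<bar>b x - g x\<bar> \<partial>lborel) < \<epsilon> / 3" by blast
  have gm [measurable]: "g \<in> borel_measurable borel" by (rule borel_measurable_continuous_onI[OF g(1)])
  have bm [measurable]: "b \<in> borel_measurable borel" using borel_measurable_integrable[OF b] by simp
  \<comment> \<open>Adding 1 keeps V positive even if the ball is empty, so that \<epsilon> / (3 V)
    is an admissible tolerance.\<close>
  define V where "V = measure lborel (cball (0 :: 'a) (R + 1)) + 1"
  have V: "V > 0" by (simp add: V_def add_nonneg_pos)
  have uc: "uniformly_continuous_on (cball 0 (R + 2)) g"
    by (intro compact_uniformly_continuous continuous_on_subset[OF g(1)]) auto
  then obtain d where d: "d > 0" "\<And>x y. x \<in> cball 0 (R + 2) \<Longrightarrow> y \<in> cball 0 (R + 2) \<Longrightarrow> dist y x < d \<Longrightarrow> dist (g y) (g x) < \<epsilon> / (3 * V)"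
    using uc[unfolded uniformly_continuous_on_def, rule_format, of "\<epsilon> / (3 * V)"] \<epsilon> V by auto
  have ind: "integrable lborel (\<lambda>x :: 'a. \<epsilon> / (3 * V) * indicator (cball 0 (R + 1)) x)"
    using emeasure_lborel_cball_finite[of "0 :: 'a" "R + 1"] by (intro integrable_mult_right integrable_real_indicator) auto
  have gi: "integrable lborel g"
  proof -
    have "compact (g ` cball 0 R)" by (intro compact_continuous_image continuous_on_subset[OF g(1)]) auto
    then obtain M where M: "\<And>x. x \<in> cball 0 R \<Longrightarrow> \<bar>g x\<bar> \<le> M"
      using compact_imp_bounded bounded_iff by (metis image_eqI real_norm_def)
    have "integrable lborel (\<lambda>x :: 'a. M * indicator (cball 0 R) x)"
      using emeasure_lborel_cball_finite[of "0 :: 'a" R] by (intro integrable_mult_right integrable_real_indicator) auto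
    then show ?thesis
    proof (rule Bochner_Integration.integrable_bound)
      show "AE x in lborel. norm (g x) \<le> norm (M * indicator (cball 0 R) x)"
      proof (rule AE_I2)
        fix x :: 'a
        show "norm (g x) \<le> norm (M * indicator (cball 0 R) x)"
          using M[of x] g(2)[of x] by (cases "norm x \<le> R") auto
      qed
    qed simp
  qed
  show ?thesis
  proof (rule that[of "min d 1"])
    fix z :: 'a assume z: "norm z < min d 1"
    have pt: "\<bar>g (x - z) - g x\<bar> \<le> \<epsilon> / (3 * V) * indicator (cball 0 (R + 1)) x" for x
    proof (cases "norm x \<le> R + 1")
      case True
      have "norm (x - z) \<le> R + 2" using norm_triangle_ineq4[of x z] True z by simp
      then have "dist (g (x - z)) (g x) < \<epsilon> / (3 * V)"
        using True z by (intro d) (auto simp: dist_norm norm_minus_commute)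
      then show ?thesis using True by (simp add: dist_real_def)
    next
      case False
      have "norm x \<le> norm (x - z) + norm z" using norm_triangle_ineq[of "x - z" z] by simp
      then have "R < norm (x - z)" using False z by simp
      then show ?thesis using False g(2)[of "x - z"] g(2)[of x] by simp
    qed
    have mid: "(\<integral>x. \<bar>g (x - z) - g x\<bar> \<partial>lborel) \<le> \<epsilon> / 3"
    proof -
      have "(\<integral>x. \<bar>g (x - z) - g x\<bar> \<partial>lborel) \<le> (\<integral>(x :: 'a). \<epsilon> / (3 * V) * indicator (cball 0 (R + 1)) x \<partial>lborel)"
        by (rule integral_mono) (use pt ind gi lborel_integrable_translate[OF gi] in auto)
      also have "\<dots> = \<epsilon> / (3 * V) * (V - 1)" by (simp add: V_def)
      also have "\<dots> \<le> \<epsilon> / (3 * V) * V" using \<epsilon> V by (intro mult_left_mono) auto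
      also have "\<dots> = \<epsilon> / 3" using V by simp
      finally show ?thesis .
    qed
    have i1: "integrable lborel (\<lambda>x. \<bar>b (x - z) - g (x - z)\<bar>)"
      using lborel_integrable_translate[OF b] lborel_integrable_translate[OF gi] by simp
    have "(\<integral>x. \<bar>b (x - z) - b x\<bar> \<partial>lborel) \<le> (\<integral>x. \<bar>b (x - z) - g (x - z)\<bar> + \<bar>g (x - z) - g x\<bar> + \<bar>b x - g x\<bar> \<partial>lborel)"
      by (rule integral_mono) (use b gi lborel_integrable_translate[OF b] lborel_integrable_translate[OF gi] in auto)
    also have "\<dots> = (\<integral>x. \<bar>b (x - z) - g (x - z)\<bar> \<partial>lborel) + (\<integral>x. \<bar>g (x - z) - g x\<bar> \<partial>lborel) + (\<integral>x. \<bar>b x - g x\<bar> \<partial>lborel)"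
      using i1 b gi lborel_integrable_translate[OF gi] by simp
    also have "(\<integral>x. \<bar>b (x - z) - g (x - z)\<bar> \<partial>lborel) = (\<integral>x. \<bar>b x - g x\<bar> \<partial>lborel)"
      by (rule lborel_integral_translate) simp
    finally show "(\<integral>x. \<bar>b (x - z) - b x\<bar> \<partial>lborel) < \<epsilon>" using mid bg by simp
  qed (use d in simp)
qed

section \<open>A smooth bump function with compact support\<close>

text \<open>The standard bump exp (1 - 1/(1 - x^2)), normalised to 1 at the origin, with a rational
  prefactor: in this shape the family is closed under differentiation.\<close>

definition bump_fun :: "real poly \<Rightarrow> nat \<Rightarrow> real \<Rightarrow> real" where
  "bump_fun p k x = (if \<bar>x\<bar> < 1 then poly p x / (1 - x\<^sup>2) ^ k * exp (1 - 1 / (1 - x\<^sup>2)) else 0)"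

text \<open>The new numerator over (1 - x^2)^(k+2): the three terms come from differentiating p, the
  denominator and the exponent. The polynomial \<open>[:1, 0, -1:]\<close> is 1 - x^2.\<close>

definition bump_step :: "real poly \<Rightarrow> nat \<Rightarrow> real poly" where
  "bump_step p k = pderiv p * [:1, 0, -1:]\<^sup>2 + smult (2 * real k) ([:0, 1:] * p * [:1, 0, -1:]) - smult 2 ([:0, 1:] * p)"

lemma power_div_fact_le_exp: "0 \<le> x \<Longrightarrow> x ^ n / fact n \<le> exp x" for x :: real
proof -
  assume x: "0 \<le> x"
  have "(\<Sum>i\<in>{n}. x ^ i /\<^sub>R fact i) \<le> (\<Sum>i. x ^ i /\<^sub>R fact i)"
    by (rule sum_le_suminf) (use x summable_exp_generic[of x] in auto)
  then show ?thesis by (simp add: exp_def divide_inverse mult.commute)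
qed

text \<open>With w = 1 - x^2, one term of the exponential series gives exp (- 1/w) \<le> (k+2)!
  w^(k+2). This beats the pole of order k and leaves two powers of w to spare, which are needed for
  differentiability at the boundary.\<close>

lemma bump_fun_bound: obtains M where "M \<ge> 0" "\<And>x. \<bar>x\<bar> < 1 \<Longrightarrow> \<bar>bump_fun p k x\<bar> \<le> M * (1 - x\<^sup>2)\<^sup>2"
proof -
  have "compact (poly p ` {-1..1})" by (intro compact_continuous_image continuous_intros) auto
  then obtain B where B: "\<And>x. x \<in> {-1..1} \<Longrightarrow> \<bar>poly p x\<bar> \<le> B"
    using compact_imp_bounded bounded_iff by (metis image_eqI real_norm_def)
  have B0: "0 \<le> B" using B[of 0] by simp
  let ?M = "B * (fact (k + 2) * exp 1)"
  have "\<bar>bump_fun p k x\<bar> \<le> ?M * (1 - x\<^sup>2)\<^sup>2" if x: "\<bar>x\<bar> < 1" for x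
  proof -
    define w where "w = 1 - x\<^sup>2"
    have w: "w > 0" using x by (simp add: w_def abs_square_less_1)
    have "(1 / w) ^ (k + 2) / fact (k + 2) \<le> exp (1 / w)"
      using w by (intro power_div_fact_le_exp) auto
    then have "exp (- (1 / w)) \<le> fact (k + 2) * w ^ (k + 2)"
      using w by (simp add: exp_minus field_simps del: fact_Suc power_Suc)
    then have "exp 1 * exp (- (1 / w)) \<le> exp 1 * (fact (k + 2) * w ^ (k + 2))"
      by (intro mult_left_mono) auto
    then have "exp (1 - 1 / w) \<le> (fact (k + 2) * exp 1 * w\<^sup>2) * w ^ k"
      by (simp add: exp_add[symmetric] power_add power2_eq_square mult_ac del: fact_Suc)
    then have e: "exp (1 - 1 / w) / w ^ k \<le> fact (k + 2) * exp 1 * w\<^sup>2"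
      using w by (subst pos_divide_le_eq) auto
    have "\<bar>bump_fun p k x\<bar> = \<bar>poly p x\<bar> * (exp (1 - 1 / w) / w ^ k)"
      using x w by (simp add: bump_fun_def w_def[symmetric] abs_mult abs_divide)
    also have "\<dots> \<le> B * (fact (k + 2) * exp 1 * w\<^sup>2)"
      using B0 x w by (intro mult_mono B e) auto
    finally show ?thesis by (simp add: w_def mult.assoc)
  qed
  moreover have "0 \<le> ?M" using B0 by simp
  ultimately show ?thesis using that by blast
qed

lemma bump_fun_deriv: "(bump_fun p k has_real_derivative bump_fun (bump_step p k) (k + 2) x) (at x)"
proof -
  consider "\<bar>x\<bar> < 1" | "\<bar>x\<bar> > 1" | "\<bar>x\<bar> = 1" by linarith
  then show ?thesis
  proof cases
    case 1
    define w where "w = 1 - x\<^sup>2"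
    have w: "w > 0" using 1 by (simp add: w_def abs_square_less_1)
    have dw: "((\<lambda>x. 1 - x\<^sup>2) has_real_derivative - 2 * x) (at x)"
      by (auto intro!: derivative_eq_intros)
    have w0: "1 - x\<^sup>2 \<noteq> 0" "(1 - x\<^sup>2) ^ k \<noteq> 0" using w by (auto simp: w_def)
    have "((\<lambda>x. poly p x / (1 - x\<^sup>2) ^ k * exp (1 - 1 / (1 - x\<^sup>2))) has_real_derivative bump_fun (bump_step p k) (k + 2) x) (at x)"
    proof (rule DERIV_cong[OF DERIV_mult[OF DERIV_divide[OF poly_DERIV DERIV_power[OF dw] w0(2)]
          DERIV_chain2[OF DERIV_exp DERIV_diff[OF DERIV_const DERIV_divide[OF DERIV_const dw w0(1)]]]]])
      have "poly (bump_step p k) x = poly (pderiv p) x * w\<^sup>2 + 2 * real k * (x * poly p x * w) - 2 * (x * poly p x)"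
        by (simp add: bump_step_def w_def power2_eq_square algebra_simps)
      \<comment> \<open>The subtraction is truncated: for k = 0 the exponent is 0, and the factor
        \<open>real k\<close> makes both sides vanish.\<close>
      moreover have "real k * (- 2 * x * w ^ (k - Suc 0)) = - 2 * x * real k * w ^ k / w" using w by (cases k) auto
      moreover have "(p' * W - pp * (- 2 * x * real k * W / w)) / (W * W) * e + e * (0 - (0 * w - 1 * (- 2 * x)) / (w * w)) * (pp / W)
          = (p' * w\<^sup>2 + 2 * real k * (x * pp * w) - 2 * (x * pp)) / (W * w\<^sup>2) * e" if "W \<noteq> 0" for p' pp W e :: real
        using that w by (simp add: field_simps power2_eq_square)
      ultimately show "(poly (pderiv p) x * (1 - x\<^sup>2) ^ k - poly p x * (real k * (- 2 * x * (1 - x\<^sup>2) ^ (k - Suc 0)))) / ((1 - x\<^sup>2) ^ k * (1 - x\<^sup>2) ^ k) * exp (1 - 1 / (1 - x\<^sup>2)) +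
        exp (1 - 1 / (1 - x\<^sup>2)) * (0 - (0 * (1 - x\<^sup>2) - 1 * (- 2 * x)) / ((1 - x\<^sup>2) * (1 - x\<^sup>2))) * (poly p x / (1 - x\<^sup>2) ^ k) = bump_fun (bump_step p k) (k + 2) x"
        unfolding w_def[symmetric] bump_fun_def using 1 w by (simp only: if_True power_add power_not_zero) simp
    qed
    then show ?thesis
      by (rule has_field_derivative_transform_within_open[where S = "{-1<..<1}"]) (use 1 in \<open>auto simp: bump_fun_def\<close>)
  next
    case 2
    have "((\<lambda>x. 0) has_real_derivative bump_fun (bump_step p k) (k + 2) x) (at x)"
      using 2 by (simp add: bump_fun_def)
    then show ?thesis
      by (rule has_field_derivative_transform_within_open[where S = "{..<-1} \<union> {1<..}"]) (use 2 in \<open>auto simp: bump_fun_def\<close>)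
  next
    case 3
    obtain M where M: "M \<ge> 0" "\<And>x. \<bar>x\<bar> < 1 \<Longrightarrow> \<bar>bump_fun p k x\<bar> \<le> M * (1 - x\<^sup>2)\<^sup>2" using bump_fun_bound by blast
    \<comment> \<open>The decay of order (1 - y^2)^2 with 1 - y^2 \<le> 2 |y - x|, for x = 1 or x =
      -1, gives a quadratic bound around x and hence derivative 0 there.\<close>
    have q: "\<bar>bump_fun p k y\<bar> \<le> 4 * M * (y - x)\<^sup>2" for y
    proof (cases "\<bar>y\<bar> < 1")
      case True
      have "0 \<le> 1 - y\<^sup>2" "1 - y\<^sup>2 \<le> 2 * \<bar>y - x\<bar>"
      proof -
        show "0 \<le> 1 - y\<^sup>2" using True by (simp add: abs_square_le_1)
        have "x = 1 \<or> x = -1" using 3 by linarith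
        then show "1 - y\<^sup>2 \<le> 2 * \<bar>y - x\<bar>"
        proof
          assume "x = 1"
          have "1 - y\<^sup>2 = (1 + y) * (1 - y)" by (simp add: power2_eq_square algebra_simps)
          also have "\<dots> \<le> 2 * (1 - y)" using True by (intro mult_right_mono) auto
          finally show ?thesis using \<open>x = 1\<close> True by simp
        next
          assume "x = -1"
          have "1 - y\<^sup>2 = (1 - y) * (1 + y)" by (simp add: power2_eq_square algebra_simps)
          also have "\<dots> \<le> 2 * (1 + y)" using True by (intro mult_right_mono) auto
          finally show ?thesis using \<open>x = -1\<close> True by simp
        qed
      qed
      then have "(1 - y\<^sup>2)\<^sup>2 \<le> (2 * \<bar>y - x\<bar>)\<^sup>2" by (intro power_mono)
      then have "M * (1 - y\<^sup>2)\<^sup>2 \<le> M * (4 * (y - x)\<^sup>2)" using M(1) by (intro mult_left_mono) (auto simp: power_mult_distrib)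
      with M(2)[OF True] show ?thesis by simp
    qed (use M(1) in \<open>simp add: bump_fun_def\<close>)
    have "((\<lambda>y. (bump_fun p k y - bump_fun p k x) / (y - x)) \<longlongrightarrow> 0) (at x)"
    proof (rule Lim_null_comparison[where g = "\<lambda>y. 4 * M * \<bar>y - x\<bar>"])
      show "\<forall>\<^sub>F y in at x. norm ((bump_fun p k y - bump_fun p k x) / (y - x)) \<le> 4 * M * \<bar>y - x\<bar>"
      proof (rule eventually_at_filter[THEN iffD2], intro always_eventually allI impI)
        fix y assume "y \<noteq> x"
        then show "norm ((bump_fun p k y - bump_fun p k x) / (y - x)) \<le> 4 * M * \<bar>y - x\<bar>"
          using q[of y] 3 by (simp add: bump_fun_def[of p k x] abs_divide divide_simps power2_eq_square[of "y - x"] abs_mult_self_eq mult.assoc)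
      qed
      show "((\<lambda>y. 4 * M * \<bar>y - x\<bar>) \<longlongrightarrow> 0) (at x)"
        by (auto intro!: tendsto_eq_intros)
    qed
    then show ?thesis using 3 by (simp add: has_field_derivative_iff bump_fun_def[of _ _ x])
  qed
qed

text \<open>Numerator and pole order of the n-th derivative of the bump.\<close>

primrec bump_state :: "nat \<Rightarrow> real poly \<times> nat" where
  "bump_state 0 = (1, 0)"
| "bump_state (Suc n) = (bump_step (fst (bump_state n)) (snd (bump_state n)), snd (bump_state n) + 2)"

definition bump_deriv :: "nat \<Rightarrow> real \<Rightarrow> real" where
  "bump_deriv n = bump_fun (fst (bump_state n)) (snd (bump_state n))"

lemma bump_deriv_deriv: "(bump_deriv n has_real_derivative bump_deriv (Suc n) x) (at x)"
  using bump_fun_deriv[of "fst (bump_state n)" "snd (bump_state n)" x] by (simp add: bump_deriv_def)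

lemma bump_deriv_outside: "1 \<le> \<bar>x\<bar> \<Longrightarrow> bump_deriv n x = 0"
  by (simp add: bump_deriv_def bump_fun_def)

lemma bump_deriv_bounded: "\<exists>M\<ge>0. \<forall>x. \<bar>bump_deriv n x\<bar> \<le> M"
proof -
  obtain M where M: "M \<ge> 0" "\<And>x. \<bar>x\<bar> < 1 \<Longrightarrow> \<bar>bump_deriv n x\<bar> \<le> M * (1 - x\<^sup>2)\<^sup>2"
    unfolding bump_deriv_def using bump_fun_bound by blast
  have "\<bar>bump_deriv n x\<bar> \<le> M" for x
  proof (cases "\<bar>x\<bar> < 1")
    case True
    have "(1 - x\<^sup>2)\<^sup>2 \<le> 1\<^sup>2" using True by (intro power_mono) (auto simp: abs_square_le_1)
    then have "M * (1 - x\<^sup>2)\<^sup>2 \<le> M * 1" using M(1) by (intro mult_left_mono) auto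
    with M(2)[OF True] show ?thesis by simp
  qed (use M(1) in \<open>simp add: bump_deriv_outside\<close>)
  with M(1) show ?thesis by blast
qed

lemma bump_deriv_0: "0 \<le> bump_deriv 0 x" "bump_deriv 0 x \<le> 1" "bump_deriv 0 0 = 1"
proof -
  have "1 \<le> 1 / (1 - x\<^sup>2)" if "\<bar>x\<bar> < 1"
    using that abs_square_less_1[of x] by (simp add: pos_le_divide_eq)
  then show "0 \<le> bump_deriv 0 x" "bump_deriv 0 x \<le> 1" "bump_deriv 0 0 = 1"
    by (auto simp: bump_deriv_def bump_fun_def)
qed

text \<open>One order of differentiation per coordinate, so that a partial derivative merely raises
  one index and smoothness follows by coinduction over all \<open>m\<close>.\<close>

definition bump_prod :: "('n::finite \<Rightarrow> nat) \<Rightarrow> real ^ 'n \<Rightarrow> real" where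
  "bump_prod m x = (\<Prod>i\<in>UNIV. bump_deriv (m i) (x $ i))"

definition bump :: "real ^ 'n \<Rightarrow> real" where
  "bump = bump_prod (\<lambda>_. 0)"

lemma bump_prod_has_derivative:
  "(bump_prod m has_derivative (\<lambda>h. \<Sum>i\<in>UNIV. bump_prod (m(i := Suc (m i))) x * h $ i)) (at x)" for x :: "real ^ 'n"
proof -
  have "((\<lambda>x :: real ^ 'n. bump_deriv (m i) (x $ i)) has_derivative (\<lambda>h. h $ i * bump_deriv (Suc (m i)) (x $ i))) (at x)" for i
  proof -
    have "((\<lambda>x :: real ^ 'n. x $ i) has_derivative (\<lambda>h. h $ i)) (at x)"
      by (rule bounded_linear.has_derivative[OF bounded_linear_vec_nth has_derivative_ident])
    from has_derivative_compose[OF this bump_deriv_deriv[unfolded has_field_derivative_def]]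
    show ?thesis by (simp add: mult.commute)
  qed
  then have "((\<lambda>x. \<Prod>i\<in>UNIV. bump_deriv (m i) (x $ i)) has_derivative
      (\<lambda>h. \<Sum>i\<in>UNIV. (h $ i * bump_deriv (Suc (m i)) (x $ i)) * (\<Prod>j\<in>UNIV - {i}. bump_deriv (m j) (x $ j)))) (at x)"
    by (rule has_derivative_prod)
  moreover have "(h $ i * bump_deriv (Suc (m i)) (x $ i)) * (\<Prod>j\<in>UNIV - {i}. bump_deriv (m j) (x $ j))
      = bump_prod (m(i := Suc (m i))) x * h $ i" for h :: "real ^ 'n" and i
    unfolding bump_prod_def by (subst (2) prod.remove[of _ i]) (auto intro!: prod.cong)
  ultimately show ?thesis
    unfolding bump_prod_def[abs_def] by simp
qed

lemma bump_prod_bsmooth: "bsmooth (bump_prod m)"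
proof (rule bsmooth_coinduct[where X = "\<lambda>f. \<exists>m. f = bump_prod m"])
  fix f :: "real ^ 'a \<Rightarrow> real" assume "\<exists>m. f = bump_prod m"
  then obtain m where f: "f = bump_prod m" by blast
  obtain M where M: "\<And>n. 0 \<le> M n" "\<And>n x. \<bar>bump_deriv n x\<bar> \<le> M n" using bump_deriv_bounded by metis
  have "\<bar>f x\<bar> \<le> (\<Prod>i\<in>UNIV. M (m i))" for x
    unfolding f bump_prod_def abs_prod by (intro prod_mono) (auto intro: M)
  then show "\<exists>M. \<forall>x. \<bar>f x\<bar> \<le> M" by blast
  show "\<exists>G. (\<forall>i. \<exists>m. G i = bump_prod m) \<and> (\<forall>x. (f has_derivative (\<lambda>h. \<Sum>i\<in>UNIV. G i x * h $ i)) (at x))"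
    unfolding f by (intro exI[of _ "\<lambda>i. bump_prod (m(i := Suc (m i)))"]) (use bump_prod_has_derivative in blast)
qed blast

lemma bump: "bsmooth bump" "0 \<le> bump x" "bump x \<le> 1" "bump 0 = 1"
  unfolding bump_def bump_prod_def[of _ x] bump_prod_def[of _ 0]
  by (auto intro!: bump_prod_bsmooth prod_nonneg prod_le_1 bump_deriv_0 simp: bump_deriv_0)

text \<open>The support lies in a cube, whose points have l1 norm at most n. The radius is crude,
  but only its scaling with r and R matters later.\<close>

lemma bump_support:
  fixes x :: "real ^ 'n"
  assumes "bump x \<noteq> 0" shows "norm x \<le> CARD('n)"
proof -
  have "\<bar>x $ i\<bar> \<le> 1" for i
  proof (rule ccontr)
    assume "\<not> \<bar>x $ i\<bar> \<le> 1"
    then have "bump x = 0" unfolding bump_def bump_prod_def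
      by (intro prod_zero) (auto intro!: exI[of _ i] bump_deriv_outside)
    with assms show False by simp
  qed
  then have "(\<Sum>i\<in>UNIV. \<bar>x $ i\<bar>) \<le> (\<Sum>i\<in>(UNIV :: 'n set). 1)" by (intro sum_mono)
  with norm_le_l1_cart[of x] show ?thesis by simp
qed

text \<open>The averaging results for a shift that does not depend on the integration variable,
  where averaging over a probability measure changes nothing.\<close>

lemma bsmooth_affine:
  assumes "bsmooth f" shows "bsmooth (\<lambda>x. f (c *\<^sub>R x + z))"
    and "partial_deriv i (\<lambda>x. f (c *\<^sub>R x + z)) x = c * partial_deriv i f (c *\<^sub>R x + z)"
  using bsmooth_average[OF assms, of gaussian "\<lambda>_. 1" "\<lambda>_. z" c]
    partial_deriv_average[OF assms, of gaussian "\<lambda>_. 1" "\<lambda>_. z" i c x]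
  by simp_all

section \<open>Mollifiers and convolution\<close>

text \<open>The parameter is an inverse radius: the support shrinks like n/r, and limits are taken
  as r grows.\<close>

definition mol :: "real \<Rightarrow> real ^ 'n \<Rightarrow> real" where
  "mol r x = bump (r *\<^sub>R x) / (\<integral>y. bump (r *\<^sub>R y :: real ^ 'n) \<partial>lborel)"

lemma integrable_bounded_support:
  fixes f :: "'a::euclidean_space \<Rightarrow> real"
  assumes [measurable]: "f \<in> borel_measurable borel" and M: "\<And>x. \<bar>f x\<bar> \<le> M" and R: "\<And>x. f x \<noteq> 0 \<Longrightarrow> norm x \<le> R"
  shows "integrable lborel f"
proof (rule Bochner_Integration.integrable_bound)
  show "integrable lborel (\<lambda>x :: 'a. M * indicator (cball 0 R) x)"
    using emeasure_lborel_cball_finite[of "0 :: 'a" R] by (intro integrable_mult_right integrable_real_indicator) auto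
  show "AE x in lborel. norm (f x) \<le> norm (M * indicator (cball 0 R) x)"
  proof (rule AE_I2)
    fix x show "norm (f x) \<le> norm (M * indicator (cball 0 R) x)"
      using M[of x] R[of x] by (cases "f x = 0") auto
  qed
qed simp

lemma bump_scaled:
  assumes r: "0 < r"
  shows "bsmooth (\<lambda>x :: real ^ 'n. bump (r *\<^sub>R x))"
    and "\<And>x :: real ^ 'n. bump (r *\<^sub>R x) \<noteq> 0 \<Longrightarrow> norm x \<le> CARD('n) / r"
    and "integrable lborel (\<lambda>x :: real ^ 'n. bump (r *\<^sub>R x))"
    and "0 < (\<integral>x. bump (r *\<^sub>R x :: real ^ 'n) \<partial>lborel)"
proof -
  show s: "bsmooth (\<lambda>x :: real ^ 'n. bump (r *\<^sub>R x))"
    using bsmooth_affine(1)[OF bump(1), of r 0] by simp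
  show sup: "norm x \<le> CARD('n) / r" if "bump (r *\<^sub>R x) \<noteq> 0" for x :: "real ^ 'n"
    using bump_support[OF that] r by (simp add: pos_le_divide_eq mult.commute)
  show i: "integrable lborel (\<lambda>x :: real ^ 'n. bump (r *\<^sub>R x))"
  proof (rule integrable_bounded_support[where M = 1 and R = "CARD('n) / r"])
    show "\<bar>bump (r *\<^sub>R x)\<bar> \<le> 1" for x :: "real ^ 'n"
      using bump(2,3)[of "r *\<^sub>R x"] by linarith
  qed (use bsmooth_borel_measurable[OF s] sup in auto)
  \<comment> \<open>For the positivity of the normalising integral: by continuity the bump exceeds
    1/2 on a ball around the origin.\<close>
  have "continuous_on UNIV (\<lambda>x :: real ^ 'n. bump (r *\<^sub>R x))" by (rule bsmooth_continuous_on[OF s])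
  then have "isCont (\<lambda>x :: real ^ 'n. bump (r *\<^sub>R x)) 0" by (simp add: continuous_on_eq_continuous_at)
  then obtain d where d: "d > 0" "\<And>x :: real ^ 'n. norm x < d \<Longrightarrow> \<bar>bump (r *\<^sub>R x) - 1\<bar> < 1 / 2"
    unfolding continuous_at_eps_delta by (auto simp: dist_norm bump(4) dest!: spec[of _ "1 / 2"])
  have "(\<integral>(x :: real ^ 'n). (1 / 2 :: real) * indicator (ball 0 d) x \<partial>lborel) \<le> (\<integral>x. bump (r *\<^sub>R x :: real ^ 'n) \<partial>lborel)"
  proof (rule integral_mono[OF _ i])
    show "integrable lborel (\<lambda>x :: real ^ 'n. (1 / 2 :: real) * indicator (ball 0 d) x)"
      using emeasure_lborel_ball_finite[of "0 :: real ^ 'n" d] by (intro integrable_mult_right integrable_real_indicator) auto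
    show "1 / 2 * indicator (ball 0 d) x \<le> bump (r *\<^sub>R x)" for x :: "real ^ 'n"
    proof (cases "norm x < d")
      case True
      then have "\<bar>bump (r *\<^sub>R x) - 1\<bar> < 1 / 2" by (rule d(2))
      then have "1 / 2 \<le> bump (r *\<^sub>R x)" by linarith
      with True show ?thesis by simp
    qed (simp add: bump(2))
  qed
  moreover have "0 < (\<integral>(x :: real ^ 'n). (1 / 2 :: real) * indicator (ball 0 d) x \<partial>lborel)"
    using content_ball_pos[OF d(1), of "0 :: real ^ 'n"] by simp
  ultimately show "0 < (\<integral>x. bump (r *\<^sub>R x :: real ^ 'n) \<partial>lborel)" by linarith
qed

lemma mol:
  assumes r: "0 < r"
  shows "bsmooth (mol r :: real ^ 'n \<Rightarrow> real)" "0 \<le> mol r (x :: real ^ 'n)"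
    and "mol r (x :: real ^ 'n) \<noteq> 0 \<Longrightarrow> norm x \<le> CARD('n) / r"
    and "integrable lborel (mol r :: real ^ 'n \<Rightarrow> real)" "(\<integral>x. mol r (x :: real ^ 'n) \<partial>lborel) = 1"
proof -
  note b = bump_scaled[OF r, where 'n = 'n]
  have "bsmooth (\<lambda>x :: real ^ 'n. bump (r *\<^sub>R x) * (1 / (\<integral>y. bump (r *\<^sub>R y :: real ^ 'n) \<partial>lborel)))"
    by (intro bsmooth_mult b bsmooth_const)
  then show "bsmooth (mol r :: real ^ 'n \<Rightarrow> real)" by (simp add: mol_def[abs_def])
  show "0 \<le> mol r x" unfolding mol_def by (intro divide_nonneg_pos b(4) bump(2))
  show "norm x \<le> CARD('n) / r" if "mol r x \<noteq> 0" using that by (intro b(2)) (auto simp: mol_def)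
  show "integrable lborel (mol r :: real ^ 'n \<Rightarrow> real)" using b(3) by (simp add: mol_def[abs_def])
  show "(\<integral>x. mol r (x :: real ^ 'n) \<partial>lborel) = 1" using b(4) by (simp add: mol_def[abs_def])
qed

definition moll :: "real \<Rightarrow> (real ^ 'n \<Rightarrow> real) \<Rightarrow> real ^ 'n \<Rightarrow> real" where
  "moll r b x = (\<integral>y. b y * mol r (x - y) \<partial>lborel)"

lemma bsmooth_moll:
  assumes "0 < r" "integrable lborel b"
  shows "bsmooth (moll r b)" "partial_deriv i (moll r b) x = (\<integral>y. b y * partial_deriv i (mol r) (x - y) \<partial>lborel)"
  using bsmooth_average[OF mol(1)[OF assms(1)] assms(2), of uminus 1]
    partial_deriv_average[OF mol(1)[OF assms(1)] assms(2), of uminus i 1 x]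
  by (simp_all add: moll_def[abs_def])

lemma moll_integrable:
  fixes b :: "real ^ 'n \<Rightarrow> real"
  assumes r: "0 < r" and b: "integrable lborel b"
  shows "integrable lborel (\<lambda>y. b y * mol r (x - y))" "integrable lborel (\<lambda>z. mol r z * b (x - z))"
    "moll r b x = (\<integral>z. mol r z * b (x - z) \<partial>lborel)"
proof -
  have bm [measurable]: "b \<in> borel_measurable borel" using borel_measurable_integrable[OF b] by simp
  have mm [measurable]: "(mol r :: real ^ 'n \<Rightarrow> real) \<in> borel_measurable borel" by (rule bsmooth_borel_measurable[OF mol(1)[OF r]])
  obtain M where M: "M > 0" "\<And>x :: real ^ 'n. \<bar>mol r x\<bar> \<le> M" using bsmooth_bounded_pos[OF mol(1)[OF r]] by blast
  show i: "integrable lborel (\<lambda>y. b y * mol r (x - y))"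
  proof (rule Bochner_Integration.integrable_bound)
    show "integrable lborel (\<lambda>y. M * b y)" using b by simp
    show "AE y in lborel. norm (b y * mol r (x - y)) \<le> norm (M * b y)"
    proof (rule AE_I2)
      fix y
      have "\<bar>b y\<bar> * \<bar>mol r (x - y)\<bar> \<le> \<bar>b y\<bar> * M" by (intro mult_left_mono M) auto
      then show "norm (b y * mol r (x - y)) \<le> norm (M * b y)" using M(1) by (simp add: abs_mult mult.commute)
    qed
  qed simp
  have l: "lborel = distr lborel borel (\<lambda>z :: real ^ 'n. x - z)"
    by (rule lborel_distr_reflect[symmetric])
  have "integrable (distr lborel borel (\<lambda>z :: real ^ 'n. x - z)) (\<lambda>y. b y * mol r (x - y))"
    using i l by simp
  then show "integrable lborel (\<lambda>z. mol r z * b (x - z))" by (simp add: integrable_distr_eq mult.commute)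
  have "moll r b x = (\<integral>y. b y * mol r (x - y) \<partial>distr lborel borel (\<lambda>z. x - z))"
    unfolding moll_def using l by simp
  also have "\<dots> = (\<integral>z. mol r z * b (x - z) \<partial>lborel)"
    by (subst integral_distr) (simp_all add: mult.commute)
  finally show "moll r b x = (\<integral>z. mol r z * b (x - z) \<partial>lborel)" .
qed

text \<open>Both \<open>L\<^sup>1\<close> and \<open>L\<^sup>2\<close> convergence of mollifications follow from this averaging principle, with
  \<open>d x z = |b (x - z) - b x|\<close> or its square.\<close>

lemma moll_average_bound:
  fixes d :: "real ^ 'n \<Rightarrow> real ^ 'n \<Rightarrow> real"
  assumes r: "0 < r" and [measurable]: "(\<lambda>(x, z). d x z) \<in> borel_measurable (borel \<Otimes>\<^sub>M borel)"
    and [measurable]: "f \<in> borel_measurable borel"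
    and d0: "\<And>x z. 0 \<le> d x z"
    and f: "\<And>x. ennreal (f x) \<le> (\<integral>\<^sup>+z. ennreal (mol r z * d x z) \<partial>lborel)"
    and e: "\<And>z. norm z \<le> CARD('n) / r \<Longrightarrow> (\<integral>\<^sup>+x. ennreal (d x z) \<partial>lborel) \<le> ennreal \<epsilon>" and \<epsilon>: "0 \<le> \<epsilon>"
  shows "(\<integral>\<^sup>+x. ennreal (f x) \<partial>lborel) \<le> ennreal \<epsilon>"
proof -
  have mm [measurable]: "(mol r :: real ^ 'n \<Rightarrow> real) \<in> borel_measurable borel" by (rule bsmooth_borel_measurable[OF mol(1)[OF r]])
  have "(\<integral>\<^sup>+x. ennreal (f x) \<partial>lborel) \<le> (\<integral>\<^sup>+x. (\<integral>\<^sup>+z. ennreal (mol r z * d x z) \<partial>lborel) \<partial>lborel)"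
    by (intro nn_integral_mono f)
  also have "\<dots> = (\<integral>\<^sup>+z. (\<integral>\<^sup>+x. ennreal (mol r z * d x z) \<partial>lborel) \<partial>lborel)"
    by (rule lborel_pair.Fubini') simp
  also have "\<dots> \<le> (\<integral>\<^sup>+(z :: real ^ 'n). ennreal (mol r z) * ennreal \<epsilon> \<partial>lborel)"
  proof (rule nn_integral_mono)
    fix z
    have "(\<integral>\<^sup>+x. ennreal (mol r z * d x z) \<partial>lborel) = ennreal (mol r z) * (\<integral>\<^sup>+x. ennreal (d x z) \<partial>lborel)"
      using mol(2)[OF r, where 'n = 'n] d0 by (subst nn_integral_cmult[symmetric]) (auto simp: ennreal_mult)
    also have "\<dots> \<le> ennreal (mol r z) * ennreal \<epsilon>"
      using mol(3)[OF r, of z] e[of z] by (cases "mol r z = 0") (auto intro!: mult_left_mono)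
    finally show "(\<integral>\<^sup>+x. ennreal (mol r z * d x z) \<partial>lborel) \<le> ennreal (mol r z) * ennreal \<epsilon>" .
  qed
  also have "\<dots> = (\<integral>\<^sup>+z. ennreal (mol r (z :: real ^ 'n)) \<partial>lborel) * ennreal \<epsilon>"
    by (rule nn_integral_multc) simp
  also have "(\<integral>\<^sup>+z. ennreal (mol r (z :: real ^ 'n)) \<partial>lborel) = 1"
    using mol(4,5)[OF r, where 'n = 'n] mol(2)[OF r, where 'n = 'n] by (subst nn_integral_eq_integral) auto
  finally show ?thesis by simp
qed

lemma moll_diff:
  fixes b :: "real ^ 'n \<Rightarrow> real"
  assumes r: "0 < r" and b: "integrable lborel b"
  shows "moll r b x - b x = (\<integral>z. mol r z * (b (x - z) - b x) \<partial>lborel)"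
    and "integrable lborel (\<lambda>z. mol r z * (b (x - z) - b x))"
proof -
  note i = moll_integrable[OF r b, of x]
  have i2: "integrable lborel (\<lambda>z :: real ^ 'n. mol r z * b x)" by (intro integrable_mult_left mol r)
  show "integrable lborel (\<lambda>z. mol r z * (b (x - z) - b x))"
    unfolding right_diff_distrib by (intro Bochner_Integration.integrable_diff i i2)
  have "(\<integral>(z :: real ^ 'n). mol r z * b x \<partial>lborel) = b x" using mol(5)[OF r, where 'n = 'n] by simp
  then show "moll r b x - b x = (\<integral>z. mol r z * (b (x - z) - b x) \<partial>lborel)"
    unfolding right_diff_distrib i(3) by (subst Bochner_Integration.integral_diff[OF i(2) i2]) simp
qed

text \<open>The factor 2 in the threshold makes the second inequality strict, as the translation
  estimates require.\<close>

lemma mollifier_radius: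
  assumes "0 < \<delta>" "2 * CARD('n) / \<delta> \<le> r" shows "0 < r" "CARD('n::finite) / r < \<delta>"
proof -
  have "0 < 2 * CARD('n) / \<delta>" using assms(1) by simp
  then show r: "0 < r" using assms(2) by linarith
  have "real CARD('n) < 2 * CARD('n)" by simp
  also have "\<dots> \<le> \<delta> * r" using assms by (simp add: pos_divide_le_eq mult.commute)
  finally show "CARD('n) / r < \<delta>" using r by (simp add: pos_divide_less_eq)
qed

lemma moll_L1:
  fixes b :: "real ^ 'n \<Rightarrow> real"
  assumes b: "integrable lborel b" and \<epsilon>: "0 < \<epsilon>"
  obtains r0 where "0 < r0" "\<And>r. r0 \<le> r \<Longrightarrow> (\<integral>\<^sup>+x. ennreal \<bar>moll r b x - b x\<bar> \<partial>lborel) \<le> ennreal \<epsilon>"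
proof -
  obtain \<delta> where \<delta>: "0 < \<delta>" "\<And>z. norm z < \<delta> \<Longrightarrow> (\<integral>x. \<bar>b (x - z) - b x\<bar> \<partial>lborel) < \<epsilon>"
    using L1_translation[OF b \<epsilon>] by blast
  have [measurable]: "b \<in> borel_measurable borel" using borel_measurable_integrable[OF b] by simp
  show ?thesis
  proof (rule that[of "2 * CARD('n) / \<delta>"])
    fix r assume r: "2 * CARD('n) / \<delta> \<le> r"
    note r0 = mollifier_radius(1)[OF \<delta>(1) r] and rr = mollifier_radius(2)[OF \<delta>(1) r]

    have [measurable]: "moll r b \<in> borel_measurable borel" by (rule bsmooth_borel_measurable[OF bsmooth_moll(1)[OF r0 b]])
    show "(\<integral>\<^sup>+x. ennreal \<bar>moll r b x - b x\<bar> \<partial>lborel) \<le> ennreal \<epsilon>"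
    proof (rule moll_average_bound[OF r0, where d = "\<lambda>x z. \<bar>b (x - z) - b x\<bar>"])
      fix x
      have "\<bar>moll r b x - b x\<bar> \<le> (\<integral>z. mol r z * \<bar>b (x - z) - b x\<bar> \<partial>lborel)"
        unfolding moll_diff[OF r0 b] by (rule order_trans[OF integral_abs_bound]) (simp add: abs_mult mol(2)[OF r0, where 'n = 'n])
      then have "ennreal \<bar>moll r b x - b x\<bar> \<le> ennreal (\<integral>z. mol r z * \<bar>b (x - z) - b x\<bar> \<partial>lborel)"
        by (rule ennreal_leI)
      also have "\<dots> = (\<integral>\<^sup>+z. ennreal (mol r z * \<bar>b (x - z) - b x\<bar>) \<partial>lborel)"
        using integrable_abs[OF moll_diff(2)[OF r0 b, of x]]
        by (subst nn_integral_eq_integral) (auto simp: abs_mult mol(2)[OF r0, where 'n = 'n])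
      finally show "ennreal \<bar>moll r b x - b x\<bar> \<le> (\<integral>\<^sup>+z. ennreal (mol r z * \<bar>b (x - z) - b x\<bar>) \<partial>lborel)" .
    next
      fix z :: "real ^ 'n" assume "norm z \<le> CARD('n) / r"
      then have "norm z < \<delta>" using rr by simp
      then have "(\<integral>x. \<bar>b (x - z) - b x\<bar> \<partial>lborel) \<le> \<epsilon>" using \<delta>(2) by (intro less_imp_le)
      then show "(\<integral>\<^sup>+x. ennreal \<bar>b (x - z) - b x\<bar> \<partial>lborel) \<le> ennreal \<epsilon>"
        using lborel_integrable_translate[OF b, of z] b by (subst nn_integral_eq_integral) (auto intro: ennreal_leI)
    qed (use \<epsilon> in auto)
  qed (use \<delta> in simp)
qed

text \<open>For nonnegative s and t one has (s - t)^2 \<le> |s^2 - t^2|, so L2 continuity of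
  translations for b is L1 continuity for b^2.\<close>

lemma L2_translation_nonneg:
  fixes b :: "'a::euclidean_space \<Rightarrow> real"
  assumes b: "integrable lborel (\<lambda>x. (b x)\<^sup>2)" and [measurable]: "b \<in> borel_measurable borel" and b0: "\<And>x. 0 \<le> b x" and \<epsilon>: "0 < \<epsilon>"
  obtains \<delta> where "0 < \<delta>" "\<And>z. norm z < \<delta> \<Longrightarrow> (\<integral>\<^sup>+x. ennreal ((b (x - z) - b x)\<^sup>2) \<partial>lborel) \<le> ennreal \<epsilon>"
proof -
  obtain \<delta> where \<delta>: "0 < \<delta>" "\<And>z. norm z < \<delta> \<Longrightarrow> (\<integral>x. \<bar>(b (x - z))\<^sup>2 - (b x)\<^sup>2\<bar> \<partial>lborel) < \<epsilon>"
    using L1_translation[OF b \<epsilon>] by blast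
  have sq: "(s - t)\<^sup>2 \<le> \<bar>s\<^sup>2 - t\<^sup>2\<bar>" if "0 \<le> s" "0 \<le> t" for s t :: real
  proof -
    have "(s - t)\<^sup>2 = \<bar>s - t\<bar> * \<bar>s - t\<bar>" by (simp add: power2_eq_square)
    also have "\<dots> \<le> \<bar>s - t\<bar> * \<bar>s + t\<bar>" using that by (intro mult_left_mono) auto
    also have "\<dots> = \<bar>s\<^sup>2 - t\<^sup>2\<bar>" by (simp add: abs_mult[symmetric] power2_eq_square algebra_simps)
    finally show ?thesis .
  qed
  have "(\<integral>\<^sup>+x. ennreal ((b (x - z) - b x)\<^sup>2) \<partial>lborel) \<le> ennreal \<epsilon>" if "norm z < \<delta>" for z
  proof -
    have "(\<integral>\<^sup>+x. ennreal ((b (x - z) - b x)\<^sup>2) \<partial>lborel) \<le> (\<integral>\<^sup>+x. ennreal \<bar>(b (x - z))\<^sup>2 - (b x)\<^sup>2\<bar> \<partial>lborel)"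
      by (intro nn_integral_mono ennreal_leI sq b0)
    also have "\<dots> = ennreal (\<integral>x. \<bar>(b (x - z))\<^sup>2 - (b x)\<^sup>2\<bar> \<partial>lborel)"
      using lborel_integrable_translate[OF b, of z] b by (subst nn_integral_eq_integral) auto
    also have "\<dots> \<le> ennreal \<epsilon>" using \<delta>(2)[OF that] by (intro ennreal_leI) simp
    finally show ?thesis .
  qed
  then show ?thesis using that \<delta>(1) by blast
qed

text \<open>Splitting b into positive and negative part reduces to the nonnegative case; each part
  gets \<epsilon>/4 because squaring a sum costs a factor 2.\<close>

lemma moll_L2:
  fixes b :: "real ^ 'n \<Rightarrow> real"
  assumes b: "integrable lborel b" and b2: "integrable lborel (\<lambda>x. (b x)\<^sup>2)" and \<epsilon>: "0 < \<epsilon>"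
  obtains r0 where "0 < r0" "\<And>r. r0 \<le> r \<Longrightarrow> (\<integral>\<^sup>+x. ennreal ((moll r b x - b x)\<^sup>2) \<partial>lborel) \<le> ennreal \<epsilon>"
proof -
  have bm [measurable]: "b \<in> borel_measurable borel" using borel_measurable_integrable[OF b] by simp
  let ?p = "\<lambda>x. max 0 (b x)" and ?q = "\<lambda>x. max 0 (- b x)"
  have p2: "integrable lborel (\<lambda>x. (?p x)\<^sup>2)" "integrable lborel (\<lambda>x. (?q x)\<^sup>2)"
    by (rule Bochner_Integration.integrable_bound[OF b2]; auto simp: max_def)+
  have \<epsilon>4: "0 < \<epsilon> / 4" using \<epsilon> by simp
  obtain \<delta>1 where \<delta>1: "0 < \<delta>1" "\<And>z. norm z < \<delta>1 \<Longrightarrow> (\<integral>\<^sup>+x. ennreal ((?p (x - z) - ?p x)\<^sup>2) \<partial>lborel) \<le> ennreal (\<epsilon> / 4)"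
    by (rule L2_translation_nonneg[OF p2(1) _ _ \<epsilon>4]) auto
  obtain \<delta>2 where \<delta>2: "0 < \<delta>2" "\<And>z. norm z < \<delta>2 \<Longrightarrow> (\<integral>\<^sup>+x. ennreal ((?q (x - z) - ?q x)\<^sup>2) \<partial>lborel) \<le> ennreal (\<epsilon> / 4)"
    by (rule L2_translation_nonneg[OF p2(2) _ _ \<epsilon>4]) auto
  define \<delta> where "\<delta> = min \<delta>1 \<delta>2"
  have \<delta>0: "0 < \<delta>" using \<delta>1 \<delta>2 by (simp add: \<delta>_def)
  have tr: "(\<integral>\<^sup>+x. ennreal ((b (x - z) - b x)\<^sup>2) \<partial>lborel) \<le> ennreal \<epsilon>" if z: "norm z < \<delta>" for z
  proof -
    have pt: "(b (x - z) - b x)\<^sup>2 \<le> 2 * (?p (x - z) - ?p x)\<^sup>2 + 2 * (?q (x - z) - ?q x)\<^sup>2" for x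
    proof -
      have "b (x - z) - b x = (?p (x - z) - ?p x) - (?q (x - z) - ?q x)" by (simp add: max_def)
      moreover have "(s - t)\<^sup>2 \<le> 2 * s\<^sup>2 + 2 * t\<^sup>2" for s t :: real
        using zero_le_power2[of "s + t"] by (simp add: power2_eq_square algebra_simps)
      ultimately show ?thesis by metis
    qed
    have "(\<integral>\<^sup>+x. ennreal ((b (x - z) - b x)\<^sup>2) \<partial>lborel)
        \<le> (\<integral>\<^sup>+x. 2 * ennreal ((?p (x - z) - ?p x)\<^sup>2) + 2 * ennreal ((?q (x - z) - ?q x)\<^sup>2) \<partial>lborel)"
    proof (rule nn_integral_mono)
      fix x
      have "ennreal ((b (x - z) - b x)\<^sup>2) \<le> ennreal (2 * (?p (x - z) - ?p x)\<^sup>2 + 2 * (?q (x - z) - ?q x)\<^sup>2)"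
        by (rule ennreal_leI[OF pt])
      also have "\<dots> = 2 * ennreal ((?p (x - z) - ?p x)\<^sup>2) + 2 * ennreal ((?q (x - z) - ?q x)\<^sup>2)"
        by (simp add: ennreal_mult)
      finally show "ennreal ((b (x - z) - b x)\<^sup>2) \<le> 2 * ennreal ((?p (x - z) - ?p x)\<^sup>2) + 2 * ennreal ((?q (x - z) - ?q x)\<^sup>2)" .
    qed
    also have "\<dots> = 2 * (\<integral>\<^sup>+x. ennreal ((?p (x - z) - ?p x)\<^sup>2) \<partial>lborel) + 2 * (\<integral>\<^sup>+x. ennreal ((?q (x - z) - ?q x)\<^sup>2) \<partial>lborel)"
      by (simp add: nn_integral_add nn_integral_cmult)
    also have "\<dots> \<le> 2 * ennreal (\<epsilon> / 4) + 2 * ennreal (\<epsilon> / 4)"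
      using z by (intro add_mono mult_left_mono \<delta>1 \<delta>2) (auto simp: \<delta>_def)
    also have "\<dots> = ennreal (2 * (\<epsilon> / 4) + 2 * (\<epsilon> / 4))"
      using \<epsilon> by (simp only: ennreal_plus ennreal_mult ennreal_numeral)
    also have "\<dots> = ennreal \<epsilon>" by simp
    finally show ?thesis .
  qed
  show ?thesis
  proof (rule that[of "2 * CARD('n) / \<delta>"])
    fix r assume r: "2 * CARD('n) / \<delta> \<le> r"
    note r0 = mollifier_radius(1)[OF \<delta>0 r] and rr = mollifier_radius(2)[OF \<delta>0 r]

    have [measurable]: "moll r b \<in> borel_measurable borel" by (rule bsmooth_borel_measurable[OF bsmooth_moll(1)[OF r0 b]])
    have [measurable]: "(mol r :: real ^ 'n \<Rightarrow> real) \<in> borel_measurable borel" by (rule bsmooth_borel_measurable[OF mol(1)[OF r0]])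
    show "(\<integral>\<^sup>+x. ennreal ((moll r b x - b x)\<^sup>2) \<partial>lborel) \<le> ennreal \<epsilon>"
    proof (rule moll_average_bound[OF r0, where d = "\<lambda>x z. (b (x - z) - b x)\<^sup>2"])
      fix x
      let ?m = "moll r b x - b x"
      let ?I = "\<integral>\<^sup>+z. ennreal (mol r z * (b (x - z) - b x)\<^sup>2) \<partial>lborel"
      show "ennreal (?m\<^sup>2) \<le> ?I"
      proof (cases "?I = \<infinity>")
        case False
        then have i2: "integrable lborel (\<lambda>z. mol r z * (b (x - z) - b x)\<^sup>2)"
          using mol(2)[OF r0, where 'n = 'n] by (intro integrableI_nonneg) (auto simp: less_top)
        have i1: "integrable lborel (\<lambda>z. 2 * ?m * (mol r z * (b (x - z) - b x)) - ?m\<^sup>2 * mol r z)"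
          by (intro Bochner_Integration.integrable_diff integrable_mult_right moll_diff(2)[OF r0 b] mol(4)[OF r0])
        \<comment> \<open>Jensen's inequality for the square, proved by integrating the tangent
          bound 2 m d - m^2 \<le> d^2 against the mollifier, where m is the mean of d.\<close>
        have "?m\<^sup>2 = 2 * ?m * ?m - ?m\<^sup>2 * 1" by (simp add: power2_eq_square)
        also have "\<dots> = (\<integral>z. 2 * ?m * (mol r z * (b (x - z) - b x)) - ?m\<^sup>2 * mol r z \<partial>lborel)"
          using moll_diff[OF r0 b, of x] mol(4,5)[OF r0, where 'n = 'n]
          by (subst Bochner_Integration.integral_diff) simp_all
        also have "\<dots> \<le> (\<integral>z. mol r z * (b (x - z) - b x)\<^sup>2 \<partial>lborel)"
        proof (rule integral_mono[OF i1 i2])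
          fix z
          have "2 * m * (\<mu> * d) - m\<^sup>2 * \<mu> \<le> \<mu> * d\<^sup>2" if "0 \<le> \<mu>" for \<mu> m d :: real
          proof -
            have "0 \<le> \<mu> * (d - m)\<^sup>2" using that by simp
            then show ?thesis by (simp add: power2_eq_square algebra_simps)
          qed
          then show "2 * ?m * (mol r z * (b (x - z) - b x)) - ?m\<^sup>2 * mol r z \<le> mol r z * (b (x - z) - b x)\<^sup>2"
            using mol(2)[OF r0] by blast
        qed
        finally have "ennreal (?m\<^sup>2) \<le> ennreal (\<integral>z. mol r z * (b (x - z) - b x)\<^sup>2 \<partial>lborel)" by (rule ennreal_leI)
        also have "\<dots> = ?I" using i2 mol(2)[OF r0, where 'n = 'n] by (subst nn_integral_eq_integral) auto
        finally show ?thesis .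
      qed simp
    next
      fix z :: "real ^ 'n" assume "norm z \<le> CARD('n) / r"
      then show "(\<integral>\<^sup>+x. ennreal ((b (x - z) - b x)\<^sup>2) \<partial>lborel) \<le> ennreal \<epsilon>" using rr by (intro tr) simp
    qed (use \<epsilon> in auto)
  qed (use \<delta>0 in simp)
qed

section \<open>Weak gradients\<close>

lemma Ck_bsmooth: "bsmooth f \<Longrightarrow> Ck k f"
  by (induction k arbitrary: f) (auto intro: bsmooth_continuous_on bsmooth_differentiable bsmooth_partial_deriv)

lemma test_functionI:
  assumes "bsmooth \<phi>" and "\<And>x. \<phi> x \<noteq> 0 \<Longrightarrow> norm x \<le> R"
  shows "test_function \<phi>"
proof -
  have "{x. \<phi> x \<noteq> 0} \<subseteq> cball 0 R" using assms(2) by auto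
  then have "bounded {x. \<phi> x \<noteq> 0}" by (rule bounded_subset[OF bounded_cball])
  then show ?thesis
    unfolding test_function_def using Ck_bsmooth[OF assms(1)] by (auto simp: compact_closure)
qed

lemma test_function_support:
  assumes "test_function \<phi>"
  obtains R where "R > 0" "\<And>x. \<phi> x \<noteq> 0 \<Longrightarrow> norm x \<le> R"
proof -
  have "bounded {x. \<phi> x \<noteq> 0}" using assms by (simp add: test_function_def compact_closure)
  then show ?thesis using that unfolding bounded_pos by auto
qed

lemma partial_deriv_eq_0_outside:
  fixes \<phi> :: "real ^ 'n \<Rightarrow> real"
  assumes "\<And>x. \<phi> x \<noteq> 0 \<Longrightarrow> norm x \<le> R" and "partial_deriv i \<phi> x \<noteq> 0"
  shows "norm x \<le> R"
proof (rule ccontr)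
  assume n: "\<not> norm x \<le> R"
  have "((\<lambda>_. 0) has_derivative (\<lambda>h. \<Sum>i\<in>UNIV. 0 * h $ i)) (at x)" by simp
  then have "(\<phi> has_derivative (\<lambda>h. \<Sum>i\<in>UNIV. 0 * h $ i)) (at x)"
    by (rule has_derivative_transform_within_open[where s = "- cball 0 R"]) (use n assms(1) in force)+
  from partial_deriv_eq[OF this] assms(2) show False by simp
qed

lemma test_function_partial_deriv:
  assumes "test_function \<phi>" shows "test_function (partial_deriv i \<phi>)"
proof -
  obtain R where R: "\<And>x. \<phi> x \<noteq> 0 \<Longrightarrow> norm x \<le> R" using test_function_support[OF assms] by blast
  have "{x. partial_deriv i \<phi> x \<noteq> 0} \<subseteq> cball 0 R" using partial_deriv_eq_0_outside[OF R] by auto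
  then have "bounded {x. partial_deriv i \<phi> x \<noteq> 0}" by (rule bounded_subset[OF bounded_cball])
  moreover have "Ck k (partial_deriv i \<phi>)" for k
  proof -
    have "Ck (Suc k) \<phi>" using assms unfolding test_function_def by blast
    then show ?thesis by simp
  qed
  ultimately show ?thesis unfolding test_function_def by (auto simp: compact_closure)
qed

text \<open>Compact support bounds a test function, and its partial derivatives are test functions
  again, so the whole calculus of \<open>bsmooth\<close> becomes available.\<close>

lemma test_function_bsmooth:
  assumes "test_function \<phi>" shows "bsmooth \<phi>"
  using assms
proof (rule bsmooth_coinduct)
  fix f :: "real ^ 'a \<Rightarrow> real" assume f: "test_function f"
  have "Ck 0 f" using f unfolding test_function_def by blast
  then have c: "continuous_on UNIV f" by simp
  have "compact (closure {x. f x \<noteq> 0})" using f by (simp add: test_function_def)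
  then have "compact (f ` closure {x. f x \<noteq> 0})"
    by (intro compact_continuous_image continuous_on_subset[OF c]) auto
  then obtain M where M: "\<And>x. x \<in> closure {x. f x \<noteq> 0} \<Longrightarrow> \<bar>f x\<bar> \<le> M"
    using compact_imp_bounded bounded_iff by (metis image_eqI real_norm_def)
  have "\<bar>f x\<bar> \<le> max M 0" for x
    using M[of x] closure_subset[of "{x. f x \<noteq> 0}"] by (cases "f x = 0") auto
  then show "\<exists>M. \<forall>x. \<bar>f x\<bar> \<le> M" by blast
  have "Ck (Suc 0) f" using f unfolding test_function_def by blast
  then have "f differentiable (at x)" for x by simp
  then show "\<exists>G. (\<forall>i. test_function (G i)) \<and> (\<forall>x. (f has_derivative (\<lambda>h. \<Sum>i\<in>UNIV. G i x * h $ i)) (at x))"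
    using has_derivative_partial_deriv test_function_partial_deriv[OF f] by (intro exI[of _ "\<lambda>i. partial_deriv i f"]) blast
qed

text \<open>The integral of a translate does not depend on the translation; its derivative along the
  i-th axis is the integral in question.\<close>

lemma integral_partial_deriv_test:
  fixes \<phi> :: "real ^ 'n \<Rightarrow> real"
  assumes \<phi>: "bsmooth \<phi>" and R: "\<And>x. \<phi> x \<noteq> 0 \<Longrightarrow> norm x \<le> R"
  shows "(\<integral>x. partial_deriv i \<phi> x \<partial>lborel) = 0"
proof -
  note \<phi>' = bsmooth_partial_deriv[OF \<phi>, of i]
  have [measurable]: "\<phi> \<in> borel_measurable borel" "partial_deriv i \<phi> \<in> borel_measurable borel"
    using bsmooth_borel_measurable \<phi> \<phi>' by auto
  obtain M where M: "M > 0" "\<And>x. \<bar>\<phi> x\<bar> \<le> M" using bsmooth_bounded_pos[OF \<phi>] by blast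
  obtain N where N: "N > 0" "\<And>x. \<bar>partial_deriv i \<phi> x\<bar> \<le> N" using bsmooth_bounded_pos[OF \<phi>'] by blast
  have int: "integrable lborel \<phi>"
    by (rule integrable_bounded_support[OF _ M(2) R]) simp_all
  let ?e = "axis i 1 :: real ^ 'n"
  have line: "((\<lambda>t. \<phi> (x + t *\<^sub>R ?e)) has_real_derivative partial_deriv i \<phi> (x + t *\<^sub>R ?e)) (at t)" for x t
    by (rule partial_deriv_line[OF bsmooth_differentiable[OF \<phi>]])
  have "((\<lambda>t. \<integral>x. \<phi> (x + t *\<^sub>R ?e) \<partial>lborel) has_real_derivative (\<integral>x. partial_deriv i \<phi> (x + 0 *\<^sub>R ?e) \<partial>lborel)) (at 0)"
  proof (rule has_derivative_integral[where a = "-1" and b = 1 and w = "\<lambda>x. N * indicator (cball 0 (R + 1)) x"])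
    show "integrable lborel (\<lambda>x :: real ^ 'n. N * indicator (cball 0 (R + 1)) x)"
      using emeasure_lborel_cball_finite[of "0 :: real ^ 'n" "R + 1"] by (intro integrable_mult_right integrable_real_indicator) auto
    fix t :: real and x :: "real ^ 'n" assume t: "t \<in> {-1<..<1}"
    show "\<bar>partial_deriv i \<phi> (x + t *\<^sub>R ?e)\<bar> \<le> N * indicator (cball 0 (R + 1)) x"
    proof (cases "partial_deriv i \<phi> (x + t *\<^sub>R ?e) = 0")
      case False
      have "norm x \<le> norm (x + t *\<^sub>R ?e) + norm (t *\<^sub>R ?e)"
        using norm_triangle_ineq4[of "x + t *\<^sub>R ?e" "t *\<^sub>R ?e"] by simp
      also have "\<dots> \<le> R + 1"
        using partial_deriv_eq_0_outside[OF R False] t by (intro add_mono) auto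
      finally show ?thesis using N(2) by simp
    qed (use N(1) in simp)
  qed (use int line in auto)
  moreover have "(\<integral>x. \<phi> (x + t *\<^sub>R ?e) \<partial>lborel) = (\<integral>x. \<phi> x \<partial>lborel)" for t
    using lborel_integral_translate[of \<phi> "- t *\<^sub>R ?e"] by simp
  ultimately show ?thesis
    using DERIV_unique[OF _ DERIV_const] by fastforce
qed

section \<open>Gaussian and local Lebesgue integrability\<close>

lemma lebesgue_gaussian_AE: "(AE x in gaussian. P x) \<longleftrightarrow> (AE x in lborel. P x)"
proof -
  have "(AE x in gaussian. P x) \<longleftrightarrow> (AE x in lborel. 0 < ennreal (gauss_density x) \<longrightarrow> P x)"
    unfolding gaussian_eq by (rule AE_density) simp
  then show ?thesis by (simp add: gauss_density_pos)
qed

lemma gauss_density_lower: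
  fixes x :: "real ^ 'n"
  assumes "norm x \<le> R" shows "(2 * pi) powr (- real CARD('n) / 2) * exp (- R\<^sup>2 / 2) \<le> gauss_density x"
proof -
  have "(norm x)\<^sup>2 \<le> R\<^sup>2" using assms by (intro power_mono) auto
  then show ?thesis unfolding gauss_density_def by (intro mult_left_mono) auto
qed

text \<open>The Gaussian density is bounded below on a ball, so weighted integrability implies
  integrability there with respect to Lebesgue measure.\<close>

lemma gaussian_integrable_cball:
  fixes f :: "real ^ 'n \<Rightarrow> real"
  assumes f: "integrable gaussian f"
  shows "integrable lborel (\<lambda>x. indicator (cball 0 R) x * f x)"
proof -
  define c where "c = (2 * pi) powr (- real CARD('n) / 2) * exp (- R\<^sup>2 / 2)"
  have c: "c > 0" by (simp add: c_def)
  have [measurable]: "f \<in> borel_measurable borel" using borel_measurable_integrable[OF f] by simp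
  have "integrable lborel (\<lambda>x. gauss_density x *\<^sub>R f x)"
    using f unfolding gaussian_eq by (subst (asm) integrable_density) (auto intro: less_imp_le gauss_density_pos)
  then have "integrable lborel (\<lambda>x. (1 / c) * (gauss_density x * f x))" by simp
  then show ?thesis
  proof (rule Bochner_Integration.integrable_bound)
    show "AE x in lborel. norm (indicator (cball 0 R) x * f x) \<le> norm (1 / c * (gauss_density x * f x))"
    proof (rule AE_I2)
      fix x :: "real ^ 'n"
      show "norm (indicator (cball 0 R) x * f x) \<le> norm (1 / c * (gauss_density x * f x))"
      proof (cases "norm x \<le> R")
        case True
        then have "c \<le> gauss_density x" using gauss_density_lower[OF True] by (simp add: c_def)
        then have "c * \<bar>f x\<bar> \<le> gauss_density x * \<bar>f x\<bar>" by (intro mult_right_mono) auto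
        then show ?thesis using True c gauss_density_pos[of x]
          by (simp add: abs_mult abs_of_pos pos_le_divide_eq mult.commute)
      qed simp
    qed
    show "(\<lambda>x. indicator (cball 0 R) x * f x) \<in> borel_measurable lborel"
      by (intro borel_measurable_times borel_measurable_indicator) auto
  qed
qed

lemma locally_integrableI_cball:
  fixes f :: "real ^ 'n \<Rightarrow> 'b::{banach, second_countable_topology}"
  assumes "\<And>R. integrable lborel (\<lambda>x. indicator (cball 0 R) x *\<^sub>R f x)"
  shows "locally_integrable f"
  unfolding locally_integrable_def set_integrable_def
proof (intro allI impI)
  fix K :: "(real ^ 'n) set" assume K: "compact K"
  then obtain R where R: "\<And>x. x \<in> K \<Longrightarrow> norm x \<le> R" using compact_imp_bounded bounded_iff by metis
  have "integrable lborel (\<lambda>x. indicator K x *\<^sub>R (indicator (cball 0 R) x *\<^sub>R f x))"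
    by (rule integrable_mult_indicator[OF _ assms]) (use K in \<open>auto intro: borel_compact\<close>)
  moreover have "indicator K x *\<^sub>R (indicator (cball 0 R) x *\<^sub>R f x) = indicator K x *\<^sub>R f x" for x
    using R by (auto simp: indicator_def)
  ultimately show "integrable lborel (\<lambda>x. indicator K x *\<^sub>R f x)" by (simp only:)
qed

lemma locally_integrable_cball:
  fixes f :: "real ^ 'n \<Rightarrow> real"
  shows "locally_integrable f \<Longrightarrow> integrable lborel (\<lambda>x. indicator (cball 0 R) x * f x)"
  unfolding locally_integrable_def set_integrable_def using compact_cball by fastforce

lemma locally_integrable_component:
  fixes g :: "real ^ 'n \<Rightarrow> real ^ 'n"
  assumes "locally_integrable g" shows "locally_integrable (\<lambda>x. g x $ i)"
proof (rule locally_integrableI_cball)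
  fix R
  have "integrable lborel (\<lambda>x. indicator (cball 0 R) x *\<^sub>R g x)"
    using assms compact_cball unfolding locally_integrable_def set_integrable_def by blast
  from integrable_bounded_linear[OF bounded_linear_vec_nth this, of i]
  show "integrable lborel (\<lambda>x. indicator (cball 0 R) x *\<^sub>R (g x $ i))" by simp
qed

lemma locally_integrable_vec:
  fixes g :: "real ^ 'n \<Rightarrow> real ^ 'n"
  assumes "\<And>i. locally_integrable (\<lambda>x. g x $ i)" shows "locally_integrable g"
proof (rule locally_integrableI_cball)
  fix R
  have "integrable lborel (\<lambda>x. \<Sum>i\<in>UNIV. (indicator (cball 0 R) x * g x $ i) *\<^sub>R axis i 1 :: real ^ 'n)"
    by (intro Bochner_Integration.integrable_sum integrable_scaleR_left locally_integrable_cball assms)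
  moreover have "(\<Sum>i\<in>UNIV. (indicator (cball 0 R) x * g x $ i) *\<^sub>R axis i 1 :: real ^ 'n) = indicator (cball 0 R) x *\<^sub>R g x" for x
    by (simp add: vec_eq_iff axis_def if_distrib cong: if_cong)
  ultimately show "integrable lborel (\<lambda>x. indicator (cball 0 R) x *\<^sub>R g x)" by simp
qed

section \<open>Uniqueness of weak gradients and the gradient of a square\<close>

lemma mol_reflect:
  assumes r: "0 < r"
  shows "bsmooth (\<lambda>y :: real ^ 'n. mol r (x - y))"
    and "partial_deriv i (\<lambda>y :: real ^ 'n. mol r (x - y)) y = - partial_deriv i (mol r) (x - y)"
    and "mol r (x - y :: real ^ 'n) \<noteq> 0 \<Longrightarrow> norm y \<le> norm x + CARD('n) / r"
proof -
  have "bsmooth (\<lambda>y. mol r ((- 1) *\<^sub>R y + x))" by (rule bsmooth_affine(1)[OF mol(1)[OF r]])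
  then show "bsmooth (\<lambda>y. mol r (x - y))" by simp
  have "partial_deriv i (\<lambda>y. mol r ((- 1) *\<^sub>R y + x)) y = (- 1) * partial_deriv i (mol r) ((- 1) *\<^sub>R y + x)"
    by (rule bsmooth_affine(2)[OF mol(1)[OF r]])
  then show "partial_deriv i (\<lambda>y. mol r (x - y)) y = - partial_deriv i (mol r) (x - y)" by simp
  assume "mol r (x - y) \<noteq> 0"
  from mol(3)[OF r this] show "norm y \<le> norm x + CARD('n) / r"
    using norm_triangle_ineq4[of x "x - y"] by simp
qed

lemma mol_reflect_test: "0 < r \<Longrightarrow> test_function (\<lambda>y :: real ^ 'n. mol r (x - y))"
  using mol_reflect(1,3) by (rule test_functionI)

text \<open>Needed because \<open>weak_gradient\<close> is an arbitrary choice. Testing both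
  gradients against reflected mollifiers shows that the mollifications of their difference vanish on
  a ball; letting the radius shrink, the difference vanishes there almost everywhere.\<close>

lemma weak_gradient_unique:
  fixes f :: "real ^ 'n \<Rightarrow> real"
  assumes g: "has_weak_gradient f g" and g': "has_weak_gradient f g'"
  shows "AE x in lborel. g x = g' x"
proof -
  have "AE x in lborel. norm x \<le> real k \<longrightarrow> g x $ i = g' x $ i" for k :: nat and i
  proof -
    \<comment> \<open>A mollifier with r \<ge> 1 reaches at most n beyond the ball of radius k, so
      truncating at k + n is invisible inside that ball.\<close>
    let ?R = "real k + CARD('n)"
    define b where "b x = indicator (cball 0 ?R) x * g x $ i - indicator (cball 0 ?R) x * g' x $ i" for x
    have l: "locally_integrable (\<lambda>x. g x $ i)" "locally_integrable (\<lambda>x. g' x $ i)"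
      using g g' by (auto simp: has_weak_gradient_def intro: locally_integrable_component)
    have b: "integrable lborel b" unfolding b_def
      by (intro Bochner_Integration.integrable_diff locally_integrable_cball l)
    have [measurable]: "b \<in> borel_measurable borel" using borel_measurable_integrable[OF b] by simp
    have zero: "moll r b x = 0" if r: "1 \<le> r" and x: "norm x \<le> real k" for r x
    proof -
      have r0: "0 < r" using r by simp
      have sup: "norm y \<le> ?R" if "mol r (x - y) \<noteq> 0" for y
      proof -
        have "CARD('n) / r \<le> CARD('n)" using r by (simp add: pos_divide_le_eq mult_le_cancel_left1)
        then show ?thesis using mol_reflect(3)[OF r0 that] x by simp
      qed
      let ?\<phi> = "\<lambda>y. mol r (x - y)"
      have t: "test_function ?\<phi>" by (rule mol_reflect_test[OF r0])
      obtain M where M: "M > 0" "\<And>y. \<bar>?\<phi> y\<bar> \<le> M" using bsmooth_bounded_pos[OF mol_reflect(1)[OF r0]] by blast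
      have [measurable]: "?\<phi> \<in> borel_measurable borel" by (rule bsmooth_borel_measurable[OF mol_reflect(1)[OF r0]])
      have e: "indicator (cball 0 ?R) y * c * ?\<phi> y = c * ?\<phi> y" for c y
        using sup[of y] by (cases "?\<phi> y = 0") auto
      have int: "integrable lborel (\<lambda>y. c y * ?\<phi> y)" if "locally_integrable c" for c
        using moll_integrable(1)[OF r0 locally_integrable_cball[OF that, of ?R], of x] by (simp add: e)
      have "(\<integral>y. g y $ i * ?\<phi> y \<partial>lborel) = (\<integral>y. g' y $ i * ?\<phi> y \<partial>lborel)"
      proof -
        have "- (\<integral>y. g y $ i * ?\<phi> y \<partial>lborel) = (\<integral>y. f y * partial_deriv i ?\<phi> y \<partial>lborel)"
          using g t unfolding has_weak_gradient_def by simp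
        also have "\<dots> = - (\<integral>y. g' y $ i * ?\<phi> y \<partial>lborel)"
          using g' t unfolding has_weak_gradient_def by simp
        finally show ?thesis by simp
      qed
      then have "0 = (\<integral>y. g y $ i * ?\<phi> y - g' y $ i * ?\<phi> y \<partial>lborel)"
        using int[OF l(1)] int[OF l(2)] by simp
      also have "\<dots> = moll r b x"
        unfolding moll_def b_def left_diff_distrib e ..
      finally show ?thesis by simp
    qed
    have "(\<integral>\<^sup>+x. ennreal \<bar>indicator (cball 0 (real k)) x * b x\<bar> \<partial>lborel) \<le> ennreal \<epsilon>" if eps: "0 < \<epsilon>" for \<epsilon>
    proof -
      obtain r0 where r0: "0 < r0" "\<And>r. r0 \<le> r \<Longrightarrow> (\<integral>\<^sup>+x. ennreal \<bar>moll r b x - b x\<bar> \<partial>lborel) \<le> ennreal \<epsilon>"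
        using moll_L1[OF b eps] by blast
      have "(\<integral>\<^sup>+x. ennreal \<bar>indicator (cball 0 (real k)) x * b x\<bar> \<partial>lborel) \<le> (\<integral>\<^sup>+x. ennreal \<bar>moll (max r0 1) b x - b x\<bar> \<partial>lborel)"
        by (intro nn_integral_mono ennreal_leI) (auto simp: zero split: split_indicator)
      also have "\<dots> \<le> ennreal \<epsilon>" by (rule r0(2)) simp
      finally show ?thesis .
    qed
    then have "(\<integral>\<^sup>+x. ennreal \<bar>indicator (cball 0 (real k)) x * b x\<bar> \<partial>lborel) \<le> 0"
      by - (rule ennreal_le_epsilon, simp)
    then have "(\<integral>\<^sup>+x. ennreal \<bar>indicator (cball 0 (real k)) x * b x\<bar> \<partial>lborel) = 0"
      by (simp only: le_zero_eq)
    then have "AE x in lborel. ennreal \<bar>indicator (cball 0 (real k)) x * b x\<bar> = 0"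
      by (subst (asm) nn_integral_0_iff_AE)
        (auto intro!: measurable_compose[OF _ measurable_ennreal] borel_measurable_abs borel_measurable_times borel_measurable_indicator)
    then show ?thesis
      by eventually_elim (auto simp: b_def)
  qed
  then have "AE x in lborel. \<forall>k. \<forall>i\<in>UNIV. norm x \<le> real k \<longrightarrow> g x $ i = g' x $ i"
    unfolding AE_all_countable by (intro allI AE_finite_allI) auto
  then show ?thesis
  proof (rule AE_mp, intro AE_I2 impI)
    fix x assume "\<forall>k. \<forall>i\<in>UNIV. norm x \<le> real k \<longrightarrow> g x $ i = g' x $ i"
    then show "g x = g' x" using real_arch_simple[of "norm x"] by (auto simp: vec_eq_iff)
  qed
qed

text \<open>L2 convergence of the mollifications, paired with a fixed L2 function; integrability of
  the products is obtained on the way, for large r.\<close>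

lemma integral_mult_moll_tendsto:
  fixes a b :: "real ^ 'n \<Rightarrow> real"
  assumes a: "a \<in> borel_measurable borel" "integrable lborel (\<lambda>x. (a x)\<^sup>2)"
    and b: "integrable lborel b" "integrable lborel (\<lambda>x. (b x)\<^sup>2)"
  shows "((\<lambda>r. \<integral>x. a x * moll r b x \<partial>lborel) \<longlongrightarrow> (\<integral>x. a x * b x \<partial>lborel)) at_top"
    and "\<exists>r0>0. \<forall>r\<ge>r0. integrable lborel (\<lambda>x. a x * moll r b x)"
proof -
  note [measurable] = a(1)
  have [measurable]: "b \<in> borel_measurable borel" using borel_measurable_integrable[OF b(1)] by simp
  have ab: "integrable lborel (\<lambda>x. a x * b x)"
    by (rule integrable_mult_L2[OF _ _ a(2) b(2)]) simp_all
  define A where "A = (\<integral>x. (a x)\<^sup>2 \<partial>lborel) + 1"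
  have A: "A > 0" by (simp add: A_def add_nonneg_pos)
  have key: "\<exists>r0>0. \<forall>r\<ge>r0. integrable lborel (\<lambda>x. a x * moll r b x) \<and> \<bar>(\<integral>x. a x * moll r b x \<partial>lborel) - (\<integral>x. a x * b x \<partial>lborel)\<bar> < \<epsilon>"
    if \<epsilon>: "0 < \<epsilon>" for \<epsilon>
  proof -
    \<comment> \<open>The weight is matched to A, an upper bound of the squared norm of a, so that
      the two halves of the split product contribute \<epsilon>/2 and \<epsilon>/4.\<close>
    define \<eta> where "\<eta> = \<epsilon> / A"
    have \<eta>: "\<eta> > 0" using \<epsilon> A by (simp add: \<eta>_def)
    have "0 < \<eta> * \<epsilon> / 2" using \<eta> \<epsilon> by simp
    from moll_L2[OF b this] obtain r0 where r0: "0 < r0"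
      "\<And>r. r0 \<le> r \<Longrightarrow> (\<integral>\<^sup>+x. ennreal ((moll r b x - b x)\<^sup>2) \<partial>lborel) \<le> ennreal (\<eta> * \<epsilon> / 2)" by blast
    have "integrable lborel (\<lambda>x. a x * moll r b x) \<and> \<bar>(\<integral>x. a x * moll r b x \<partial>lborel) - (\<integral>x. a x * b x \<partial>lborel)\<bar> < \<epsilon>" if r: "r0 \<le> r" for r
    proof -
      have rp: "0 < r" using r r0(1) by simp
      have [measurable]: "moll r b \<in> borel_measurable borel" by (rule bsmooth_borel_measurable[OF bsmooth_moll(1)[OF rp b(1)]])
      let ?d = "\<lambda>x. moll r b x - b x"
      have "(\<integral>\<^sup>+x. ennreal ((?d x)\<^sup>2) \<partial>lborel) < \<infinity>"
        using r0(2)[OF r] by (rule le_less_trans) simp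
      then have d2: "integrable lborel (\<lambda>x. (?d x)\<^sup>2)" by (intro integrableI_nonneg) auto
      have dI: "(\<integral>x. (?d x)\<^sup>2 \<partial>lborel) \<le> \<eta> * \<epsilon> / 2"
        using r0(2)[OF r] \<eta> \<epsilon> by (subst (asm) nn_integral_eq_integral[OF d2]) auto
      have bnd: "2 * \<bar>a x * ?d x\<bar> \<le> \<eta> * (a x)\<^sup>2 + (?d x)\<^sup>2 / \<eta>" for x
        by (rule amgm_weighted[OF \<eta>])
      have s: "integrable lborel (\<lambda>x. \<eta> * (a x)\<^sup>2 + (?d x)\<^sup>2 / \<eta>)" using a d2 by simp
      have ad: "integrable lborel (\<lambda>x. a x * ?d x)"
      proof (rule Bochner_Integration.integrable_bound[OF s])
        show "AE x in lborel. norm (a x * ?d x) \<le> norm (\<eta> * (a x)\<^sup>2 + (?d x)\<^sup>2 / \<eta>)"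
        proof (rule AE_I2)
          fix x show "norm (a x * ?d x) \<le> norm (\<eta> * (a x)\<^sup>2 + (?d x)\<^sup>2 / \<eta>)"
            using bnd[of x] abs_ge_zero[of "a x * ?d x"] by simp
        qed
      qed simp
      have "integrable lborel (\<lambda>x. a x * ?d x + a x * b x)" by (intro Bochner_Integration.integrable_add ad ab)
      then have am: "integrable lborel (\<lambda>x. a x * moll r b x)" by (simp add: right_diff_distrib)
      have "\<bar>(\<integral>x. a x * moll r b x \<partial>lborel) - (\<integral>x. a x * b x \<partial>lborel)\<bar> = \<bar>\<integral>x. a x * ?d x \<partial>lborel\<bar>"
        using am ab by (simp add: right_diff_distrib)
      also have "\<dots> \<le> (\<integral>x. (\<eta> * (a x)\<^sup>2 + (?d x)\<^sup>2 / \<eta>) / 2 \<partial>lborel)"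
      proof (rule order_trans[OF integral_abs_bound], rule integral_mono)
        show "\<bar>a x * ?d x\<bar> \<le> (\<eta> * (a x)\<^sup>2 + (?d x)\<^sup>2 / \<eta>) / 2" for x using bnd[of x] by simp
      qed (use ad s in auto)
      also have "\<dots> = (\<eta> * (A - 1) + (\<integral>x. (?d x)\<^sup>2 \<partial>lborel) / \<eta>) / 2"
        using a d2 by (simp add: A_def)
      also have "\<dots> \<le> (\<eta> * A + (\<eta> * \<epsilon> / 2) / \<eta>) / 2"
        using \<eta> dI by (intro divide_right_mono add_mono mult_left_mono) auto
      also have "\<dots> = (\<epsilon> + \<epsilon> / 2) / 2" using \<eta> A by (simp add: \<eta>_def)
      also have "\<dots> < \<epsilon>" using \<epsilon> by simp
      finally show ?thesis using am by blast
    qed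
    then show ?thesis using r0(1) by blast
  qed
  show "((\<lambda>r. \<integral>x. a x * moll r b x \<partial>lborel) \<longlongrightarrow> (\<integral>x. a x * b x \<partial>lborel)) at_top"
    unfolding tendsto_iff eventually_at_top_linorder dist_real_def using key by meson
  show "\<exists>r0>0. \<forall>r\<ge>r0. integrable lborel (\<lambda>x. a x * moll r b x)" using key[of 1] by auto
qed

text \<open>Testing the weak gradient of \<open>u\<close> against \<open>u\<^sub>r \<phi>\<close>, where \<open>u\<^sub>r\<close> is a mollification of \<open>u\<close>, gives the
  claim in the limit, because \<open>\<partial>\<^sub>i u\<^sub>r\<close> is the mollification of \<open>g\<^sub>i\<close>.\<close>

lemma has_weak_gradient_square:
  fixes u :: "real ^ 'n \<Rightarrow> real"
  assumes ug: "has_weak_gradient u g" and u2: "integrable gaussian (\<lambda>x. (u x)\<^sup>2)"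
    and g2: "integrable gaussian (\<lambda>x. (norm (g x))\<^sup>2)"
  shows "has_weak_gradient (\<lambda>x. (u x)\<^sup>2) (\<lambda>x. (2 * u x) *\<^sub>R g x)"
proof -
  let ?u = "\<lambda>R x. indicator (cball 0 R) x * u x :: real" and ?g = "\<lambda>R i x. indicator (cball 0 R) x * g x $ i :: real"
  have ui: "integrable lborel (?u R)" for R
    using ug by (auto simp: has_weak_gradient_def intro: locally_integrable_cball)
  have gi: "integrable lborel (?g R i)" for R i
    using ug by (auto simp: has_weak_gradient_def intro!: locally_integrable_cball locally_integrable_component)
  have um: "?u R \<in> borel_measurable borel" and gm: "?g R i \<in> borel_measurable borel" for R i
    using borel_measurable_integrable[OF ui] borel_measurable_integrable[OF gi] by simp_all
  have indsq: "(indicator A x * c)\<^sup>2 = indicator A x * c\<^sup>2" for A and c :: real and x :: "real ^ 'n"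
    by (simp add: indicator_def)
  have ui2: "integrable lborel (\<lambda>x. (?u R x)\<^sup>2)" for R
    unfolding indsq by (rule gaussian_integrable_cball[OF u2])
  have gi2: "integrable lborel (\<lambda>x. (?g R i x)\<^sup>2)" for R i
  proof (rule Bochner_Integration.integrable_bound[OF gaussian_integrable_cball[OF g2, of R]])
    show "AE x in lborel. norm ((?g R i x)\<^sup>2) \<le> norm (indicator (cball 0 R) x * (norm (g x))\<^sup>2)"
    proof (rule AE_I2)
      fix x
      have "\<bar>g x $ i\<bar>\<^sup>2 \<le> (norm (g x))\<^sup>2" by (intro power_mono component_le_norm_cart) auto
      then show "norm ((?g R i x)\<^sup>2) \<le> norm (indicator (cball 0 R) x * (norm (g x))\<^sup>2)"
        unfolding indsq by (simp add: indicator_def)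
    qed
    show "(\<lambda>x. (?g R i x)\<^sup>2) \<in> borel_measurable lborel" using gm[of R i] by simp
  qed
  have "locally_integrable (\<lambda>x. (u x)\<^sup>2)"
    using gaussian_integrable_cball[OF u2] by (intro locally_integrableI_cball) simp
  moreover have "locally_integrable (\<lambda>x. (2 * u x) *\<^sub>R g x)"
  proof (rule locally_integrable_vec, rule locally_integrableI_cball)
    fix i R
    have "integrable lborel (\<lambda>x. 2 * (?u R x * ?g R i x))"
      by (intro integrable_mult_right integrable_mult_L2 ui2 gi2) (use um gm in simp_all)
    moreover have "2 * (?u R x * ?g R i x) = indicator (cball 0 R) x *\<^sub>R ((2 * u x) *\<^sub>R g x) $ i" for x
      by (simp add: indicator_def)
    ultimately show "integrable lborel (\<lambda>x. indicator (cball 0 R) x *\<^sub>R ((2 * u x) *\<^sub>R g x) $ i)" by (simp only:)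
  qed
  moreover have "(\<integral>x. (u x)\<^sup>2 * partial_deriv i \<phi> x \<partial>lborel) = - (\<integral>x. ((2 * u x) *\<^sub>R g x) $ i * \<phi> x \<partial>lborel)"
    if t: "test_function \<phi>" for \<phi> i
  proof -
    obtain R0 where R0: "R0 > 0" "\<And>x. \<phi> x \<noteq> 0 \<Longrightarrow> norm x \<le> R0" using test_function_support[OF t] by blast
    \<comment> \<open>The margin n exceeds the reach of the mollifier for r \<ge> 1, so on the
      support of \<phi> truncating u and g at radius R does not affect their mollifications.\<close>
    define R where "R = R0 + CARD('n)"
    have \<phi>: "bsmooth \<phi>" by (rule test_function_bsmooth[OF t])
    have sup: "\<phi> x = 0" "partial_deriv i \<phi> x = 0" if "\<not> norm x \<le> R0" for x
      using R0(2)[of x] partial_deriv_eq_0_outside[of \<phi> R0 i x] R0(2) that by auto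
    let ?U = "?u R" and ?G = "?g R i"
    have UG: "?U x = u x" "?G x = g x $ i" if "norm x \<le> R0" for x using that by (simp_all add: R_def)
    have L2: "(\<lambda>x. c x * \<psi> x) \<in> borel_measurable borel" "integrable lborel (\<lambda>x. (c x * \<psi> x)\<^sup>2)"
      if c: "c \<in> borel_measurable borel" "integrable lborel (\<lambda>x. (c x)\<^sup>2)" and \<psi>: "bsmooth \<psi>" for c \<psi> :: "real ^ 'n \<Rightarrow> real"
    proof -
      show "(\<lambda>x. c x * \<psi> x) \<in> borel_measurable borel" using c bsmooth_borel_measurable[OF \<psi>] by simp
      obtain M where "\<And>x. \<bar>\<psi> x * \<psi> x\<bar> \<le> M" using bsmooth_bounded[OF bsmooth_mult[OF \<psi> \<psi>]] by blast
      then have "integrable lborel (\<lambda>x. (c x)\<^sup>2 * (\<psi> x * \<psi> x))"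
        using bsmooth_borel_measurable[OF \<psi>] c by (intro integrable_bounded_mult) auto
      then show "integrable lborel (\<lambda>x. (c x * \<psi> x)\<^sup>2)" by (simp add: power2_eq_square mult_ac)
    qed
    note \<phi>' = bsmooth_partial_deriv[OF \<phi>, of i]
    note A1 = integral_mult_moll_tendsto[OF L2[OF um[of R] ui2[of R] \<phi>'] ui[of R] ui2[of R]]
    note A2 = integral_mult_moll_tendsto[OF L2[OF um[of R] ui2[of R] \<phi>] gi[of R i] gi2[of R i]]
    note A3 = integral_mult_moll_tendsto[OF L2[OF gm[of R i] gi2[of R i] \<phi>] ui[of R] ui2[of R]]
    obtain r1 where r1: "\<And>r. r1 \<le> r \<Longrightarrow> integrable lborel (\<lambda>x. (?U x * partial_deriv i \<phi> x) * moll r ?U x)" using A1(2) by blast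
    obtain r2 where r2: "\<And>r. r2 \<le> r \<Longrightarrow> integrable lborel (\<lambda>x. (?U x * \<phi> x) * moll r ?G x)" using A2(2) by blast
    have id: "(\<integral>x. (?U x * partial_deriv i \<phi> x) * moll r ?U x \<partial>lborel) + (\<integral>x. (?U x * \<phi> x) * moll r ?G x \<partial>lborel)
        = - (\<integral>x. (?G x * \<phi> x) * moll r ?U x \<partial>lborel)" if r: "max (max r1 r2) 1 \<le> r" for r
    proof -
      have rp: "0 < r" using r by simp
      have N: "CARD('n) / r \<le> CARD('n)" using r by (simp add: pos_divide_le_eq mult_le_cancel_left1)
      note sU = bsmooth_moll[OF rp ui[of R]]
      let ?w = "\<lambda>x. moll r ?U x * \<phi> x"
      have w: "bsmooth ?w" by (intro bsmooth_mult sU \<phi>)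
      have "test_function ?w" by (rule test_functionI[OF w, of R0]) (use R0 in auto)
      then have weak: "(\<integral>x. u x * partial_deriv i ?w x \<partial>lborel) = - (\<integral>x. g x $ i * ?w x \<partial>lborel)"
        using ug unfolding has_weak_gradient_def by blast
      \<comment> \<open>Moving the derivative onto the mollifier produces a test function in y, and
        the weak gradient then takes over.\<close>
      have dmoll: "partial_deriv i (moll r ?U) x = moll r ?G x" if x: "norm x \<le> R0" for x
      proof -
        have inR: "norm y \<le> R" if "mol r (x - y) \<noteq> 0" for y
          using mol_reflect(3)[OF rp that] N x by (simp add: R_def)
        have inR': "norm y \<le> R" if "partial_deriv i (mol r) (x - y) \<noteq> 0" for y
        proof -
          have "norm (x - y) \<le> CARD('n) / r" by (rule partial_deriv_eq_0_outside[OF mol(3)[OF rp] that])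
          then show ?thesis using N x norm_triangle_ineq4[of x "x - y"] by (simp add: R_def)
        qed
        have "partial_deriv i (moll r ?U) x = (\<integral>y. ?U y * partial_deriv i (mol r) (x - y) \<partial>lborel)" by (rule sU)
        also have "\<dots> = (\<integral>y. - (u y * partial_deriv i (\<lambda>y. mol r (x - y)) y) \<partial>lborel)"
        proof (rule Bochner_Integration.integral_cong[OF refl])
          fix y show "?U y * partial_deriv i (mol r) (x - y) = - (u y * partial_deriv i (\<lambda>y. mol r (x - y)) y)"
            using inR'[of y] unfolding mol_reflect(2)[OF rp] by (cases "partial_deriv i (mol r) (x - y) = 0") auto
        qed
        also have "\<dots> = - (\<integral>y. u y * partial_deriv i (\<lambda>y. mol r (x - y)) y \<partial>lborel)" by simp
        also have "\<dots> = (\<integral>y. g y $ i * mol r (x - y) \<partial>lborel)"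
          using ug mol_reflect_test[OF rp, of x] unfolding has_weak_gradient_def by simp
        also have "\<dots> = moll r ?G x"
          unfolding moll_def
        proof (rule Bochner_Integration.integral_cong[OF refl])
          fix y show "g y $ i * mol r (x - y) = ?G y * mol r (x - y)"
            using inR[of y] by (cases "mol r (x - y) = 0") auto
        qed
        finally show ?thesis .
      qed
      have "u x * partial_deriv i ?w x = (?U x * partial_deriv i \<phi> x) * moll r ?U x + (?U x * \<phi> x) * moll r ?G x" for x
        unfolding partial_deriv_mult[OF sU(1) \<phi>]
        using UG[of x] dmoll[of x] sup[of x] by (cases "norm x \<le> R0") (auto simp: algebra_simps)
      then have "(\<integral>x. u x * partial_deriv i ?w x \<partial>lborel) = (\<integral>x. (?U x * partial_deriv i \<phi> x) * moll r ?U x \<partial>lborel) + (\<integral>x. (?U x * \<phi> x) * moll r ?G x \<partial>lborel)"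
        using r r1[of r] r2[of r] by simp
      moreover have "g x $ i * ?w x = (?G x * \<phi> x) * moll r ?U x" for x
        using UG[of x] sup[of x] by (cases "norm x \<le> R0") auto
      ultimately show ?thesis using weak by simp
    qed
    have "((\<lambda>r. (\<integral>x. (?U x * partial_deriv i \<phi> x) * moll r ?U x \<partial>lborel) + (\<integral>x. (?U x * \<phi> x) * moll r ?G x \<partial>lborel))
        \<longlongrightarrow> (\<integral>x. (?U x * partial_deriv i \<phi> x) * ?U x \<partial>lborel) + (\<integral>x. (?U x * \<phi> x) * ?G x \<partial>lborel)) at_top"
      by (rule tendsto_add[OF A1(1) A2(1)])
    moreover have "((\<lambda>r. - (\<integral>x. (?G x * \<phi> x) * moll r ?U x \<partial>lborel)) \<longlongrightarrow> - (\<integral>x. (?G x * \<phi> x) * ?U x \<partial>lborel)) at_top"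
      by (rule tendsto_minus[OF A3(1)])
    then have "((\<lambda>r. (\<integral>x. (?U x * partial_deriv i \<phi> x) * moll r ?U x \<partial>lborel) + (\<integral>x. (?U x * \<phi> x) * moll r ?G x \<partial>lborel))
        \<longlongrightarrow> - (\<integral>x. (?G x * \<phi> x) * ?U x \<partial>lborel)) at_top"
      by (rule Lim_transform_eventually) (use id in \<open>auto simp: eventually_at_top_linorder intro!: exI[of _ "max (max r1 r2) 1"]\<close>)
    ultimately have lim: "(\<integral>x. (?U x * partial_deriv i \<phi> x) * ?U x \<partial>lborel) + (\<integral>x. (?U x * \<phi> x) * ?G x \<partial>lborel) = - (\<integral>x. (?G x * \<phi> x) * ?U x \<partial>lborel)"
      by (rule tendsto_unique[rotated]) simp
    have e1: "(u x)\<^sup>2 * partial_deriv i \<phi> x = (?U x * partial_deriv i \<phi> x) * ?U x" for x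
      using UG[of x] sup[of x] by (cases "norm x \<le> R0") (auto simp: power2_eq_square)
    have e2: "((2 * u x) *\<^sub>R g x) $ i * \<phi> x = 2 * ((?U x * \<phi> x) * ?G x)" for x
      using UG[of x] sup[of x] by (cases "norm x \<le> R0") auto
    have e3: "(?G x * \<phi> x) * ?U x = (?U x * \<phi> x) * ?G x" for x by (simp only: mult_ac)
    show ?thesis
      using lim unfolding e1 e2 e3 by simp
  qed
  ultimately show ?thesis unfolding has_weak_gradient_def by blast
qed

lemma has_weak_gradient_cong_AE:
  fixes f f' :: "real ^ 'n \<Rightarrow> real"
  assumes fg: "has_weak_gradient f g" and [measurable]: "f \<in> borel_measurable borel" "f' \<in> borel_measurable borel"
    and eq: "AE x in lborel. f x = f' x"
  shows "has_weak_gradient f' g"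
proof -
  have "locally_integrable f'"
  proof (rule locally_integrableI_cball)
    fix R
    have m: "(\<lambda>x. indicator (cball 0 R) x *\<^sub>R h x) \<in> borel_measurable borel" if "h \<in> borel_measurable borel" for h :: "real ^ 'n \<Rightarrow> real"
      using that by (intro borel_measurable_scaleR borel_measurable_indicator) auto
    have "integrable lborel (\<lambda>x. indicator (cball 0 R) x *\<^sub>R f x)"
      using fg locally_integrable_cball[of f R] by (simp add: has_weak_gradient_def)
    then show "integrable lborel (\<lambda>x. indicator (cball 0 R) x *\<^sub>R f' x)"
      by (subst (asm) integrable_cong_AE[where g = "\<lambda>x. indicator (cball 0 R) x *\<^sub>R f' x"])
        (use eq in \<open>auto intro!: m simp del: real_scaleR_def\<close>)
  qed
  moreover have "(\<integral>x. f' x * partial_deriv i \<phi> x \<partial>lborel) = (\<integral>x. f x * partial_deriv i \<phi> x \<partial>lborel)" if "test_function \<phi>" for \<phi> i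
    using bsmooth_borel_measurable[OF bsmooth_partial_deriv[OF test_function_bsmooth[OF that]], of i] eq
    by (intro integral_cong_AE) auto
  ultimately show ?thesis using fg unfolding has_weak_gradient_def by simp
qed

section \<open>Smooth approximation of Sobolev densities\<close>

lemma gauss_density_le_1: "gauss_density x \<le> 1" for x :: "real ^ 'n"
proof -
  have "(2 * pi) powr (- real CARD('n) / 2) \<le> 1"
    using powr_mono[of "- real CARD('n) / 2" 0 "2 * pi"] pi_ge_two by simp
  then show ?thesis unfolding gauss_density_def by (intro mult_le_one) auto
qed

text \<open>The exponents differ by at most a b, since |y|^2 - |x|^2 \<le> 2 a b. This bounds the
  price of mollifying at scale a inside a ball of radius b under the Gaussian weight.\<close>

lemma gauss_density_ratio:
  fixes x y :: "real ^ 'n"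
  assumes d: "norm (x - y) \<le> a" and y: "norm y \<le> b" and a: "0 \<le> a"
  shows "gauss_density x \<le> exp (a * b) * gauss_density y"
proof -
  have "(norm y)\<^sup>2 - (norm x)\<^sup>2 \<le> 2 * (a * b)"
  proof (cases "norm x \<le> norm y")
    case True
    have "(norm y)\<^sup>2 - (norm x)\<^sup>2 = (norm y - norm x) * (norm y + norm x)"
      by (simp add: power2_eq_square algebra_simps)
    also have "\<dots> \<le> a * (b + b)"
    proof (rule mult_mono)
      show "norm y - norm x \<le> a" using norm_triangle_ineq2[of y x] d by (simp add: norm_minus_commute)
      show "norm y + norm x \<le> b + b" using True y by simp
    qed (use a in auto)
    finally show ?thesis by simp
  next
    case False
    then have "(norm y)\<^sup>2 \<le> (norm x)\<^sup>2" by (intro power_mono) auto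
    moreover have "0 \<le> a * b" using a order_trans[OF norm_ge_zero y] by simp
    ultimately show ?thesis by linarith
  qed
  then have "exp (- (norm x)\<^sup>2 / 2) \<le> exp (a * b) * exp (- (norm y)\<^sup>2 / 2)"
    unfolding exp_add[symmetric] by simp
  then have "(2 * pi) powr (- real CARD('n) / 2) * exp (- (norm x)\<^sup>2 / 2)
      \<le> (2 * pi) powr (- real CARD('n) / 2) * (exp (a * b) * exp (- (norm y)\<^sup>2 / 2))"
    by (intro mult_left_mono) auto
  then show ?thesis unfolding gauss_density_def by (simp only: mult.left_commute)
qed

lemma nn_integral_gaussian:
  "f \<in> borel_measurable borel \<Longrightarrow> (\<integral>\<^sup>+x. f x \<partial>gaussian) = (\<integral>\<^sup>+x. ennreal (gauss_density x) * f x \<partial>lborel)"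
  unfolding gaussian_eq by (rule nn_integral_density) simp_all

lemma mol_reflect_integral:
  assumes r: "0 < r"
  shows "integrable lborel (\<lambda>y :: real ^ 'n. mol r (x - y))" "(\<integral>y. mol r (x - y :: real ^ 'n) \<partial>lborel) = 1"
    and "(\<integral>\<^sup>+y. ennreal (mol r (y - x :: real ^ 'n)) \<partial>lborel) = 1"
proof -
  have mm [measurable]: "(mol r :: real ^ 'n \<Rightarrow> real) \<in> borel_measurable borel" by (rule bsmooth_borel_measurable[OF mol(1)[OF r]])
  have l: "lborel = distr lborel borel (\<lambda>z :: real ^ 'n. x - z)"
    by (rule lborel_distr_reflect[symmetric])
  have "integrable (distr lborel borel (\<lambda>z. x - z)) (\<lambda>y. mol r y)"
    using mol(4)[OF r, where 'n = 'n] l by simp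
  then show "integrable lborel (\<lambda>y. mol r (x - y))" by (simp add: integrable_distr_eq)
  have "(\<integral>y. mol r (y :: real ^ 'n) \<partial>distr lborel borel (\<lambda>z. x - z)) = 1"
    using mol(5)[OF r, where 'n = 'n] l by simp
  then show "(\<integral>y. mol r (x - y) \<partial>lborel) = 1" by (simp add: integral_distr)
  have "(\<integral>\<^sup>+y. ennreal (mol r (y - x)) \<partial>lborel) = ennreal (\<integral>y. mol r (y - x) \<partial>lborel)"
    using mol(2)[OF r, where 'n = 'n] lborel_integrable_translate[OF mol(4)[OF r, where 'n = 'n]]
    by (intro nn_integral_eq_integral) auto
  then show "(\<integral>\<^sup>+y. ennreal (mol r (y - x)) \<partial>lborel) = 1"
    by (simp add: lborel_integral_translate mol(5)[OF r])
qed

text \<open>A square, so that its squared gradient is bounded by a constant times 1/R^2 times the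
  cutoff itself; the division by the density in the Fisher information is then harmless.\<close>

definition cutoff :: "real \<Rightarrow> real ^ 'n \<Rightarrow> real" where
  "cutoff R x = bump ((1 / R) *\<^sub>R x) * bump ((1 / R) *\<^sub>R x)"

lemma cutoff:
  fixes R :: real
  assumes R: "0 < R"
  shows "bsmooth (cutoff R :: real ^ 'n \<Rightarrow> real)" "0 \<le> cutoff R (x :: real ^ 'n)" "cutoff R (x :: real ^ 'n) \<le> 1"
    and "cutoff R (x :: real ^ 'n) \<noteq> 0 \<Longrightarrow> norm x \<le> CARD('n) * R"
    and "(\<And>i y. \<bar>partial_deriv i bump (y :: real ^ 'n)\<bar> \<le> S) \<Longrightarrow> (partial_deriv i (cutoff R) (x :: real ^ 'n))\<^sup>2 \<le> 4 * S\<^sup>2 / R\<^sup>2 * cutoff R x"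
proof -
  let ?\<beta> = "\<lambda>x :: real ^ 'n. bump ((1 / R) *\<^sub>R x)"
  have \<beta>: "bsmooth ?\<beta>" "partial_deriv i ?\<beta> x = (1 / R) * partial_deriv i bump ((1 / R) *\<^sub>R x)" for i x
    using bsmooth_affine[OF bump(1), where c = "1 / R" and z = 0] by simp_all
  show "bsmooth (cutoff R :: real ^ 'n \<Rightarrow> real)" unfolding cutoff_def[abs_def] by (intro bsmooth_mult \<beta>)
  show "0 \<le> cutoff R x" unfolding cutoff_def by simp
  show "cutoff R x \<le> 1" unfolding cutoff_def by (intro mult_le_one bump)
  show "norm x \<le> CARD('n) * R" if "cutoff R x \<noteq> 0"
    using bump_support[of "(1 / R) *\<^sub>R x"] that R by (auto simp: cutoff_def pos_divide_le_eq)
  assume S: "\<And>i y. \<bar>partial_deriv i bump (y :: real ^ 'n)\<bar> \<le> S"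
  have "partial_deriv i (cutoff R) x = 2 * ?\<beta> x * ((1 / R) * partial_deriv i bump ((1 / R) *\<^sub>R x))"
    unfolding cutoff_def[abs_def] partial_deriv_mult[OF \<beta>(1) \<beta>(1)] \<beta>(2) by simp
  then have "(partial_deriv i (cutoff R) x)\<^sup>2 = 4 * (partial_deriv i bump ((1 / R) *\<^sub>R x))\<^sup>2 / R\<^sup>2 * cutoff R x"
    by (simp add: cutoff_def power2_eq_square)
  also have "\<dots> \<le> 4 * S\<^sup>2 / R\<^sup>2 * cutoff R x"
  proof -
    have "(partial_deriv i bump ((1 / R) *\<^sub>R x))\<^sup>2 \<le> S\<^sup>2"
      by (subst power2_abs[symmetric]) (intro power_mono S, simp)
    then show ?thesis using \<open>0 \<le> cutoff R x\<close> by (intro mult_right_mono divide_right_mono) auto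
  qed
  finally show "(partial_deriv i (cutoff R) x)\<^sup>2 \<le> 4 * S\<^sup>2 / R\<^sup>2 * cutoff R x" .
qed

lemma cutoff_tendsto: "(\<lambda>k. cutoff (real (Suc k)) x) \<longlonglongrightarrow> 1" for x :: "real ^ 'n"
proof -
  have "continuous_on UNIV (bump :: real ^ 'n \<Rightarrow> real)" by (rule bsmooth_continuous_on[OF bump(1)])
  then have "isCont bump (0 :: real ^ 'n)" by (simp add: continuous_on_eq_continuous_at)
  moreover have "(\<lambda>k. (1 / real (Suc k)) *\<^sub>R x) \<longlonglongrightarrow> 0"
    using tendsto_scaleR[OF LIMSEQ_inverse_real_of_nat tendsto_const[of x]] by (simp add: inverse_eq_divide)
  ultimately have "(\<lambda>k. bump ((1 / real (Suc k)) *\<^sub>R x)) \<longlonglongrightarrow> bump (0 :: real ^ 'n)"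
    by (rule isCont_tendsto_compose)
  from tendsto_mult[OF this this] show ?thesis by (simp add: cutoff_def bump(4))
qed

text \<open>Only f - \<alpha> is cut off and mollified, so the lower bound \<alpha> survives. The
  Fisher information hardly grows for three reasons: the cutoff costs O(1/R^2) relative to f, the
  function q^2/w is jointly convex and so compatible with averaging, and the Gaussian weight varies
  by a factor of at most exp (n^2/R) over the mollification radius.\<close>

lemma smooth_approximation_step:
  fixes f :: "real ^ 'n \<Rightarrow> real"
  assumes \<alpha>: "0 < \<alpha>" and f_ge: "\<And>x. \<alpha> \<le> f x" and fm: "f \<in> borel_measurable borel"
    and weak: "has_weak_gradient f G" and fi: "integrable gaussian f"
    and Gi: "integrable gaussian (\<lambda>x. (norm (G x))\<^sup>2 / f x)"
    and S: "\<And>i y. \<bar>partial_deriv i bump (y :: real ^ 'n)\<bar> \<le> S" and R: "1 \<le> R"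
  obtains F where "smooth_density F \<alpha>"
    and "(\<Sum>i\<in>UNIV. \<integral>x. (partial_deriv i F x)\<^sup>2 / F x \<partial>gaussian)
      \<le> exp ((real CARD('n))\<^sup>2 / R) * ((1 + 1 / R) * (\<integral>x. (norm (G x))\<^sup>2 / f x \<partial>gaussian)
        + (1 + R) * (CARD('n) * (4 * S\<^sup>2 / R\<^sup>2)) * (\<integral>x. f x \<partial>gaussian))"
    and "(\<integral>x. \<bar>F x - f x\<bar> \<partial>gaussian) \<le> 1 / R + (\<integral>x. (1 - cutoff R x) * (f x - \<alpha>) \<partial>gaussian)"
proof -
  note [measurable] = fm
  let ?N = "real CARD('n)"
  have R0: "0 < R" using R by simp
  let ?\<chi> = "cutoff R :: real ^ 'n \<Rightarrow> real"
  note \<chi> = cutoff[OF R0, where 'n = 'n]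
  have [measurable]: "?\<chi> \<in> borel_measurable borel" by (rule bsmooth_borel_measurable[OF \<chi>(1)])
  have d\<chi>_sup: "norm x \<le> ?N * R" if "partial_deriv i ?\<chi> x \<noteq> 0" for i x
    by (rule partial_deriv_eq_0_outside[OF \<chi>(4) that])
  have fl: "locally_integrable f" and Gl: "\<And>i. locally_integrable (\<lambda>x. G x $ i)"
    using weak by (auto simp: has_weak_gradient_def intro: locally_integrable_component)
  have li: "integrable lborel (\<lambda>x. c x * \<psi> x)"
    if c: "locally_integrable c" and \<psi>: "bsmooth \<psi>" and sup: "\<And>x. \<psi> x \<noteq> 0 \<Longrightarrow> norm x \<le> ?N * R" for c \<psi> :: "real ^ 'n \<Rightarrow> real"
  proof -
    obtain B where B: "\<And>x. \<bar>\<psi> x\<bar> \<le> B" using bsmooth_bounded[OF \<psi>] by blast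
    have "integrable lborel (\<lambda>x. (indicator (cball 0 (?N * R)) x * c x) * \<psi> x)"
      by (rule integrable_bounded_mult[OF _ B locally_integrable_cball[OF c]]) (simp add: bsmooth_borel_measurable[OF \<psi>])
    moreover have "(indicator (cball 0 (?N * R)) x * c x) * \<psi> x = c x * \<psi> x" for x
      using sup[of x] by (cases "\<psi> x = 0") auto
    ultimately show ?thesis by (simp only:)
  qed
  have \<chi>i: "integrable lborel \<psi>" if \<psi>: "bsmooth \<psi>" and sup: "\<And>x. \<psi> x \<noteq> 0 \<Longrightarrow> norm x \<le> ?N * R" for \<psi> :: "real ^ 'n \<Rightarrow> real"
    using bsmooth_bounded[OF \<psi>] bsmooth_borel_measurable[OF \<psi>] sup by (auto intro: integrable_bounded_support)
  have fli: "integrable lborel (\<lambda>x. (f x - \<alpha>) * \<psi> x)" if \<psi>: "bsmooth \<psi>" and sup: "\<And>x. \<psi> x \<noteq> 0 \<Longrightarrow> norm x \<le> ?N * R" for \<psi>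
    unfolding left_diff_distrib by (intro Bochner_Integration.integrable_diff integrable_mult_right li[OF fl] \<chi>i \<psi> sup)
  define w where "w x = (f x - \<alpha>) * ?\<chi> x" for x
  have w: "integrable lborel w" unfolding w_def by (rule fli[OF \<chi>(1,4)])
  have w0: "0 \<le> w x" for x using f_ge[of x] \<chi>(2) by (simp add: w_def)
  have [measurable]: "w \<in> borel_measurable borel" unfolding w_def by measurable
  \<comment> \<open>The weak partial derivatives of w; what is proved of them is that mollifying
    them gives the partial derivatives of the mollified w.\<close>
  define q where "q i x = (f x - \<alpha>) * partial_deriv i ?\<chi> x + G x $ i * ?\<chi> x" for i x
  have qi: "integrable lborel (q i)" for i
    unfolding q_def by (intro Bochner_Integration.integrable_add fli li Gl bsmooth_partial_deriv \<chi>(1) d\<chi>_sup \<chi>(4))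
  have [measurable]: "q i \<in> borel_measurable borel" for i using borel_measurable_integrable[OF qi] by simp
  \<comment> \<open>The Fisher integrand of \<alpha> + w, that is, after cutting off and before
    mollifying.\<close>
  define s where "s i x = (q i x)\<^sup>2 / (\<alpha> + w x)" for i x
  have [measurable]: "s i \<in> borel_measurable borel" for i unfolding s_def by measurable
  have s0: "0 \<le> s i x" for i x unfolding s_def using w0[of x] \<alpha> by simp
  have s_sup: "norm x \<le> ?N * R" if "s i x \<noteq> 0" for i x
  proof -
    have "q i x \<noteq> 0" using that by (auto simp: s_def)
    then have "partial_deriv i ?\<chi> x \<noteq> 0 \<or> ?\<chi> x \<noteq> 0" by (auto simp: q_def)
    then show ?thesis using d\<chi>_sup \<chi>(4) by blast
  qed
  have s_le: "s i x \<le> (1 + 1 / R) * ((G x $ i)\<^sup>2 / f x) + (1 + R) * (4 * S\<^sup>2 / R\<^sup>2) * f x" for i x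
  proof (cases "?\<chi> x = 0")
    case True
    have "(partial_deriv i ?\<chi> x)\<^sup>2 \<le> 4 * S\<^sup>2 / R\<^sup>2 * ?\<chi> x" by (rule \<chi>(5)[OF S])
    then have "partial_deriv i ?\<chi> x = 0" using True by simp
    then have "s i x = 0" using True by (simp add: s_def q_def)
    moreover have "0 < f x" using f_ge[of x] \<alpha> by simp
    ultimately show ?thesis using R0 by simp
  next
    case False
    then have c0: "0 < ?\<chi> x" using \<chi>(2)[of x] by simp
    have f0: "0 < f x" using f_ge[of x] \<alpha> by simp
    \<comment> \<open>Here \<alpha> + w is the convex combination of f and \<alpha> with weight
      \<open>?\<chi> x\<close>, hence at least \<open>?\<chi> x * f x\<close>.\<close>
    have qge: "?\<chi> x * f x \<le> \<alpha> + w x"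
      using \<chi>(3)[of x] \<alpha> by (simp add: w_def algebra_simps mult_left_le)
    let ?A = "(f x - \<alpha>) * partial_deriv i ?\<chi> x" and ?B = "G x $ i * ?\<chi> x"
    \<comment> \<open>The large weight goes to the cutoff term, whose factor 1/R^2 still leaves
      O(1/R), while the Fisher term keeps a coefficient tending to 1.\<close>
    have "(A + B)\<^sup>2 \<le> (1 + R) * A\<^sup>2 + (1 + 1 / R) * B\<^sup>2" for A B :: real
    proof -
      have "2 * \<bar>A * B\<bar> \<le> R * A\<^sup>2 + B\<^sup>2 / R" by (rule amgm_weighted[OF R0])
      then show ?thesis using abs_ge_self[of "A * B"] by (simp add: power2_sum distrib_right)
    qed
    then have "s i x \<le> ((1 + R) * ?A\<^sup>2 + (1 + 1 / R) * ?B\<^sup>2) / (?\<chi> x * f x)"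
      unfolding s_def q_def using qge c0 f0 R0 by (intro frac_le) auto
    also have "\<dots> = (1 + R) * (?A\<^sup>2 / (?\<chi> x * f x)) + (1 + 1 / R) * (?B\<^sup>2 / (?\<chi> x * f x))"
      by (simp add: add_divide_distrib)
    also have "\<dots> \<le> (1 + R) * (4 * S\<^sup>2 / R\<^sup>2 * f x) + (1 + 1 / R) * ((G x $ i)\<^sup>2 / f x)"
    proof (intro add_mono mult_left_mono)
      show "?A\<^sup>2 / (?\<chi> x * f x) \<le> 4 * S\<^sup>2 / R\<^sup>2 * f x"
    proof -
      have "?A\<^sup>2 \<le> (f x)\<^sup>2 * (4 * S\<^sup>2 / R\<^sup>2 * ?\<chi> x)"
        unfolding power_mult_distrib using f_ge[of x] \<alpha> by (intro mult_mono \<chi>(5)[OF S] power_mono) auto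
      then have "?A\<^sup>2 / (?\<chi> x * f x) \<le> (f x)\<^sup>2 * (4 * S\<^sup>2 / R\<^sup>2 * ?\<chi> x) / (?\<chi> x * f x)"
        using c0 f0 by (intro divide_right_mono) auto
      also have "\<dots> = 4 * S\<^sup>2 / R\<^sup>2 * f x" using c0 f0 by (simp add: power2_eq_square)
      finally show ?thesis .
    qed
      show "?B\<^sup>2 / (?\<chi> x * f x) \<le> (G x $ i)\<^sup>2 / f x"
    proof -
      have "?B\<^sup>2 / (?\<chi> x * f x) = ?\<chi> x * ((G x $ i)\<^sup>2 / f x)" using c0 f0 by (simp add: power2_eq_square)
      also have "\<dots> \<le> 1 * ((G x $ i)\<^sup>2 / f x)" using f0 by (intro mult_right_mono \<chi>(3)) auto
      finally show ?thesis by simp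
    qed
    qed (use R0 in auto)
    finally show ?thesis by (simp only: mult.assoc add.commute)
  qed
  have sum_s_le: "(\<Sum>i\<in>UNIV. s i x) \<le> (1 + 1 / R) * ((norm (G x))\<^sup>2 / f x) + (1 + R) * (?N * (4 * S\<^sup>2 / R\<^sup>2)) * f x" for x
  proof -
    have "(\<Sum>i\<in>UNIV. s i x) \<le> (\<Sum>i\<in>UNIV. (1 + 1 / R) * ((G x $ i)\<^sup>2 / f x) + (1 + R) * (4 * S\<^sup>2 / R\<^sup>2) * f x)"
      by (intro sum_mono s_le)
    also have "\<dots> = (1 + 1 / R) * ((\<Sum>i\<in>UNIV. (G x $ i)\<^sup>2) / f x) + (1 + R) * (?N * (4 * S\<^sup>2 / R\<^sup>2)) * f x"
      by (simp add: sum.distrib sum_distrib_left[symmetric] sum_divide_distrib[symmetric])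
    also have "(\<Sum>i\<in>UNIV. (G x $ i)\<^sup>2) = (norm (G x))\<^sup>2"
      unfolding power2_norm_eq_inner inner_vec_def by (simp add: power2_eq_square)
    finally show ?thesis .
  qed
  have bi: "integrable gaussian (\<lambda>x. (1 + 1 / R) * ((norm (G x))\<^sup>2 / f x) + (1 + R) * (?N * (4 * S\<^sup>2 / R\<^sup>2)) * f x)"
    by (intro Bochner_Integration.integrable_add integrable_mult_right Gi fi)
  have sgi: "integrable gaussian (s i)" for i
  proof (rule Bochner_Integration.integrable_bound[OF bi])
    show "AE x in gaussian. norm (s i x) \<le> norm ((1 + 1 / R) * ((norm (G x))\<^sup>2 / f x) + (1 + R) * (?N * (4 * S\<^sup>2 / R\<^sup>2)) * f x)"
    proof (rule AE_I2)
      fix x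
      have "s i x \<le> (\<Sum>i\<in>UNIV. s i x)" by (rule member_le_sum) (auto simp: s0)
      with sum_s_le[of x] s0[of i x] show "norm (s i x) \<le> norm ((1 + 1 / R) * ((norm (G x))\<^sup>2 / f x) + (1 + R) * (?N * (4 * S\<^sup>2 / R\<^sup>2)) * f x)"
        by simp
    qed
  qed simp
  have si: "integrable lborel (s i)" for i
  proof -
    have "integrable lborel (\<lambda>x. indicator (cball 0 (?N * R)) x * s i x)" by (rule gaussian_integrable_cball[OF sgi])
    moreover have "indicator (cball 0 (?N * R)) x * s i x = s i x" for x
      using s_sup[of i x] by (cases "s i x = 0") auto
    ultimately show ?thesis by (simp only:)
  qed
  obtain r0 where r0: "0 < r0" "\<And>r. r0 \<le> r \<Longrightarrow> (\<integral>\<^sup>+x. ennreal \<bar>moll r w x - w x\<bar> \<partial>lborel) \<le> ennreal (1 / R)"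
    using moll_L1[OF w, of "1 / R"] R0 by auto
  \<comment> \<open>Beyond L1 closeness, r \<ge> R^2 is imposed so that the mollification radius n/r
    times the support radius n R is at most n^2/R.\<close>
  define r where "r = max r0 (R\<^sup>2)"
  have rp: "0 < r" and rR: "R\<^sup>2 \<le> r" and rr0: "r0 \<le> r" using r0(1) by (auto simp: r_def)
  define F where "F x = \<alpha> + moll r w x" for x
  have Fs: "bsmooth F" unfolding F_def by (intro bsmooth_add bsmooth_const bsmooth_moll rp w)
  have Fge: "\<alpha> \<le> F x" for x
    unfolding F_def moll_def using w0 mol(2)[OF rp, where 'n = 'n] by (simp add: integral_nonneg)
  have dF: "partial_deriv i F x = moll r (q i) x" for i x
  proof -
    have a: "partial_deriv i F x = partial_deriv i (moll r w) x"
    proof (rule partial_deriv_eq)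
      show "(F has_derivative (\<lambda>h. \<Sum>i\<in>UNIV. partial_deriv i (moll r w) x * h $ i)) (at x)"
        unfolding F_def[abs_def]
        by (rule has_derivative_eq_rhs[OF has_derivative_add[OF has_derivative_const bsmooth_has_derivative[OF bsmooth_moll(1)[OF rp w]]]]) simp
    qed
    let ?m = "\<lambda>y. mol r (x - y)" and ?m' = "\<lambda>y. partial_deriv i (mol r) (x - y)"
    note mr = mol_reflect[OF rp, where 'n = 'n]
    have dm: "partial_deriv i ?m = (\<lambda>y. - ?m' y)" using mr(2) by blast
    have bs: "bsmooth (\<lambda>y. - ?m' y)" using bsmooth_partial_deriv[OF mr(1)[of x], of i] unfolding dm .
    \<comment> \<open>Cutoff times reflected mollifier is an admissible test function for the weak
      gradient of f; the constant \<alpha> drops out since the integral of a derivative of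
      \<open>?\<phi>\<close> vanishes.\<close>
    let ?\<phi> = "\<lambda>y. ?\<chi> y * ?m y"
    have \<phi>: "bsmooth ?\<phi>" by (intro bsmooth_mult \<chi>(1) mr(1))
    have \<phi>sup: "norm y \<le> ?N * R" if "?\<phi> y \<noteq> 0" for y using \<chi>(4)[of y] that by auto
    have d\<phi>: "partial_deriv i ?\<phi> y = ?\<chi> y * (- ?m' y) + partial_deriv i ?\<chi> y * ?m y" for y
      unfolding partial_deriv_mult[OF \<chi>(1) mr(1)] dm ..
    have i1: "integrable lborel (\<lambda>y. (f y - \<alpha>) * (?\<chi> y * (- ?m' y)))" "integrable lborel (\<lambda>y. (f y - \<alpha>) * (partial_deriv i ?\<chi> y * ?m y))"
      by (intro fli bsmooth_mult \<chi>(1) bs mr(1) bsmooth_partial_deriv; use \<chi>(4) d\<chi>_sup in force)+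
    have i2: "integrable lborel (\<lambda>y. G y $ i * ?\<phi> y)" by (intro li Gl \<phi> \<phi>sup)
    have "(\<integral>y. f y * partial_deriv i ?\<phi> y \<partial>lborel) = - (\<integral>y. G y $ i * ?\<phi> y \<partial>lborel)"
      using weak test_functionI[OF \<phi> \<phi>sup] unfolding has_weak_gradient_def by blast
    moreover have "(\<integral>y. partial_deriv i ?\<phi> y \<partial>lborel) = 0"
      by (rule integral_partial_deriv_test[OF \<phi> \<phi>sup])
    moreover have "integrable lborel (\<lambda>y. f y * partial_deriv i ?\<phi> y)" "integrable lborel (partial_deriv i ?\<phi>)"
    proof -
      have "norm y \<le> ?N * R" if "partial_deriv i ?\<phi> y \<noteq> 0" for y
        by (rule partial_deriv_eq_0_outside[of ?\<phi>, OF \<phi>sup that])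
      note sup' = this
      show "integrable lborel (\<lambda>y. f y * partial_deriv i ?\<phi> y)"
        by (rule li[OF fl bsmooth_partial_deriv[OF \<phi>] sup'])
      show "integrable lborel (partial_deriv i ?\<phi>)"
        by (rule \<chi>i[OF bsmooth_partial_deriv[OF \<phi>] sup'])
    qed
    ultimately have "(\<integral>y. f y * partial_deriv i ?\<phi> y - \<alpha> * partial_deriv i ?\<phi> y \<partial>lborel) = - (\<integral>y. G y $ i * ?\<phi> y \<partial>lborel)"
      by simp
    also have "(\<integral>y. f y * partial_deriv i ?\<phi> y - \<alpha> * partial_deriv i ?\<phi> y \<partial>lborel)
        = (\<integral>y. (f y - \<alpha>) * (?\<chi> y * (- ?m' y)) + (f y - \<alpha>) * (partial_deriv i ?\<chi> y * ?m y) \<partial>lborel)"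
      unfolding d\<phi> by (intro Bochner_Integration.integral_cong refl) (simp add: algebra_simps)
    also have "\<dots> = - (\<integral>y. w y * ?m' y \<partial>lborel) + (\<integral>y. (f y - \<alpha>) * (partial_deriv i ?\<chi> y * ?m y) \<partial>lborel)"
      using i1 by (simp add: w_def mult.assoc)
    finally have "(\<integral>y. w y * ?m' y \<partial>lborel) = (\<integral>y. (f y - \<alpha>) * (partial_deriv i ?\<chi> y * ?m y) \<partial>lborel) + (\<integral>y. G y $ i * ?\<phi> y \<partial>lborel)"
      by simp
    also have "\<dots> = (\<integral>y. (f y - \<alpha>) * (partial_deriv i ?\<chi> y * ?m y) + G y $ i * ?\<phi> y \<partial>lborel)"
      using i1 i2 by simp
    also have "\<dots> = moll r (q i) x"
      unfolding moll_def q_def by (intro Bochner_Integration.integral_cong refl) (simp add: algebra_simps)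
    finally show ?thesis unfolding a bsmooth_moll(2)[OF rp w] .
  qed
  have cs: "(partial_deriv i F x)\<^sup>2 / F x \<le> moll r (s i) x" for i x
  proof -
    let ?m = "\<lambda>y. mol r (x - y)"
    note mi = mol_reflect_integral[OF rp, of x]
    note iq = moll_integrable(1)[OF rp qi, of i x] and iw = moll_integrable(1)[OF rp w, of x] and iss = moll_integrable(1)[OF rp si, of i x]
    \<comment> \<open>Joint convexity in dual form: q^2/w is the supremum over l of 2 l q - l^2 w.
      The slope attaining it for the averaged quantities is used as a competitor at every y.\<close>
    define l where "l = partial_deriv i F x / F x"
    have Fp: "0 < F x" using Fge[of x] \<alpha> by simp
    have "(partial_deriv i F x)\<^sup>2 / F x = 2 * l * partial_deriv i F x - l\<^sup>2 * F x"
      using Fp by (simp add: l_def power2_eq_square field_simps)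
    also have "\<dots> = (\<integral>y. 2 * l * (q i y * ?m y) - (l\<^sup>2 * \<alpha>) * ?m y - l\<^sup>2 * (w y * ?m y) \<partial>lborel)"
      unfolding dF F_def moll_def using mi(1,2) iq iw by (simp add: distrib_left)
    also have "\<dots> \<le> (\<integral>y. s i y * ?m y \<partial>lborel)"
    proof (rule integral_mono)
      fix y
      have qp: "0 < \<alpha> + w y" using w0[of y] \<alpha> by simp
      have "0 \<le> (q i y - l * (\<alpha> + w y))\<^sup>2 / (\<alpha> + w y)" using qp by simp
      also have "\<dots> = s i y - 2 * l * q i y + l\<^sup>2 * (\<alpha> + w y)"
        unfolding s_def using qp by (simp add: power2_diff field_simps) (simp add: power2_eq_square algebra_simps)
      finally have "2 * l * q i y - l\<^sup>2 * (\<alpha> + w y) \<le> s i y" by simp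
      then have "(2 * l * q i y - l\<^sup>2 * (\<alpha> + w y)) * ?m y \<le> s i y * ?m y"
        by (intro mult_right_mono mol(2) rp)
      then show "2 * l * (q i y * ?m y) - (l\<^sup>2 * \<alpha>) * ?m y - l\<^sup>2 * (w y * ?m y) \<le> s i y * ?m y"
        by (simp add: algebra_simps)
    qed (use mi iq iw iss in auto)
    finally show ?thesis unfolding moll_def .
  qed
  let ?E = "exp (?N\<^sup>2 / R)"
  have moll_s: "(\<integral>x. moll r (s i) x \<partial>gaussian) \<le> ?E * (\<integral>x. s i x \<partial>gaussian)" for i
  proof -
    have sm: "bsmooth (moll r (s i))" by (rule bsmooth_moll[OF rp si])
    have [measurable]: "(mol r :: real ^ 'n \<Rightarrow> real) \<in> borel_measurable borel" by (rule bsmooth_borel_measurable[OF mol(1)[OF rp]])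
    have ms0: "0 \<le> moll r (s i) x" for x unfolding moll_def using s0 mol(2)[OF rp, where 'n = 'n] by (simp add: integral_nonneg)
    have ms: "ennreal (moll r (s i) x) = (\<integral>\<^sup>+y. ennreal (s i y * mol r (x - y)) \<partial>lborel)" for x
      unfolding moll_def using moll_integrable(1)[OF rp si, of i x] s0 mol(2)[OF rp, where 'n = 'n]
      by (intro nn_integral_eq_integral[symmetric]) auto
    have "ennreal (\<integral>x. moll r (s i) x \<partial>gaussian) = (\<integral>\<^sup>+x. ennreal (moll r (s i) x) \<partial>gaussian)"
      using ms0 by (intro nn_integral_eq_integral[symmetric] bsmooth_integrable sm) auto
    also have "\<dots> = (\<integral>\<^sup>+x. ennreal (gauss_density x) * (\<integral>\<^sup>+y. ennreal (s i y * mol r (x - y)) \<partial>lborel) \<partial>lborel)"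
      unfolding ms[symmetric] using bsmooth_borel_measurable[OF sm] by (intro nn_integral_gaussian) simp
    also have "\<dots> = (\<integral>\<^sup>+x. (\<integral>\<^sup>+y. ennreal (gauss_density x) * ennreal (s i y * mol r (x - y)) \<partial>lborel) \<partial>lborel)"
      by (intro nn_integral_cong nn_integral_cmult[symmetric]) simp
    also have "\<dots> = (\<integral>\<^sup>+y. (\<integral>\<^sup>+x. ennreal (gauss_density x) * ennreal (s i y * mol r (x - y)) \<partial>lborel) \<partial>lborel)"
      by (rule lborel_pair.Fubini') simp
    also have "\<dots> \<le> (\<integral>\<^sup>+y. ennreal ?E * (ennreal (gauss_density y) * ennreal (s i y)) \<partial>lborel)"
    proof (rule nn_integral_mono)
      fix y :: "real ^ 'n"
      have "(\<integral>\<^sup>+x. ennreal (gauss_density x) * ennreal (s i y * mol r (x - y)) \<partial>lborel)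
          \<le> (\<integral>\<^sup>+x. ennreal (?E * gauss_density y * s i y) * ennreal (mol r (x - y)) \<partial>lborel)"
      proof (rule nn_integral_mono)
        fix x
        have "gauss_density x * (s i y * mol r (x - y)) \<le> ?E * gauss_density y * s i y * mol r (x - y)"
        proof (cases "s i y * mol r (x - y) = 0")
          case False
          have "gauss_density x \<le> exp (?N / r * (?N * R)) * gauss_density y"
            using False s_sup[of i y] mol(3)[OF rp, of "x - y"] rp by (intro gauss_density_ratio) auto
          also have "\<dots> \<le> ?E * gauss_density y"
          proof -
            have "?N / r * (?N * R) = ?N\<^sup>2 * (R / r)" by (simp add: power2_eq_square)
            also have "\<dots> \<le> ?N\<^sup>2 * (1 / R)"
              using rR rp R0 by (intro mult_left_mono) (auto simp: divide_simps power2_eq_square)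
            finally show ?thesis using gauss_density_pos[of y] by (intro mult_right_mono) auto
          qed
          finally have "gauss_density x * (s i y * mol r (x - y)) \<le> (?E * gauss_density y) * (s i y * mol r (x - y))"
            using s0[of i y] mol(2)[OF rp, of "x - y"] by (intro mult_right_mono) auto
          then show ?thesis by (simp only: mult.assoc)
        qed (auto)
        then have "ennreal (gauss_density x * (s i y * mol r (x - y))) \<le> ennreal (?E * gauss_density y * s i y * mol r (x - y))"
          by (rule ennreal_leI)
        then show "ennreal (gauss_density x) * ennreal (s i y * mol r (x - y)) \<le> ennreal (?E * gauss_density y * s i y) * ennreal (mol r (x - y))"
          using s0[of i y] mol(2)[OF rp, of "x - y"] gauss_density_pos[of x] gauss_density_pos[of y]
          by (simp add: ennreal_mult[symmetric])
      qed
      also have "\<dots> = ennreal (?E * gauss_density y * s i y) * (\<integral>\<^sup>+x. ennreal (mol r (x - y)) \<partial>lborel)"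
        by (rule nn_integral_cmult) simp
      also have "\<dots> = ennreal ?E * (ennreal (gauss_density y) * ennreal (s i y))"
        using s0[of i y] gauss_density_pos[of y] by (simp add: mol_reflect_integral(3)[OF rp] ennreal_mult[symmetric] mult.assoc)
      finally show "(\<integral>\<^sup>+x. ennreal (gauss_density x) * ennreal (s i y * mol r (x - y)) \<partial>lborel) \<le> ennreal ?E * (ennreal (gauss_density y) * ennreal (s i y))" .
    qed
    also have "\<dots> = ennreal ?E * (\<integral>\<^sup>+y. ennreal (s i y) \<partial>gaussian)"
      by (subst nn_integral_cmult) (simp_all add: nn_integral_gaussian)
    also have "(\<integral>\<^sup>+y. ennreal (s i y) \<partial>gaussian) = ennreal (\<integral>y. s i y \<partial>gaussian)"
      using s0 by (intro nn_integral_eq_integral sgi) auto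
    finally show ?thesis
      using s0 by (simp add: ennreal_mult[symmetric] integral_nonneg)
  qed
  show ?thesis
  proof (rule that[of F])
    show sd: "smooth_density F \<alpha>" by unfold_locales (use Fs \<alpha> Fge in auto)
    have "(\<Sum>i\<in>UNIV. \<integral>x. (partial_deriv i F x)\<^sup>2 / F x \<partial>gaussian) \<le> (\<Sum>i\<in>UNIV. ?E * (\<integral>x. s i x \<partial>gaussian))"
    proof (rule sum_mono)
      fix i
      have "(\<integral>x. (partial_deriv i F x)\<^sup>2 / F x \<partial>gaussian) \<le> (\<integral>x. moll r (s i) x \<partial>gaussian)"
      proof (rule integral_mono)
        show "integrable gaussian (\<lambda>x. (partial_deriv i F x)\<^sup>2 / F x)"
          unfolding power2_eq_square by (intro bsmooth_integrable bsmooth_divide[OF _ Fs \<alpha> Fge] bsmooth_mult bsmooth_partial_deriv Fs)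
      qed (use cs bsmooth_integrable[OF bsmooth_moll(1)[OF rp si]] in auto)
      with moll_s[of i] show "(\<integral>x. (partial_deriv i F x)\<^sup>2 / F x \<partial>gaussian) \<le> ?E * (\<integral>x. s i x \<partial>gaussian)" by linarith
    qed
    also have "\<dots> = ?E * (\<integral>x. (\<Sum>i\<in>UNIV. s i x) \<partial>gaussian)"
      by (simp add: Bochner_Integration.integral_sum sgi sum_distrib_left)
    also have "\<dots> \<le> ?E * (\<integral>x. (1 + 1 / R) * ((norm (G x))\<^sup>2 / f x) + (1 + R) * (?N * (4 * S\<^sup>2 / R\<^sup>2)) * f x \<partial>gaussian)"
      by (intro mult_left_mono integral_mono Bochner_Integration.integrable_sum sgi bi sum_s_le) simp
    also have "(\<integral>x. (1 + 1 / R) * ((norm (G x))\<^sup>2 / f x) + (1 + R) * (?N * (4 * S\<^sup>2 / R\<^sup>2)) * f x \<partial>gaussian)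
        = (1 + 1 / R) * (\<integral>x. (norm (G x))\<^sup>2 / f x \<partial>gaussian) + (1 + R) * (?N * (4 * S\<^sup>2 / R\<^sup>2)) * (\<integral>x. f x \<partial>gaussian)"
      by (simp only: Bochner_Integration.integral_add integrable_mult_right Gi fi integral_mult_right_zero)
    finally show "(\<Sum>i\<in>UNIV. \<integral>x. (partial_deriv i F x)\<^sup>2 / F x \<partial>gaussian)
      \<le> ?E * ((1 + 1 / R) * (\<integral>x. (norm (G x))\<^sup>2 / f x \<partial>gaussian) + (1 + R) * (?N * (4 * S\<^sup>2 / R\<^sup>2)) * (\<integral>x. f x \<partial>gaussian))" .
    let ?T = "\<lambda>x. (1 - ?\<chi> x) * (f x - \<alpha>)"
    have Ti: "integrable gaussian ?T"
    proof -
      have "\<bar>1 - ?\<chi> x\<bar> \<le> 1" for x using \<chi>(2,3)[of x] by simp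
      then show ?thesis using fi by (intro integrable_mult_bounded[where M = 1]) auto
    qed
    have [measurable]: "moll r w \<in> borel_measurable borel" by (rule bsmooth_borel_measurable[OF bsmooth_moll(1)[OF rp w]])
    have "(\<integral>\<^sup>+x. ennreal \<bar>moll r w x - w x\<bar> \<partial>gaussian) \<le> (\<integral>\<^sup>+x. ennreal \<bar>moll r w x - w x\<bar> \<partial>lborel)"
      unfolding nn_integral_gaussian[of "\<lambda>x. ennreal \<bar>moll r w x - w x\<bar>", simplified]
    proof (rule nn_integral_mono)
      fix x :: "real ^ 'n"
      have "ennreal (gauss_density x) * ennreal \<bar>moll r w x - w x\<bar> \<le> 1 * ennreal \<bar>moll r w x - w x\<bar>"
        using gauss_density_le_1[of x] by (intro mult_right_mono) auto
      then show "ennreal (gauss_density x) * ennreal \<bar>moll r w x - w x\<bar> \<le> ennreal \<bar>moll r w x - w x\<bar>" by simp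
    qed
    then have le: "(\<integral>\<^sup>+x. ennreal \<bar>moll r w x - w x\<bar> \<partial>gaussian) \<le> ennreal (1 / R)"
      using r0(2)[OF rr0] by (rule order_trans)
    have di: "integrable gaussian (\<lambda>x. \<bar>moll r w x - w x\<bar>)"
      using le_less_trans[OF le] by (intro integrableI_nonneg) auto
    have "(\<integral>x. \<bar>moll r w x - w x\<bar> \<partial>gaussian) \<le> 1 / R"
      using le R0 by (subst (asm) nn_integral_eq_integral[OF di]) auto
    moreover have "(\<integral>x. \<bar>F x - f x\<bar> \<partial>gaussian) \<le> (\<integral>x. \<bar>moll r w x - w x\<bar> + ?T x \<partial>gaussian)"
    proof (rule integral_mono)
      fix x
      have "F x - f x = (moll r w x - w x) - ?T x" by (simp add: F_def w_def algebra_simps)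
      moreover have "0 \<le> ?T x" using \<chi>(3)[of x] f_ge[of x] by simp
      ultimately show "\<bar>F x - f x\<bar> \<le> \<bar>moll r w x - w x\<bar> + ?T x" by linarith
    qed (use fi bsmooth_integrable[OF Fs] di Ti in auto)
    ultimately show "(\<integral>x. \<bar>F x - f x\<bar> \<partial>gaussian) \<le> 1 / R + (\<integral>x. ?T x \<partial>gaussian)"
      using di Ti by simp
  qed
qed

section \<open>Stability\<close>

text \<open>The one-step approximation at R = k + 1. The Fisher informations need not converge; an
  upper bound with the right limit is enough for estimating deficits from above.\<close>

lemma smooth_approximation:
  fixes f :: "real ^ 'n \<Rightarrow> real"
  assumes \<alpha>: "0 < \<alpha>" and f_ge: "\<And>x. \<alpha> \<le> f x" and fm: "f \<in> borel_measurable borel"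
    and weak: "has_weak_gradient f G" and fi: "integrable gaussian f"
    and Gi: "integrable gaussian (\<lambda>x. (norm (G x))\<^sup>2 / f x)"
  obtains F I where "\<And>k :: nat. smooth_density (F k) \<alpha>"
    and "\<And>k. (\<Sum>i\<in>UNIV. \<integral>x. (partial_deriv i (F k) x)\<^sup>2 / F k x \<partial>gaussian) \<le> I k"
    and "I \<longlonglongrightarrow> (\<integral>x. (norm (G x))\<^sup>2 / f x \<partial>gaussian)"
    and "(\<lambda>k. \<integral>x. \<bar>F k x - f x\<bar> \<partial>gaussian) \<longlonglongrightarrow> 0"
proof -
  have "\<exists>M. \<forall>y :: real ^ 'n. \<bar>partial_deriv i bump y\<bar> \<le> M" for i
    using bsmooth_bounded[OF bsmooth_partial_deriv[OF bump(1)]] .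
  then obtain M where M: "\<And>i (y :: real ^ 'n). \<bar>partial_deriv i bump y\<bar> \<le> M i" by metis
  define S where "S = (\<Sum>i\<in>(UNIV :: 'n set). M i)"
  have S: "\<bar>partial_deriv i bump y\<bar> \<le> S" for i and y :: "real ^ 'n"
  proof -
    have "M i \<le> S" unfolding S_def by (rule member_le_sum) (use order_trans[OF abs_ge_zero M] in auto)
    then show ?thesis using M[of i y] by simp
  qed
  let ?N = "real CARD('n)" and ?I0 = "\<integral>x. (norm (G x))\<^sup>2 / f x \<partial>gaussian"
  define I where "I k = exp (?N\<^sup>2 / real (Suc k)) * ((1 + 1 / real (Suc k)) * ?I0
        + (1 + real (Suc k)) * (?N * (4 * S\<^sup>2 / (real (Suc k))\<^sup>2)) * (\<integral>x. f x \<partial>gaussian))" for k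
  define T where "T k = (\<integral>x. (1 - cutoff (real (Suc k)) x) * (f x - \<alpha>) \<partial>gaussian)" for k
  have ex: "\<exists>F. smooth_density F \<alpha> \<and> (\<Sum>i\<in>UNIV. \<integral>x. (partial_deriv i F x)\<^sup>2 / F x \<partial>gaussian) \<le> I k
      \<and> (\<integral>x. \<bar>F x - f x\<bar> \<partial>gaussian) \<le> 1 / real (Suc k) + T k" for k
  proof -
    have "1 \<le> real (Suc k)" by simp
    then show ?thesis
      unfolding I_def T_def by (rule smooth_approximation_step[OF \<alpha> f_ge fm weak fi Gi S]) blast
  qed
  obtain F where "\<forall>k. smooth_density (F k) \<alpha> \<and> (\<Sum>i\<in>UNIV. \<integral>x. (partial_deriv i (F k) x)\<^sup>2 / F k x \<partial>gaussian) \<le> I k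
      \<and> (\<integral>x. \<bar>F k x - f x\<bar> \<partial>gaussian) \<le> 1 / real (Suc k) + T k"
    using choice[OF allI[OF ex]] by (rule exE)
  then have F: "\<And>k. smooth_density (F k) \<alpha>"
    "\<And>k. (\<Sum>i\<in>UNIV. \<integral>x. (partial_deriv i (F k) x)\<^sup>2 / F k x \<partial>gaussian) \<le> I k"
    "\<And>k. (\<integral>x. \<bar>F k x - f x\<bar> \<partial>gaussian) \<le> 1 / real (Suc k) + T k" by simp_all
  have inv: "(\<lambda>k. 1 / real (Suc k)) \<longlonglongrightarrow> 0"
    using LIMSEQ_inverse_real_of_nat by (simp add: inverse_eq_divide)
  have "I \<longlonglongrightarrow> ?I0"
  proof -
    \<comment> \<open>In terms of t = 1/R the bound is a continuous function at t = 0, as (1 +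
      R)/R^2 = t^2 + t.\<close>
    define g where "g t = exp (?N\<^sup>2 * t) * ((1 + t) * ?I0 + (t\<^sup>2 + t) * (?N * (4 * S\<^sup>2)) * (\<integral>x. f x \<partial>gaussian))" for t
    have "isCont g 0" unfolding g_def by (intro continuous_intros)
    from isCont_tendsto_compose[OF this inv] have "(\<lambda>k. g (1 / real (Suc k))) \<longlonglongrightarrow> ?I0"
      by (simp add: g_def)
    moreover have "g (1 / real (Suc k)) = I k" for k
    proof -
      have "(1 / real (Suc k))\<^sup>2 + 1 / real (Suc k) = (1 + real (Suc k)) * (1 / (real (Suc k))\<^sup>2)"
        by (simp add: field_simps power2_eq_square del: of_nat_Suc)
      then have "((1 / real (Suc k))\<^sup>2 + 1 / real (Suc k)) * (?N * (4 * S\<^sup>2)) = (1 + real (Suc k)) * (?N * (4 * S\<^sup>2 / (real (Suc k))\<^sup>2))"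
        by (simp only:) simp
      then show ?thesis unfolding g_def I_def by (simp only: times_divide_eq_right mult_1_right)
    qed
    ultimately show ?thesis by simp
  qed
  moreover have "(\<lambda>k. \<integral>x. \<bar>F k x - f x\<bar> \<partial>gaussian) \<longlonglongrightarrow> 0"
  proof -
    have "T \<longlonglongrightarrow> (\<integral>(x :: real ^ 'n). 0 \<partial>gaussian)"
      unfolding T_def[abs_def]
    proof (rule integral_dominated_convergence[where w = "\<lambda>x. \<bar>f x\<bar> + \<alpha>"])
      show "(\<lambda>x. (1 - cutoff (real (Suc k)) x) * (f x - \<alpha>)) \<in> borel_measurable gaussian" for k
        using bsmooth_borel_measurable[OF cutoff(1)[of "real (Suc k)", where 'n = 'n]] fm by simp
      show "AE x in gaussian. (\<lambda>k. (1 - cutoff (real (Suc k)) x) * (f x - \<alpha>)) \<longlonglongrightarrow> 0"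
      proof (rule AE_I2)
        fix x :: "real ^ 'n"
        have "(\<lambda>k. (1 - cutoff (real (Suc k)) x) * (f x - \<alpha>)) \<longlonglongrightarrow> (1 - 1) * (f x - \<alpha>)"
          by (intro tendsto_intros cutoff_tendsto)
        then show "(\<lambda>k. (1 - cutoff (real (Suc k)) x) * (f x - \<alpha>)) \<longlonglongrightarrow> 0" by simp
      qed
      show "AE x in gaussian. norm ((1 - cutoff (real (Suc k)) x) * (f x - \<alpha>)) \<le> \<bar>f x\<bar> + \<alpha>" for k
      proof (rule AE_I2)
        fix x :: "real ^ 'n"
        have "\<bar>1 - cutoff (real (Suc k)) x\<bar> * \<bar>f x - \<alpha>\<bar> \<le> 1 * (\<bar>f x\<bar> + \<alpha>)"
          using cutoff(2,3)[of "real (Suc k)" x] \<alpha> by (intro mult_mono) auto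
        then show "norm ((1 - cutoff (real (Suc k)) x) * (f x - \<alpha>)) \<le> \<bar>f x\<bar> + \<alpha>" by (simp add: abs_mult)
      qed
    qed (use fi in auto)
    then have "(\<lambda>k. 1 / real (Suc k) + T k) \<longlonglongrightarrow> 0 + 0" by (intro tendsto_add inv) simp
    then have lim: "(\<lambda>k. 1 / real (Suc k) + T k) \<longlonglongrightarrow> 0" by simp
    show ?thesis
    proof (rule tendsto_sandwich[OF _ _ tendsto_const lim])
      show "\<forall>\<^sub>F k in sequentially. (\<integral>x. \<bar>F k x - f x\<bar> \<partial>gaussian) \<le> 1 / real (Suc k) + T k"
        by (intro always_eventually allI F(3))
    qed simp
  qed
  ultimately show ?thesis using that F(1,2) by blast
qed

lemma resid_diff:
  assumes "integrable gaussian \<phi>" "integrable gaussian \<psi>"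
  shows "resid (\<lambda>x. \<phi> x - \<psi> x) x = resid \<phi> x - resid \<psi> x"
proof -
  have "slope (\<lambda>x. \<phi> x - \<psi> x) = slope \<phi> - slope \<psi>"
    using integrable_arctan_mult[OF assms(1)] integrable_arctan_mult[OF assms(2)]
    by (simp add: vec_eq_iff slope_def right_diff_distrib diff_divide_distrib)
  then show ?thesis using assms by (simp add: resid_def inner_diff_left)
qed

text \<open>From ln \<alpha> \<le> ln f \<le> f - 1: the upper side is paid for by the mass, the
  lower one by |ln \<alpha>|.\<close>

lemma ln_integrable:
  fixes f :: "real ^ 'n \<Rightarrow> real"
  assumes \<alpha>: "0 < \<alpha>" and f_ge: "\<And>x. \<alpha> \<le> f x" and fi: "integrable gaussian f"
  shows "integrable gaussian (\<lambda>x. ln (f x))"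
    and "(\<integral>x. \<bar>ln (f x)\<bar> \<partial>gaussian) \<le> (\<integral>x. f x \<partial>gaussian) - 1 + 2 * \<bar>ln \<alpha>\<bar>"
proof -
  have fm [measurable]: "f \<in> borel_measurable borel" using borel_measurable_integrable[OF fi] by simp
  have b: "\<bar>ln (f x)\<bar> \<le> (f x - 1) + 2 * \<bar>ln \<alpha>\<bar>" for x
  proof -
    have "0 < f x" using f_ge[of x] \<alpha> by simp
    then have "ln \<alpha> \<le> ln (f x)" "ln (f x) \<le> f x - 1" using \<alpha> f_ge[of x] ln_le_minus_one by auto
    then show ?thesis by linarith
  qed
  show i: "integrable gaussian (\<lambda>x. ln (f x))"
  proof (rule Bochner_Integration.integrable_bound)
    show "integrable gaussian (\<lambda>x. (f x - 1) + 2 * \<bar>ln \<alpha>\<bar>)" using fi by simp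
    show "AE x in gaussian. norm (ln (f x)) \<le> norm ((f x - 1) + 2 * \<bar>ln \<alpha>\<bar>)"
    proof (rule AE_I2)
      fix x show "norm (ln (f x)) \<le> norm ((f x - 1) + 2 * \<bar>ln \<alpha>\<bar>)"
        using b[of x] by simp
    qed
  qed simp
  have "(\<integral>x. \<bar>ln (f x)\<bar> \<partial>gaussian) \<le> (\<integral>x. (f x - 1) + 2 * \<bar>ln \<alpha>\<bar> \<partial>gaussian)"
    by (rule integral_mono) (use b i fi in auto)
  then show "(\<integral>x. \<bar>ln (f x)\<bar> \<partial>gaussian) \<le> (\<integral>x. f x \<partial>gaussian) - 1 + 2 * \<bar>ln \<alpha>\<bar>"
    using fi by simp
qed

text \<open>From ln (1/t) \<le> 1/t - 1. The uniform lower bound makes the entropy integrand plus 1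
  nonnegative, as Fatou's lemma requires.\<close>

lemma entropy_integrand_ge: "0 < t \<Longrightarrow> - 1 \<le> t * ln t" for t :: real
proof -
  assume t: "0 < t"
  have "ln (1 / t) \<le> 1 / t - 1" using t by (intro ln_le_minus_one) simp
  then have "1 - 1 / t \<le> ln t" using t by (simp add: ln_div)
  then have "t * (1 - 1 / t) \<le> t * ln t" using t by (intro mult_left_mono) auto
  then show ?thesis using t by (simp add: algebra_simps)
qed

text \<open>Solving the smooth estimate for the entropy gives an upper bound on the entropies of the
  approximations, so that Fatou's lemma simultaneously yields the logarithmic Sobolev inequality,
  hence the integrability of \<open>f ln f\<close>, and the stability estimate for \<open>f\<close>.\<close>

lemma sobolev_stability:
  fixes f :: "real ^ 'n \<Rightarrow> real"
  assumes \<alpha>: "0 < \<alpha>" and f_ge: "\<And>x. \<alpha> \<le> f x" and fm: "f \<in> borel_measurable borel"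
    and weak: "has_weak_gradient f G" and fi: "integrable gaussian f" and mass: "(\<integral>x. f x \<partial>gaussian) = 1"
    and Gi: "integrable gaussian (\<lambda>x. (norm (G x))\<^sup>2 / f x)"
    and \<eta>: "0 < \<eta>" "\<eta> \<le> 1"
  shows "(\<integral>x. \<bar>resid (\<lambda>x. ln (f x)) x\<bar> \<partial>gaussian) \<le> stability_const CARD('n) \<alpha> *
    (\<eta> + ((\<integral>x. (norm (G x))\<^sup>2 / f x \<partial>gaussian) / 2 - (\<integral>x. f x * ln (f x) \<partial>gaussian)) / \<eta>)"
proof -
  note [measurable] = fm
  let ?C = "stability_const (real CARD('n)) \<alpha>" and ?K = "4 * real CARD('n) + 2"
  let ?I0 = "\<integral>x. (norm (G x))\<^sup>2 / f x \<partial>gaussian"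
  have C: "0 < ?C" using \<alpha> by (intro stability_const_pos) auto
  obtain F I where F: "\<And>k :: nat. smooth_density (F k) \<alpha>"
    and FI: "\<And>k. (\<Sum>i\<in>UNIV. \<integral>x. (partial_deriv i (F k) x)\<^sup>2 / F k x \<partial>gaussian) \<le> I k"
    and I: "I \<longlonglongrightarrow> ?I0" and L1: "(\<lambda>k. \<integral>x. \<bar>F k x - f x\<bar> \<partial>gaussian) \<longlonglongrightarrow> 0"
    using smooth_approximation[OF \<alpha> f_ge fm weak fi Gi] by blast
  have Fs: "bsmooth (F k)" and Fge: "\<alpha> \<le> F k x" for k x using F[of k] by (auto simp: smooth_density_def)
  have Fi: "integrable gaussian (F k)" for k by (rule bsmooth_integrable[OF Fs])
  have [measurable]: "F k \<in> borel_measurable borel" for k by (rule bsmooth_borel_measurable[OF Fs])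
  define m where "m k = (\<integral>x. F k x \<partial>gaussian)" for k
  define d where "d k = (\<integral>x. \<bar>F k x - f x\<bar> \<partial>gaussian)" for k
  define H where "H k = (\<integral>x. F k x * ln (F k x) \<partial>gaussian)" for k
  define x where "x = (\<integral>x. \<bar>resid (\<lambda>x. ln (f x)) x\<bar> \<partial>gaussian)"
  have m: "m \<longlonglongrightarrow> 1"
  proof -
    have "\<bar>m k - 1\<bar> \<le> d k" for k
    proof -
      have "m k - 1 = (\<integral>x. F k x - f x \<partial>gaussian)" using Fi fi mass by (simp add: m_def)
      then show ?thesis unfolding d_def using integral_abs_bound by metis
    qed
    then have "(\<lambda>k. m k - 1) \<longlonglongrightarrow> 0"
      using L1 unfolding d_def[symmetric] by (intro tendsto_0_le[OF L1[folded d_def], of _ 1]) (auto intro!: always_eventually order_trans[OF _ abs_ge_self])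
    then show ?thesis by (simp add: LIM_zero_iff)
  qed
  \<comment> \<open>The residual is linear and bounded on L1, and ln is Lipschitz with constant
    1/\<alpha> above \<alpha>, so L1 convergence of the densities passes to the residuals of their
    logarithms.\<close>
  have x_le: "x \<le> (\<integral>x. \<bar>resid (\<lambda>x. ln (F k x)) x\<bar> \<partial>gaussian) + ?K / \<alpha> * d k" for k
  proof -
    note lf = ln_integrable(1)[OF \<alpha> f_ge fi] and lF = ln_integrable(1)[OF \<alpha> Fge Fi, of k]
    have rd: "resid (\<lambda>x. ln (f x) - ln (F k x)) y = resid (\<lambda>x. ln (f x)) y - resid (\<lambda>x. ln (F k x)) y" for y
      by (rule resid_diff[OF lf lF])
    have ld: "integrable gaussian (\<lambda>x. ln (f x) - ln (F k x))" by (intro Bochner_Integration.integrable_diff lf lF)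
    have "x \<le> (\<integral>y. \<bar>resid (\<lambda>x. ln (F k x)) y\<bar> + \<bar>resid (\<lambda>x. ln (f x) - ln (F k x)) y\<bar> \<partial>gaussian)"
      unfolding x_def by (rule integral_mono)
        (use resid_integrable[OF lf] resid_integrable[OF lF] resid_integrable[OF ld] in \<open>auto simp: rd\<close>)
    also have "\<dots> = (\<integral>x. \<bar>resid (\<lambda>x. ln (F k x)) x\<bar> \<partial>gaussian) + (\<integral>y. \<bar>resid (\<lambda>x. ln (f x) - ln (F k x)) y\<bar> \<partial>gaussian)"
      using resid_integrable[OF lF] resid_integrable[OF ld] by simp
    finally have 1: "x \<le> (\<integral>x. \<bar>resid (\<lambda>x. ln (F k x)) x\<bar> \<partial>gaussian) + (\<integral>y. \<bar>resid (\<lambda>x. ln (f x) - ln (F k x)) y\<bar> \<partial>gaussian)" .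
    have "(\<integral>x. \<bar>ln (f x) - ln (F k x)\<bar> \<partial>gaussian) \<le> (\<integral>x. \<bar>F k x - f x\<bar> / \<alpha> \<partial>gaussian)"
    proof (rule integral_mono)
      have lip: "ln s - ln t \<le> \<bar>t - s\<bar> / \<alpha>" if "\<alpha> \<le> s" "\<alpha> \<le> t" for s t
      proof -
        have "ln s - ln t = ln (s / t)" using that \<alpha> by (simp add: ln_div)
        also have "\<dots> \<le> s / t - 1" using that \<alpha> by (intro ln_le_minus_one) simp
        also have "\<dots> = (s - t) / t" using that \<alpha> by (simp add: diff_divide_distrib)
        also have "\<dots> \<le> \<bar>t - s\<bar> / t" using that \<alpha> by (intro divide_right_mono) auto
        also have "\<dots> \<le> \<bar>t - s\<bar> / \<alpha>" using that \<alpha> by (intro frac_le) auto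
        finally show ?thesis .
      qed
      show "\<bar>ln (f x) - ln (F k x)\<bar> \<le> \<bar>F k x - f x\<bar> / \<alpha>" for x
        using lip[OF f_ge Fge, of x k x] lip[OF Fge f_ge, of k x x] by (simp add: abs_le_iff abs_minus_commute)
    qed (use ld Fi fi in auto)
    also have "\<dots> = d k / \<alpha>" by (simp add: d_def)
    finally have "?K * (\<integral>x. \<bar>ln (f x) - ln (F k x)\<bar> \<partial>gaussian) \<le> ?K * (d k / \<alpha>)"
      by (intro mult_left_mono) auto
    moreover have "(\<integral>y. \<bar>resid (\<lambda>x. ln (f x) - ln (F k x)) y\<bar> \<partial>gaussian) \<le> ?K * (\<integral>x. \<bar>ln (f x) - ln (F k x)\<bar> \<partial>gaussian)"
      using integral_abs_resid_le[OF ld] by (simp add: add.commute)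
    moreover have "?K * (d k / \<alpha>) = ?K / \<alpha> * d k" by simp
    ultimately show ?thesis using 1 by linarith
  qed
  \<comment> \<open>The smooth stability estimate solved for the entropy of the k-th approximation,
    with the Fisher information replaced by its bound \<open>I k\<close> and the residual norm by
    that of f up to the L1 error.\<close>
  define \<rho> where "\<rho> k = I k / 2 + m k * ln (m k) - \<eta> * ((x - ?K / \<alpha> * d k) / ?C - \<eta>)" for k
  define \<rho>0 where "\<rho>0 = ?I0 / 2 - \<eta> * (x / ?C - \<eta>)"
  have "\<rho> \<longlonglongrightarrow> ?I0 / 2 + 1 * ln 1 - \<eta> * ((x - ?K / \<alpha> * 0) / ?C - \<eta>)"
    unfolding \<rho>_def by (intro tendsto_intros I m L1[folded d_def]) (use C in auto)
  then have \<rho>: "\<rho> \<longlonglongrightarrow> \<rho>0" by (simp add: \<rho>0_def)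
  have H_le: "\<forall>\<^sub>F k in sequentially. H k \<le> \<rho> k"
  proof -
    have "\<forall>\<^sub>F k in sequentially. m k < 2" by (rule order_tendstoD(2)[OF m]) simp
    then show ?thesis
    proof eventually_elim
      case (elim k)
      interpret sd: smooth_density "F k" \<alpha> by (rule F)
      have "x - ?K / \<alpha> * d k \<le> ?C * (\<eta> + sd.deficit / \<eta>)"
        using sd.smooth_stability[OF _ \<eta>] elim x_le[of k] unfolding m_def by simp
      then have "(x - ?K / \<alpha> * d k) / ?C \<le> \<eta> + sd.deficit / \<eta>"
        using C by (simp add: pos_divide_le_eq mult.commute)
      then have "\<eta> * ((x - ?K / \<alpha> * d k) / ?C - \<eta>) \<le> \<eta> * (sd.deficit / \<eta>)"
        using \<eta> by (intro mult_left_mono) auto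
      also have "\<dots> = sd.deficit" using \<eta> by simp
      also have "\<dots> \<le> I k / 2 - H k + m k * ln (m k)"
        unfolding sd.deficit_eq using FI[of k] by (simp add: m_def H_def)
      finally show ?case by (simp add: \<rho>_def)
    qed
  qed
  have H_ge: "- 1 \<le> H k" for k
  proof -
    have "(\<integral>(x :: real ^ 'n). - 1 \<partial>gaussian) \<le> H k"
      unfolding H_def
    proof (rule integral_mono)
      show "integrable gaussian (\<lambda>x. F k x * ln (F k x))"
        by (intro bsmooth_integrable bsmooth_mult Fs bsmooth_ln[OF Fs \<alpha> Fge])
      show "- 1 \<le> F k x * ln (F k x)" for x using Fge[of k x] \<alpha> by (intro entropy_integrand_ge) simp
    qed simp
    then show ?thesis by simp
  qed
  \<comment> \<open>Lets the bound from Fatou's lemma be read back in the reals: in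
    \<open>ennreal\<close> a negative right-hand side would be cut to 0.\<close>
  have \<rho>0_ge: "- 1 \<le> \<rho>0"
    by (rule tendsto_lowerbound[OF \<rho>]) (use H_le H_ge in \<open>auto elim!: eventually_mono intro: order_trans\<close>)
  obtain s where s: "strict_mono s" "AE x in gaussian. (\<lambda>k. F (s k) x - f x) \<longlonglongrightarrow> 0"
    using tendsto_L1_AE_subseq[of gaussian "\<lambda>k x. F k x - f x"] Fi fi L1 by auto
  have fatou: "(\<integral>\<^sup>+x. ennreal (f x * ln (f x) + 1) \<partial>gaussian) \<le> ennreal (\<rho>0 + 1)"
  proof -
    have "(\<integral>\<^sup>+x. ennreal (f x * ln (f x) + 1) \<partial>gaussian)
        = (\<integral>\<^sup>+x. liminf (\<lambda>k. ennreal (F (s k) x * ln (F (s k) x) + 1)) \<partial>gaussian)"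
    proof (rule nn_integral_cong_AE)
      show "AE x in gaussian. ennreal (f x * ln (f x) + 1) = liminf (\<lambda>k. ennreal (F (s k) x * ln (F (s k) x) + 1))"
        using s(2)
      proof eventually_elim
        case (elim x)
        have fx: "f x \<noteq> 0" using f_ge[of x] \<alpha> by auto
        have "(\<lambda>k. F (s k) x) \<longlonglongrightarrow> f x" using elim by (simp add: LIM_zero_iff)
        then have "(\<lambda>k. ennreal (F (s k) x * ln (F (s k) x) + 1)) \<longlonglongrightarrow> ennreal (f x * ln (f x) + 1)"
          by (intro tendsto_intros tendsto_ennrealI fx)
        then show ?case by (simp add: lim_imp_Liminf)
      qed
    qed
    also have "\<dots> \<le> liminf (\<lambda>k. \<integral>\<^sup>+x. ennreal (F (s k) x * ln (F (s k) x) + 1) \<partial>gaussian)"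
      by (rule nn_integral_liminf) simp
    also have "\<dots> \<le> liminf (\<lambda>k. ennreal (\<rho> (s k) + 1))"
    proof (rule Liminf_mono)
      have "\<forall>\<^sub>F k in sequentially. H (s k) \<le> \<rho> (s k)"
        using H_le s(1) by (rule eventually_subseq[rotated])
      then show "\<forall>\<^sub>F k in sequentially. (\<integral>\<^sup>+x. ennreal (F (s k) x * ln (F (s k) x) + 1) \<partial>gaussian) \<le> ennreal (\<rho> (s k) + 1)"
      proof eventually_elim
        case (elim k)
        have i: "integrable gaussian (\<lambda>x. F (s k) x * ln (F (s k) x))"
          by (intro bsmooth_integrable bsmooth_mult Fs bsmooth_ln[OF Fs \<alpha> Fge])
        have "0 \<le> F (s k) x * ln (F (s k) x) + 1" for x
          using entropy_integrand_ge[of "F (s k) x"] Fge[of "s k" x] \<alpha> by simp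
        then have "(\<integral>\<^sup>+x. ennreal (F (s k) x * ln (F (s k) x) + 1) \<partial>gaussian) = ennreal (\<integral>x. F (s k) x * ln (F (s k) x) + 1 \<partial>gaussian)"
          using i by (intro nn_integral_eq_integral) auto
        also have "\<dots> = ennreal (H (s k) + 1)" using i by (simp add: H_def)
        also have "\<dots> \<le> ennreal (\<rho> (s k) + 1)" using elim by (intro ennreal_leI) simp
        finally show ?case .
      qed
    qed
    also have "(\<lambda>k. ennreal (\<rho> (s k) + 1)) \<longlonglongrightarrow> ennreal (\<rho>0 + 1)"
      using LIMSEQ_subseq_LIMSEQ[OF \<rho> s(1)] by (intro tendsto_ennrealI tendsto_intros) (simp add: comp_def)
    then have "liminf (\<lambda>k. ennreal (\<rho> (s k) + 1)) = ennreal (\<rho>0 + 1)" by (intro lim_imp_Liminf) simp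
    finally show ?thesis .
  qed
  have ent0: "0 \<le> f x * ln (f x) + 1" for x
    using entropy_integrand_ge[of "f x"] f_ge[of x] \<alpha> by simp
  have i1: "integrable gaussian (\<lambda>x. f x * ln (f x) + 1)"
    using le_less_trans[OF fatou] ent0 by (intro integrableI_nonneg) auto
  from Bochner_Integration.integrable_diff[OF this, of "\<lambda>_. 1"]
  have i2: "integrable gaussian (\<lambda>x. f x * ln (f x))" by simp
  have "ennreal (\<integral>x. f x * ln (f x) + 1 \<partial>gaussian) \<le> ennreal (\<rho>0 + 1)"
    using fatou ent0 by (subst (asm) nn_integral_eq_integral[OF i1]) auto
  then have "(\<integral>x. f x * ln (f x) + 1 \<partial>gaussian) \<le> \<rho>0 + 1"
    using \<rho>0_ge by (subst (asm) ennreal_le_iff) auto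
  then have "(\<integral>x. f x * ln (f x) \<partial>gaussian) \<le> \<rho>0" using i2 by simp
  then have "\<eta> * (x / ?C - \<eta>) \<le> ?I0 / 2 - (\<integral>x. f x * ln (f x) \<partial>gaussian)" by (simp add: \<rho>0_def)
  then have "x / ?C - \<eta> \<le> (?I0 / 2 - (\<integral>x. f x * ln (f x) \<partial>gaussian)) / \<eta>"
    using \<eta> by (simp add: pos_le_divide_eq mult.commute)
  then have "x / ?C \<le> \<eta> + (?I0 / 2 - (\<integral>x. f x * ln (f x) \<partial>gaussian)) / \<eta>" by simp
  then show ?thesis using C by (simp add: pos_divide_le_eq x_def mult.commute)
qed

text \<open>The chosen \<open>weak_gradient\<close> is known only through its defining property;
  this supplies the measurability needed to replace it by another representative under the
  integral.\<close>

lemma locally_integrable_measurable: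
  fixes f :: "real ^ 'n \<Rightarrow> 'b::{banach, second_countable_topology}"
  assumes "locally_integrable f" shows "f \<in> borel_measurable borel"
proof (rule borel_measurable_LIMSEQ_metric)
  have "integrable lborel (\<lambda>x. indicator (cball 0 (real k)) x *\<^sub>R f x)" for k :: nat
    using assms compact_cball unfolding locally_integrable_def set_integrable_def by blast
  from borel_measurable_integrable[OF this]
  show "(\<lambda>x. indicator (cball 0 (real k)) x *\<^sub>R f x) \<in> borel_measurable borel" for k by simp
  fix x :: "real ^ 'n"
  obtain k0 :: nat where k0: "norm x \<le> real k0" using real_arch_simple by blast
  show "(\<lambda>k. indicator (cball 0 (real k)) x *\<^sub>R f x) \<longlonglongrightarrow> f x"
    by (rule tendsto_eventually, rule eventually_sequentiallyI[of k0]) (use k0 in simp)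
qed

text \<open>The affine function consists of the \<open>slope\<close> and the mean of ln f. Both are
  bounded through the L1 norm of ln f, which is at most 2 |ln \<alpha>| for mass 1.\<close>

theorem theorem1p6:
  fixes \<alpha> :: real
  assumes "0 < \<alpha>" and "\<alpha> \<le> 1"
  shows "\<exists>C>0. \<exists>c>0. \<forall>f :: real ^ 'n \<Rightarrow> real.
           gaussian_prob_density f \<longrightarrow>
           centered (density gaussian (\<lambda>x. ennreal (f x))) \<longrightarrow>
           gaussian_W12 (\<lambda>x. sqrt (f x)) \<longrightarrow>
           (AE x in gaussian. \<alpha> \<le> f x) \<longrightarrow>
           (\<exists>(a :: real ^ 'n) (b :: real). norm a + \<bar>b\<bar> \<le> c \<and>
              gaussian_L1_norm (\<lambda>x. ln (f x) - (a \<bullet> x + b))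
                \<le> ennreal (C * sqrt (log_sobolev_deficit f)))"
proof -
  let ?N = "real CARD('n)" and ?B = "2 * \<bar>ln \<alpha>\<bar>"
  let ?S = "stability_const (real CARD('n)) \<alpha>"
  \<comment> \<open>In \<open>?C\<close> the first summand serves deficits up to 1, where \<eta> is
    the root of the deficit; the second is the trivial bound on the residual and serves larger ones.
    In \<open>?c\<close> the slope contributes 4 n \<open>?B\<close> and the mean \<open>?B\<close>;
    the 1 ensures positivity when \<alpha> = 1.\<close>
  let ?C = "2 * ?S + (4 * ?N + 2) * ?B" and ?c = "(4 * ?N + 1) * ?B + 1"
  have C0: "0 < ?S" using assms by (intro stability_const_pos) auto
  have C: "0 < ?C" and c: "0 < ?c" using C0 by (intro add_pos_nonneg add_nonneg_pos mult_nonneg_nonneg mult_pos_pos; simp)+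
  have "\<exists>(a :: real ^ 'n) (b :: real). norm a + \<bar>b\<bar> \<le> ?c \<and>
      gaussian_L1_norm (\<lambda>x. ln (f x) - (a \<bullet> x + b)) \<le> ennreal (?C * sqrt (log_sobolev_deficit f))"
    if f: "gaussian_prob_density f" and W: "gaussian_W12 (\<lambda>x. sqrt (f x))" and fge: "AE x in gaussian. \<alpha> \<le> f x"
    for f :: "real ^ 'n \<Rightarrow> real"
  proof -
    have fm [measurable]: "f \<in> borel_measurable borel" using f by (simp add: gaussian_prob_density_def)
    \<comment> \<open>A representative with the lower bound at every point; the change on a null set
      affects neither the deficit nor the norm.\<close>
    define f0 where "f0 x = max \<alpha> (f x)" for x
    have f0m [measurable]: "f0 \<in> borel_measurable borel" unfolding f0_def by measurable
    have f0ge: "\<alpha> \<le> f0 x" for x by (simp add: f0_def)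
    have eq: "AE x in gaussian. f x = f0 x" using fge by eventually_elim (simp add: f0_def)
    then have eql: "AE x in lborel. f x = f0 x" by (simp add: lebesgue_gaussian_AE)
    interpret \<mu>: prob_space "density gaussian (\<lambda>x. ennreal (f x))" using f by (simp add: gaussian_prob_density_def)
    have "(\<integral>\<^sup>+x. ennreal (f0 x) \<partial>gaussian) = (\<integral>\<^sup>+x. ennreal (f x) \<partial>gaussian)"
      using eq by (intro nn_integral_cong_AE) auto
    also have "\<dots> = 1" using \<mu>.emeasure_space_1 by (simp add: emeasure_density)
    finally have nn1: "(\<integral>\<^sup>+x. ennreal (f0 x) \<partial>gaussian) = 1" .
    have f0p: "0 \<le> f0 x" for x using f0ge[of x] assms by simp
    have f0i: "integrable gaussian f0" using nn1 f0p by (intro integrableI_nonneg) auto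
    have mass: "(\<integral>x. f0 x \<partial>gaussian) = 1"
      using nn1 f0p by (subst (asm) nn_integral_eq_integral[OF f0i]) auto
    obtain g where g: "has_weak_gradient (\<lambda>x. sqrt (f x)) g" "integrable gaussian (\<lambda>x. (norm (g x))\<^sup>2)"
      and u2: "integrable gaussian (\<lambda>x. (sqrt (f x))\<^sup>2)"
      using W by (auto simp: gaussian_W12_def)
    define G0 where "G0 x = (2 * sqrt (f x)) *\<^sub>R g x" for x
    have sq: "has_weak_gradient (\<lambda>x. (sqrt (f x))\<^sup>2) G0"
      unfolding G0_def by (rule has_weak_gradient_square[OF g(1) u2 g(2)])
    \<comment> \<open>In HOL \<open>sqrt\<close> is extended to negative arguments as an odd
      function, so squaring it recovers f only where f is nonnegative, that is, almost
      everywhere.\<close>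
    have "AE x in lborel. (sqrt (f x))\<^sup>2 = f x"
      using eql by eventually_elim (use f0p in auto)
    then have Gf: "has_weak_gradient f G0"
      by (intro has_weak_gradient_cong_AE[OF sq _ fm]) simp_all
    have Gf0: "has_weak_gradient f0 G0"
      by (rule has_weak_gradient_cong_AE[OF Gf fm f0m eql])
    have wG: "has_weak_gradient f (weak_gradient f)"
      unfolding weak_gradient_def using Gf by (rule someI[of "has_weak_gradient f"])
    have Geq: "AE x in gaussian. weak_gradient f x = G0 x"
      using weak_gradient_unique[OF wG Gf] by (simp add: lebesgue_gaussian_AE)
    have [measurable]: "weak_gradient f \<in> borel_measurable borel"
      using wG by (auto simp: has_weak_gradient_def intro: locally_integrable_measurable)
    have [measurable]: "G0 \<in> borel_measurable borel" "g \<in> borel_measurable borel"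
      using Gf g by (auto simp: has_weak_gradient_def intro: locally_integrable_measurable)
    have Gi: "integrable gaussian (\<lambda>x. (norm (G0 x))\<^sup>2 / f0 x)"
    proof (rule integrable_cong_AE_imp)
      show "integrable gaussian (\<lambda>x. 4 * (norm (g x))\<^sup>2)" using g(2) by simp
      show "AE x in gaussian. 4 * (norm (g x))\<^sup>2 = (norm (G0 x))\<^sup>2 / f0 x"
        using eq
      proof eventually_elim
        case (elim x)
        have "0 < f0 x" using f0ge[of x] assms by simp
        then show ?case by (simp add: G0_def elim power_mult_distrib)
      qed
    qed simp
    have fisher: "fisher_information f = (\<integral>x. (norm (G0 x))\<^sup>2 / f0 x \<partial>gaussian)"
      unfolding fisher_information_def
      by (intro integral_cong_AE) (use Geq eq in auto)
    have entropy: "relative_entropy f = (\<integral>x. f0 x * ln (f0 x) \<partial>gaussian)"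
      unfolding relative_entropy_def by (intro integral_cong_AE) (use eq in auto)
    let ?\<delta> = "log_sobolev_deficit f" and ?h = "\<lambda>x. ln (f0 x)"
    define x where "x = (\<integral>x. \<bar>resid ?h x\<bar> \<partial>gaussian)"
    have x_le: "x \<le> ?S * (\<eta> + ?\<delta> / \<eta>)" if "0 < \<eta>" "\<eta> \<le> 1" for \<eta>
      using sobolev_stability[OF assms(1) f0ge f0m Gf0 f0i mass Gi that]
      by (simp add: x_def log_sobolev_deficit_def fisher entropy)
    note hi = ln_integrable(1)[OF assms(1) f0ge f0i]
    have hB: "(\<integral>x. \<bar>?h x\<bar> \<partial>gaussian) \<le> ?B"
      using ln_integrable(2)[OF assms(1) f0ge f0i] mass by simp
    have x0: "0 \<le> x" unfolding x_def by simp
    have "x \<le> ?C * sqrt ?\<delta>"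
    proof -
      consider "?\<delta> < 0" | "?\<delta> = 0" | "0 < ?\<delta>" "?\<delta> \<le> 1" | "1 < ?\<delta>" by linarith
      then show ?thesis
      proof cases
        case 1
        \<comment> \<open>This choice gives \<eta>^2 + \<delta> < 0, so the upper bound on the
          nonnegative x would be negative: a negative deficit is contradictory, which is the
          log-Sobolev inequality for f.\<close>
        define \<eta> where "\<eta> = min 1 (- ?\<delta> / 2)"
        have \<eta>: "0 < \<eta>" "\<eta> \<le> 1" using 1 by (auto simp: \<eta>_def)
        have "\<eta> * \<eta> \<le> 1 * (- ?\<delta> / 2)" using \<eta> by (intro mult_mono) (auto simp: \<eta>_def)
        then have "\<eta> * \<eta> + ?\<delta> < 0" using 1 by simp
        then have "(\<eta> * \<eta> + ?\<delta>) / \<eta> < 0" using \<eta>(1) by (rule divide_neg_pos)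
        then have "\<eta> + ?\<delta> / \<eta> < 0" using \<eta>(1) by (simp add: add_divide_distrib)
        then have "?S * (\<eta> + ?\<delta> / \<eta>) < 0" using C0 by (simp add: mult_pos_neg)
        with x_le[OF \<eta>] x0 show ?thesis by simp
      next
        case 2
        have "x \<le> 0 + \<epsilon>" if \<epsilon>: "0 < \<epsilon>" for \<epsilon>
        proof -
          define \<eta> where "\<eta> = min 1 (\<epsilon> / ?S)"
          have \<eta>: "0 < \<eta>" "\<eta> \<le> 1" using \<epsilon> C0 by (auto simp: \<eta>_def)
          have "?S * \<eta> \<le> ?S * (\<epsilon> / ?S)" using C0 by (intro mult_left_mono) (auto simp: \<eta>_def)
          with x_le[OF \<eta>] 2 C0 show ?thesis by simp
        qed
        then have "x \<le> 0" by (rule field_le_epsilon)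
        with 2 show ?thesis by simp
      next
        case 3
        \<comment> \<open>The root of the deficit balances \<eta> against \<delta> / \<eta> and is
          admissible because the deficit is at most 1.\<close>
        then have \<eta>: "0 < sqrt ?\<delta>" "sqrt ?\<delta> \<le> 1" by auto
        have "x \<le> ?S * (sqrt ?\<delta> + ?\<delta> / sqrt ?\<delta>)" by (rule x_le[OF \<eta>])
        also have "\<dots> = 2 * ?S * sqrt ?\<delta>" using 3 by (simp add: real_div_sqrt)
        also have "\<dots> \<le> ?C * sqrt ?\<delta>" using \<eta> by (intro mult_right_mono) auto
        finally show ?thesis .
      next
        case 4
        have "x \<le> (4 * ?N + 2) * (\<integral>x. \<bar>?h x\<bar> \<partial>gaussian)" using integral_abs_resid_le[OF hi] by (simp add: x_def add.commute)
        also have "\<dots> \<le> (4 * ?N + 2) * ?B" by (intro mult_left_mono hB) auto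
        also have "\<dots> \<le> ?C * 1" using C0 by simp
        also have "\<dots> \<le> ?C * sqrt ?\<delta>" using C 4 by (intro mult_left_mono) auto
        finally show ?thesis .
      qed
    qed
    moreover have "gaussian_L1_norm (\<lambda>x. ln (f x) - (slope ?h \<bullet> x + (\<integral>y. ?h y \<partial>gaussian))) = ennreal x"
    proof -
      have "gaussian_L1_norm (\<lambda>x. ln (f x) - (slope ?h \<bullet> x + (\<integral>y. ?h y \<partial>gaussian))) = (\<integral>\<^sup>+x. ennreal \<bar>resid ?h x\<bar> \<partial>gaussian)"
        unfolding gaussian_L1_norm_def resid_def by (rule nn_integral_cong_AE) (use eq in auto)
      also have "\<dots> = ennreal x"
        unfolding x_def by (intro nn_integral_eq_integral integrable_abs resid_integrable hi) simp
      finally show ?thesis .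
    qed
    moreover have "norm (slope ?h) + \<bar>\<integral>y. ?h y \<partial>gaussian\<bar> \<le> ?c"
    proof -
      have "norm (slope ?h) \<le> (\<Sum>i\<in>UNIV. \<bar>slope ?h $ i\<bar>)" by (rule norm_le_l1_cart)
      also have "\<dots> \<le> (\<Sum>i\<in>(UNIV :: 'n set). 4 * ?B)"
        by (intro sum_mono order_trans[OF slope_bound[OF hi]] mult_left_mono hB) simp
      also have "\<dots> = 4 * ?N * ?B" by simp
      finally have "norm (slope ?h) \<le> 4 * ?N * ?B" .
      moreover have "\<bar>\<integral>y. ?h y \<partial>gaussian\<bar> \<le> ?B"
        using integral_abs_bound[of gaussian ?h] hB by linarith
      ultimately show ?thesis by (simp add: algebra_simps)
    qed
    ultimately show ?thesis
      by (intro exI[of _ "slope ?h"] exI[of _ "\<integral>y. ?h y \<partial>gaussian"] conjI) (auto intro: ennreal_leI)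
  qed
  then show ?thesis
    using C c by (intro exI[of _ ?C] exI[of _ ?c] conjI allI impI) auto
qed

end
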